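(* For a simple orientable matroid $M$, the order of the pole of $\operatorname{Mag}(M;q)$ at $q=-1$ is $\lambda(M)$, and $$\lim_{q\to-1}(1+q)^{\lambda(M)}\operatorname{Mag}(M;q)>0.$$ This pole order also equals, for every orientation of $M$, the Varchenko--Gelfand degree over $\mathbb R$ of the tope parity function $B\mapsto\prod_{e\in E}B_e$, where the signs $B_e$ are identified with $1$ and $-1$.
   Context: All matroids are finite; $\mathbb N=\mathbb Z_{\ge0}$. For a matroid $M$ on $E$ with rank function $r_M$ and $r(M)=r_M(E)$, $\chi_M(x)=\sum_{S\subseteq E}(-1)^{|S|}x^{r(M)-r_M(S)}$. For $w\in\mathbb N^E$ put $|w|=\sum_ew_e$, $\operatorname{wt}_M(w)=\max_B\sum_{e\in B}w_e$ over bases $B$; the maximizing bases are the bases of the initial matroid $M_w$. The motivic zeta function is $Z_M(x,T)=\sum_{w\in\mathbb N^E}\chi_{M_w}(x)x^{-r(M)-\operatorname{wt}_M(w)}T^{|w|}\in\mathbb Z[x^{\pm1}][[T]]$, and the magnitude of $M$ is $\operatorname{Mag}(M;q)=Z_M(-1,q)\in\mathbb Z[[q]]$, which is (the expansion at $0$ of) a rational function in $q$. The pole order is $0$ if the function is regular at the point. For a loopless matroid $M$, $\lambda(M)$ is the maximum $p\ge 0$ for which there is a chain of flats $\varnothing=F_0\subsetneq F_1\subsetneq\cdots\subsetneq F_p$ with $r_M(F_i)=i$ for all $i$ and $|F_i\setminus F_{i-1}|$ odd for all $i\geq 1$. The chain need not end at $E$. An oriented matroid on $E$ is given by a covector set $\mathcal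 L\subseteq\{+,0,-\}^E$ (containing $0$, closed under negation and composition, satisfying strong elimination); its underlying matroid has as flats the zero sets of covectors; $M$ is orientable if it underlies an oriented matroid, called an orientation of $M$. For loopless $M$ the topes are the covectors with no zero coordinate. The Varchenko--Gelfand degree over $\mathbb R$ of a function $f$ from the set of topes to $\mathbb R$ is the least $k$ such that $f$ lies in the real span of the functions $\prod_{e\in S}h_e$ with $S\subseteq E$, $|S|\le k$, where $h_e(B)=1$ if $B_e=+$ and $h_e(B)=0$ if $B_e=-$ (equivalently, in the span of the functions $B\mapsto\prod_{e\in S}B_e$, $|S|\le k$). *)

theory Defs
  imports "HOL-Complex_Analysis.Complex_Analysis"
begin

section \<open>Matroids\<close>

text \<open>
  A finite matroid is given by its ground set and its set of bases. Bases are the primitive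
  notion because initial matroids are described by their bases.
\<close>

locale matroid =
  fixes E :: "'a set" and \<B> :: "'a set set"
  assumes finite_ground: "finite E"
    and bases_nonempty: "\<B> \<noteq> {}"
    and bases_subset: "B \<in> \<B> \<Longrightarrow> B \<subseteq> E"
    and basis_exchange:
      "\<lbrakk>B1 \<in> \<B>; B2 \<in> \<B>; e \<in> B1 - B2\<rbrakk> \<Longrightarrow> \<exists>f\<in>B2 - B1. insert f (B1 - {e}) \<in> \<B>"

definition rank :: "'a set set \<Rightarrow> 'a set \<Rightarrow> nat" where
  "rank \<B> S = Max ((\<lambda>B. card (B \<inter> S)) ` \<B>)"

definition flat :: "'a set \<Rightarrow> 'a set set \<Rightarrow> 'a set \<Rightarrow> bool" where
  "flat E \<B> F \<longleftrightarrow> F \<subseteq> E \<and> (\<forall>e\<in>E - F. rank \<B> F < rank \<B> (insert e F))"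

definition loopless :: "'a set \<Rightarrow> 'a set set \<Rightarrow> bool" where
  "loopless E \<B> \<longleftrightarrow> (\<forall>e\<in>E. rank \<B> {e} = 1)"

definition simple_matroid :: "'a set \<Rightarrow> 'a set set \<Rightarrow> bool" where
  "simple_matroid E \<B> \<longleftrightarrow> matroid E \<B> \<and> loopless E \<B> \<and>
     (\<forall>e\<in>E. \<forall>f\<in>E. e \<noteq> f \<longrightarrow> rank \<B> {e, f} = 2)"

definition char_poly_at :: "'a set \<Rightarrow> 'a set set \<Rightarrow> 'b::comm_ring_1 \<Rightarrow> 'b" where
  "char_poly_at E \<B> x = (\<Sum>S\<in>Pow E. (-1) ^ card S * x ^ (rank \<B> E - rank \<B> S))"


section \<open>Motivic zeta function and magnitude\<close>

definition wt :: "'a set set \<Rightarrow> ('a \<Rightarrow> nat) \<Rightarrow> nat" where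
  "wt \<B> w = Max ((\<lambda>B. sum w B) ` \<B>)"

definition initial_bases :: "'a set set \<Rightarrow> ('a \<Rightarrow> nat) \<Rightarrow> 'a set set" where
  "initial_bases \<B> w = {B \<in> \<B>. sum w B = wt \<B> w}"

text \<open>
  A vector indexed by the ground set is a function vanishing outside of it, so that
  distinct functions are distinct vectors.
\<close>

definition weights_of_size :: "'a set \<Rightarrow> nat \<Rightarrow> ('a \<Rightarrow> nat) set" where
  "weights_of_size E n = {w. (\<forall>e. e \<notin> E \<longrightarrow> w e = 0) \<and> sum w E = n}"

text \<open>
  The zeta function as a power series in the second variable. Its coefficients are Laurent
  polynomials in the first variable, evaluated here at a nonzero element \<open>x\<close> of an arbitrary
  field; the formal Laurent polynomials are recovered by taking \<open>x = fls_X\<close> in \<open>rat fls\<close>.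
\<close>

definition motivic_zeta :: "'a set \<Rightarrow> 'a set set \<Rightarrow> 'b::field \<Rightarrow> 'b fps" where
  "motivic_zeta E \<B> x = Abs_fps (\<lambda>n. \<Sum>w\<in>weights_of_size E n.
     char_poly_at E (initial_bases \<B> w) x * x powi (- int (rank \<B> E) - int (wt \<B> w)))"

definition magnitude :: "'a set \<Rightarrow> 'a set set \<Rightarrow> complex fps" where
  "magnitude E \<B> = motivic_zeta E \<B> (- 1)"

definition rational_function :: "(complex \<Rightarrow> complex) \<Rightarrow> bool" where
  "rational_function f \<longleftrightarrow> (\<exists>P Q. Q \<noteq> 0 \<and> f = (\<lambda>z. poly P z / poly Q z))"

definition pole_order :: "(complex \<Rightarrow> complex) \<Rightarrow> complex \<Rightarrow> nat" where
  "pole_order f z = (if is_pole f z then nat (- zorder f z) else 0)"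


section \<open>Odd chains of flats\<close>

definition odd_flat_chain :: "'a set \<Rightarrow> 'a set set \<Rightarrow> nat \<Rightarrow> (nat \<Rightarrow> 'a set) \<Rightarrow> bool" where
  "odd_flat_chain E \<B> p F \<longleftrightarrow> F 0 = {} \<and>
     (\<forall>i\<le>p. flat E \<B> (F i) \<and> rank \<B> (F i) = i) \<and>
     (\<forall>i<p. F i \<subset> F (Suc i) \<and> odd (card (F (Suc i) - F i)))"

definition odd_chain_length :: "'a set \<Rightarrow> 'a set set \<Rightarrow> nat" where
  "odd_chain_length E \<B> = Max {p. \<exists>F. odd_flat_chain E \<B> p F}"


section \<open>Oriented matroids\<close>

text \<open>Signs are the integers \<open>1\<close>, \<open>0\<close>, \<open>-1\<close>, and sign vectors vanish outside the ground set.\<close>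

definition sign_vectors :: "'a set \<Rightarrow> ('a \<Rightarrow> int) set" where
  "sign_vectors E = {X. (\<forall>e. X e \<in> {-1, 0, 1}) \<and> (\<forall>e. e \<notin> E \<longrightarrow> X e = 0)}"

definition sign_comp :: "('a \<Rightarrow> int) \<Rightarrow> ('a \<Rightarrow> int) \<Rightarrow> 'a \<Rightarrow> int" where
  "sign_comp X Y = (\<lambda>e. if X e \<noteq> 0 then X e else Y e)"

definition separation :: "('a \<Rightarrow> int) \<Rightarrow> ('a \<Rightarrow> int) \<Rightarrow> 'a set" where
  "separation X Y = {e. X e \<noteq> 0 \<and> X e = - Y e}"

locale oriented_matroid =
  fixes E :: "'a set" and \<L> :: "('a \<Rightarrow> int) set"
  assumes finite_ground: "finite E"
    and covectors_sign: "\<L> \<subseteq> sign_vectors E"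
    and zero_covector: "(\<lambda>e. 0) \<in> \<L>"
    and neg_covector: "X \<in> \<L> \<Longrightarrow> (\<lambda>e. - X e) \<in> \<L>"
    and comp_covector: "\<lbrakk>X \<in> \<L>; Y \<in> \<L>\<rbrakk> \<Longrightarrow> sign_comp X Y \<in> \<L>"
    and strong_elimination:
      "\<lbrakk>X \<in> \<L>; Y \<in> \<L>; e \<in> separation X Y\<rbrakk> \<Longrightarrow>
         \<exists>Z\<in>\<L>. Z e = 0 \<and> (\<forall>f\<in>E - separation X Y. Z f = sign_comp X Y f)"

definition zero_set :: "'a set \<Rightarrow> ('a \<Rightarrow> int) \<Rightarrow> 'a set" where
  "zero_set E X = {e \<in> E. X e = 0}"

definition orientation :: "'a set \<Rightarrow> 'a set set \<Rightarrow> ('a \<Rightarrow> int) set \<Rightarrow> bool" where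
  "orientation E \<B> \<L> \<longleftrightarrow>
     matroid E \<B> \<and> oriented_matroid E \<L> \<and> {F. flat E \<B> F} = zero_set E ` \<L>"

definition orientable :: "'a set \<Rightarrow> 'a set set \<Rightarrow> bool" where
  "orientable E \<B> \<longleftrightarrow> (\<exists>\<L>. orientation E \<B> \<L>)"

definition topes :: "'a set \<Rightarrow> ('a \<Rightarrow> int) set \<Rightarrow> ('a \<Rightarrow> int) set" where
  "topes E \<L> = {B \<in> \<L>. \<forall>e\<in>E. B e \<noteq> 0}"


section \<open>Varchenko--Gelfand degree\<close>

definition heaviside :: "'a \<Rightarrow> ('a \<Rightarrow> int) \<Rightarrow> real" where
  "heaviside e B = (if B e = 1 then 1 else 0)"

text \<open>
  Membership of \<open>f\<close>, as a function on topes, in the real span of the products of at most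
  \<open>k\<close> Heaviside functions; values of \<open>f\<close> outside the topes are irrelevant.
\<close>

definition vg_filtration ::
  "'a set \<Rightarrow> ('a \<Rightarrow> int) set \<Rightarrow> nat \<Rightarrow> (('a \<Rightarrow> int) \<Rightarrow> real) \<Rightarrow> bool" where
  "vg_filtration E \<L> k f \<longleftrightarrow> (\<exists>c :: 'a set \<Rightarrow> real. \<forall>B\<in>topes E \<L>.
     f B = (\<Sum>S | S \<subseteq> E \<and> card S \<le> k. c S * (\<Prod>e\<in>S. heaviside e B)))"

definition vg_degree :: "'a set \<Rightarrow> ('a \<Rightarrow> int) set \<Rightarrow> (('a \<Rightarrow> int) \<Rightarrow> real) \<Rightarrow> nat" where
  "vg_degree E \<L> f = (LEAST k. vg_filtration E \<L> k f)"

definition tope_parity :: "'a set \<Rightarrow> ('a \<Rightarrow> int) \<Rightarrow> real" where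
  "tope_parity E B = (\<Prod>e\<in>E. real_of_int (B e))"

end

theory Submission
  imports Defs
begin

text \<open>
  For an orientation with set of topes \<open>T\<close>, the magnitude is the sum of the entries of the inverse of
  the Varchenko matrix \<open>q\<^bsup>d(B,C)\<^esup>\<close> on \<open>T\<close>, where \<open>d\<close> counts separating elements: both sides satisfy
  the same recursion over the covectors. For \<open>q = -s\<close> with \<open>0 < s < 1\<close>, conjugation by the parity function
  turns the matrix into \<open>s\<^bsup>d(B,C)\<^esup>\<close>, the restriction to \<open>T\<close> of a kernel on the cube that is diagonal in
  the monomials \<open>\<Prod>e\<in>S. B e\<close>, with eigenvalues of order \<open>(1 - s)\<^bsup>card S\<^esup>\<close>. So the magnitude is a
  positive definite quadratic form evaluated at the parity function, and it grows like
  \<open>(1 - s)\<^bsup>-k\<^esup>\<close> for the least degree \<open>k\<close> of a polynomial that agrees with the parity function on \<open>T\<close>.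
  A function on \<open>T\<close> has degree less than \<open>p\<close> iff its alternating sums over the cubes of topes attached to
  chains of flats of length \<open>p\<close> vanish; for the parity function such a sum is nonzero exactly
  when all differences in the chain are odd.
\<close>

section \<open>Rank function of a matroid and its initial matroids\<close>

text \<open>The weightings exist only for real \<open>q\<close> of absolute value below 1, so the
  point \<open>-1\<close> itself is out of their reach. Rationality bridges the gap: for a rational
  function, two-sided bounds along the single ray \<open>q = -s\<close> already force the pole
  order, and a positive lower bound forces a positive limit, so no leading coefficient has to be
  computed. Orientations enter the recursion for the magnitude only through a count. Up to sign, the
  characteristic polynomial of a minor at \<open>-1\<close> is a number of covectors with a given
  zero set, and this follows from the Euler characteristic of open cones of covectors. Cubes of
  topes come from chains of flats with arbitrary rank gaps, whereas \<lambda> asks for steps of rank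
  one. The covers of a flat partition what lies above it, and a parity count then yields an odd
  chain of the same length without gaps. Since this length depends on the matroid alone, one
  orientation suffices for the analytic part.\<close>

context matroid
begin

lemma finite_bases: "finite \<B>"
  by (rule finite_subset[of _ "Pow E"]) (use bases_subset finite_ground in auto)

lemma finite_basis: "B \<in> \<B> \<Longrightarrow> finite B"
  using bases_subset finite_ground finite_subset by blast

lemma card_basis_le:
  assumes "B1 \<in> \<B>" "B2 \<in> \<B>"
  shows "card B1 \<le> card B2"
  using assms
proof (induction "card (B1 - B2)" arbitrary: B1 rule: less_induct)
  case less
  show ?case
  proof (cases "B1 \<subseteq> B2")
    case True
    then show ?thesis
      using less.prems finite_basis card_mono by blast
  next
    case False
    then obtain e where e: "e \<in> B1 - B2" by blast
    obtain f where f: "f \<in> B2 - B1" "insert f (B1 - {e}) \<in> \<B>"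
      using basis_exchange[OF less.prems e] by blast
    have fin: "finite B1" using less.prems finite_basis by blast
    have "insert f (B1 - {e}) - B2 \<subset> B1 - B2" using e f by auto
    then have "card (insert f (B1 - {e}) - B2) < card (B1 - B2)"
      using fin by (simp add: psubset_card_mono)
    have "card (insert f (B1 - {e})) = card B1"
      using e f(1) fin card_Suc_Diff1[of B1 e] by simp
    with less.hyps[OF \<open>card (insert f (B1 - {e}) - B2) < card (B1 - B2)\<close> f(2) less.prems(2)]
    show ?thesis by simp
  qed
qed

lemma card_basis: "B1 \<in> \<B> \<Longrightarrow> B2 \<in> \<B> \<Longrightarrow> card B1 = card B2"
  using card_basis_le by (meson order_antisym)

text \<open>While \<open>B1\<close> meets \<open>A\<close> less often than \<open>B2\<close> does,
  equal cardinality gives \<open>B1\<close> more elements outside \<open>A\<close>, so some element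
  of \<open>B1 - B2\<close> outside \<open>A\<close> can be exchanged. This never shrinks
  \<open>B1 \<inter> A\<close> and brings \<open>B1\<close> closer to \<open>B2\<close>.\<close>

lemma basis_augment:
  assumes "B1 \<in> \<B>" "B2 \<in> \<B>"
  shows "\<exists>B\<in>\<B>. B1 \<inter> A \<subseteq> B \<and> card (B2 \<inter> A) \<le> card (B \<inter> A)"
  using assms
proof (induction "card (B1 - B2)" arbitrary: B1 rule: less_induct)
  case less
  show ?case
  proof (cases "card (B2 \<inter> A) \<le> card (B1 \<inter> A)")
    case True
    then show ?thesis using less.prems by blast
  next
    case False
    have fin: "finite B1" "finite B2" using less.prems finite_basis by auto
    have "card (B1 - A) > card (B2 - A)"
      using False card_basis[OF less.prems] card_Int_Diff[OF fin(1), of A] card_Int_Diff[OF fin(2), of A]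
      by linarith
    then have "\<not> B1 - A \<subseteq> B2 - A"
      using card_mono[of "B2 - A" "B1 - A"] fin by auto
    then obtain e where e: "e \<in> B1 - B2" "e \<notin> A" by blast
    obtain f where f: "f \<in> B2 - B1" "insert f (B1 - {e}) \<in> \<B>"
      using basis_exchange[OF less.prems e(1)] by blast
    have "insert f (B1 - {e}) - B2 \<subset> B1 - B2" using e f by auto
    then have "card (insert f (B1 - {e}) - B2) < card (B1 - B2)"
      using fin by (simp add: psubset_card_mono)
    from less.hyps[OF this f(2) less.prems(2)]
    show ?thesis using e(2) by blast
  qed
qed

lemma card_Int_le_rank: "B \<in> \<B> \<Longrightarrow> card (B \<inter> S) \<le> rank \<B> S"
  unfolding rank_def using finite_bases by (intro Max_ge) auto

lemma rank_attained: "\<exists>B\<in>\<B>. card (B \<inter> S) = rank \<B> S"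
proof -
  have "rank \<B> S \<in> (\<lambda>B. card (B \<inter> S)) ` \<B>"
    unfolding rank_def using finite_bases bases_nonempty by (intro Max_in) auto
  then show ?thesis by auto
qed

text \<open>Augmentation on a larger set keeps the traces on the smaller ones, so one basis can be
  optimal on a whole chain. Submodularity and the level-by-level analysis of weights both rest on
  this.\<close>

lemma rank_attained_chain:
  assumes "mono A"
  shows "\<exists>B\<in>\<B>. \<forall>i\<le>m. card (B \<inter> A i) = rank \<B> (A (i::nat))"
proof (induction m)
  case 0
  then show ?case using rank_attained by simp
next
  case (Suc m)
  then obtain B1 where B1: "B1 \<in> \<B>" "\<forall>i\<le>m. card (B1 \<inter> A i) = rank \<B> (A i)" by blast
  obtain B2 where B2: "B2 \<in> \<B>" "card (B2 \<inter> A (Suc m)) = rank \<B> (A (Suc m))"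
    using rank_attained by blast
  obtain B where B: "B \<in> \<B>" "B1 \<inter> A (Suc m) \<subseteq> B" "card (B2 \<inter> A (Suc m)) \<le> card (B \<inter> A (Suc m))"
    using basis_augment[OF B1(1) B2(1)] by blast
  have "card (B \<inter> A i) = rank \<B> (A i)" if "i \<le> Suc m" for i
  proof (cases "i = Suc m")
    case True
    then show ?thesis using B B2 card_Int_le_rank[OF B(1)] by (simp add: order_antisym)
  next
    case False
    then have "i \<le> m" using that by simp
    have "A i \<subseteq> A (Suc m)" using assms that by (rule monoD)
    then have "card (B1 \<inter> A i) \<le> card (B \<inter> A i)"
      using B(1,2) finite_basis by (intro card_mono) auto
    then show ?thesis using B1(2) \<open>i \<le> m\<close> card_Int_le_rank[OF B(1)] by (simp add: order_antisym)
  qed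
  then show ?case using B(1) by blast
qed

lemma rank_attained_pair:
  assumes "S \<subseteq> T"
  shows "\<exists>B\<in>\<B>. card (B \<inter> S) = rank \<B> S \<and> card (B \<inter> T) = rank \<B> T"
proof -
  define A where "A i = (if i = 0 then S else T)" for i :: nat
  have "mono A" using assms by (auto simp: mono_def A_def)
  from rank_attained_chain[OF this, of 1] obtain B where
    B: "B \<in> \<B>" "\<forall>i\<le>1. card (B \<inter> A i) = rank \<B> (A i)"
    by blast
  then have "card (B \<inter> A 0) = rank \<B> (A 0)" "card (B \<inter> A 1) = rank \<B> (A 1)" by auto
  with B(1) show ?thesis unfolding A_def by auto
qed

lemma rank_empty: "rank \<B> {} = 0"
  using rank_attained[of "{}"] by auto

lemma rank_insert_ge: "rank \<B> S \<le> rank \<B> (insert e S)"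
proof -
  obtain B where B: "B \<in> \<B>" "card (B \<inter> S) = rank \<B> S" using rank_attained by blast
  have "card (B \<inter> S) \<le> card (B \<inter> insert e S)" using B finite_basis by (intro card_mono) auto
  then show ?thesis using B card_Int_le_rank[OF B(1), of "insert e S"] by linarith
qed

lemma rank_insert_le: "rank \<B> (insert e S) \<le> Suc (rank \<B> S)"
proof -
  obtain B where B: "B \<in> \<B>" "card (B \<inter> insert e S) = rank \<B> (insert e S)" using rank_attained by blast
  have "card (B \<inter> insert e S) \<le> card (insert e (B \<inter> S))" using B finite_basis by (intro card_mono) auto
  also have "\<dots> \<le> Suc (card (B \<inter> S))" by (rule card_insert_le_m1) auto
  finally show ?thesis using B card_Int_le_rank[OF B(1), of S] by linarith
qed

lemma rank_submodular: "rank \<B> (S \<union> T) + rank \<B> (S \<inter> T) \<le> rank \<B> S + rank \<B> T"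
proof -
  obtain B where B: "B \<in> \<B>" "card (B \<inter> (S \<inter> T)) = rank \<B> (S \<inter> T)" "card (B \<inter> (S \<union> T)) = rank \<B> (S \<union> T)"
    using rank_attained_pair[of "S \<inter> T" "S \<union> T"] by blast
  have "card (B \<inter> S) + card (B \<inter> T) = card (B \<inter> (S \<union> T)) + card (B \<inter> (S \<inter> T))"
    using card_Un_Int[of "B \<inter> S" "B \<inter> T"] finite_basis[OF B(1)]
    by (simp add: Int_Un_distrib Int_assoc Int_left_commute)
  then show ?thesis using B card_Int_le_rank[OF B(1), of S] card_Int_le_rank[OF B(1), of T] by linarith
qed

section \<open>Initial matroids through the level sets of a weight\<close>

lemma sum_level_sets:
  fixes w :: "'a \<Rightarrow> nat"
  assumes "finite B" "\<forall>e\<in>B. w e \<le> K"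
  shows "sum w B = (\<Sum>i<K. card (B \<inter> {e. i < w e}))"
proof -
  have "sum w B = (\<Sum>e\<in>B. \<Sum>i<K. if i < w e then 1 else 0)"
  proof (rule sum.cong)
    fix e assume "e \<in> B"
    then have "w e \<le> K" using assms by blast
    then have "{..<K} \<inter> {i. i < w e} = {..<w e}" by auto
    then show "w e = (\<Sum>i<K. if i < w e then 1 else 0)" by (simp add: sum.If_cases)
  qed simp
  also have "\<dots> = (\<Sum>i<K. \<Sum>e\<in>B. if i < w e then 1 else 0)" by (rule sum.swap)
  also have "\<dots> = (\<Sum>i<K. card (B \<inter> {e. i < w e}))" using assms(1) by (simp add: sum.If_cases)
  finally show ?thesis .
qed

context
  fixes w :: "'a \<Rightarrow> nat" and K :: nat
  assumes w_less: "\<And>e. w e < K"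
begin

lemma weight_basis: "B \<in> \<B> \<Longrightarrow> sum w B = (\<Sum>i<K. card (B \<inter> {e. i < w e}))"
  using finite_basis w_less by (intro sum_level_sets) (auto intro: less_imp_le)

lemma weight_le: "B \<in> \<B> \<Longrightarrow> sum w B \<le> (\<Sum>i<K. rank \<B> {e. i < w e})"
  by (simp add: weight_basis sum_mono card_Int_le_rank)

text \<open>
  The level sets of \<open>2 w + 1\<^sub>S\<close> refine those of \<open>w\<close>, so a basis of full rank on all of them is
  of maximal \<open>w\<close>-weight and, among these bases, meets \<open>S\<close> as often as possible.
\<close>

lemma weight_chain_basis:
  "\<exists>B\<in>\<B>. \<forall>i<K. card (B \<inter> {e. i < w e}) = rank \<B> {e. i < w e} \<and>
     card (B \<inter> ({e. i < w e} \<union> S \<inter> {e. w e = i})) = rank \<B> ({e. i < w e} \<union> S \<inter> {e. w e = i})"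
proof -
  define v where "v e = 2 * w e + (if e \<in> S then 1 else 0)" for e
  \<comment> \<open>\<open>A j\<close> is the superlevel set of \<open>v\<close> at the threshold
    \<open>2 * K - j\<close>, hence increasing in \<open>j\<close>. The threshold
    \<open>2 * i + 2\<close> cuts out the elements with \<open>i < w e\<close>, and
    \<open>2 * i + 1\<close> adds the elements of \<open>S\<close> of weight exactly
    \<open>i\<close>.\<close>
  define A where "A j = {e. 2 * K \<le> v e + j}" for j
  have "mono A" unfolding A_def mono_def by auto
  from rank_attained_chain[OF this, of "2 * K"]
  obtain B where B: "B \<in> \<B>" "\<forall>j\<le>2 * K. card (B \<inter> A j) = rank \<B> (A j)" by blast
  have "{e. i < w e} = A (2 * (K - i - 1))" if "i < K" for i
    using that by (auto simp: A_def v_def)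
  moreover have "{e. i < w e} \<union> S \<inter> {e. w e = i} = A (2 * (K - i - 1) + 1)" if "i < K" for i
    using that by (auto simp: A_def v_def split: if_splits)
  ultimately show ?thesis using B by (intro bexI[of _ B]) auto
qed

lemma wt_eq: "wt \<B> w = (\<Sum>i<K. rank \<B> {e. i < w e})"
proof -
  obtain B where B: "B \<in> \<B>" "\<forall>i<K. card (B \<inter> {e. i < w e}) = rank \<B> {e. i < w e}"
    using weight_chain_basis by blast
  then have "sum w B = (\<Sum>i<K. rank \<B> {e. i < w e})"
    using weight_basis by simp
  then show ?thesis
    unfolding wt_def using B(1) weight_le finite_bases by (intro Max_eqI) force+
qed

lemma initial_bases_level:
  assumes "B \<in> initial_bases \<B> w" "i < K"
  shows "card (B \<inter> {e. i < w e}) = rank \<B> {e. i < w e}"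
proof (rule ccontr)
  assume ne: "\<not> ?thesis"
  have B: "B \<in> \<B>" "sum w B = wt \<B> w" using assms by (auto simp: initial_bases_def)
  have "sum w B = (\<Sum>i<K. card (B \<inter> {e. i < w e}))"
    using weight_basis[OF B(1)] by simp
  also have "\<dots> < (\<Sum>i<K. rank \<B> {e. i < w e})"
    using ne assms(2) card_Int_le_rank[OF B(1)]
    by (intro sum_strict_mono_ex1) (auto intro!: bexI[of _ i] simp: order_less_le)
  finally show False using B(2) wt_eq by simp
qed

text \<open>This is the rank function of a direct sum of minors, one for each level. An initial
  basis has full rank on every level set, so its trace on \<open>S\<close> within a level is at most
  the rank increment there; the basis from \<open>weight_chain_basis\<close> attains all these
  bounds at once.\<close>

lemma rank_initial_bases:
  "rank (initial_bases \<B> w) S =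
     (\<Sum>i<K. rank \<B> ({e. i < w e} \<union> S \<inter> {e. w e = i}) - rank \<B> {e. i < w e})"
proof -
  have split: "card (B \<inter> S) =
      (\<Sum>i<K. card (B \<inter> ({e. i < w e} \<union> S \<inter> {e. w e = i})) - card (B \<inter> {e. i < w e}))"
    if "B \<in> \<B>" for B
  proof -
    have fin: "finite B" using that finite_basis by blast
    have "card (B \<inter> S) = card (\<Union>i\<in>{..<K}. B \<inter> S \<inter> {e. w e = i})"
      using w_less by (intro arg_cong[of _ _ card]) auto
    also have "\<dots> = (\<Sum>i<K. card (B \<inter> S \<inter> {e. w e = i}))"
      using fin by (intro card_UN_disjoint) auto
    also have "\<dots> = (\<Sum>i<K. card (B \<inter> ({e. i < w e} \<union> S \<inter> {e. w e = i})) - card (B \<inter> {e. i < w e}))"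
    proof (rule sum.cong)
      fix i
      have "B \<inter> ({e. i < w e} \<union> S \<inter> {e. w e = i}) = (B \<inter> {e. i < w e}) \<union> (B \<inter> S \<inter> {e. w e = i})"
        by auto
      moreover have "card \<dots> = card (B \<inter> {e. i < w e}) + card (B \<inter> S \<inter> {e. w e = i})"
        using fin by (intro card_Un_disjoint) auto
      ultimately show "card (B \<inter> S \<inter> {e. w e = i}) =
          card (B \<inter> ({e. i < w e} \<union> S \<inter> {e. w e = i})) - card (B \<inter> {e. i < w e})" by simp
    qed simp
    finally show ?thesis .
  qed
  obtain B where B: "B \<in> \<B>" "\<forall>i<K. card (B \<inter> {e. i < w e}) = rank \<B> {e. i < w e} \<and>
     card (B \<inter> ({e. i < w e} \<union> S \<inter> {e. w e = i})) = rank \<B> ({e. i < w e} \<union> S \<inter> {e. w e = i})"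
    using weight_chain_basis by blast
  have "sum w B = wt \<B> w"
    using weight_basis[OF B(1)] B(2) wt_eq by simp
  then have Bi: "B \<in> initial_bases \<B> w" using B(1) by (simp add: initial_bases_def)
  have "card (B \<inter> S) = (\<Sum>i<K. rank \<B> ({e. i < w e} \<union> S \<inter> {e. w e = i}) - rank \<B> {e. i < w e})"
    using split[OF B(1)] B(2) by simp
  moreover have "card (B' \<inter> S) \<le>
      (\<Sum>i<K. rank \<B> ({e. i < w e} \<union> S \<inter> {e. w e = i}) - rank \<B> {e. i < w e})"
    if "B' \<in> initial_bases \<B> w" for B'
  proof -
    have B': "B' \<in> \<B>" using that by (simp add: initial_bases_def)
    show ?thesis unfolding split[OF B']
      using initial_bases_level[OF that] card_Int_le_rank[OF B'] by (intro sum_mono) (simp add: diff_le_mono)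
  qed
  moreover have "finite (initial_bases \<B> w)"
    using finite_bases by (simp add: initial_bases_def)
  ultimately show ?thesis
    unfolding rank_def[of "initial_bases \<B> w"] using Bi by (intro Max_eqI) force+
qed

end

lemma rank_ground: "B \<in> \<B> \<Longrightarrow> rank \<B> E = card B"
  using rank_attained[of E] bases_subset card_basis by (metis Int_absorb2)

lemma rank_initial_ground: "rank (initial_bases \<B> w) E = rank \<B> E"
proof -
  have fin: "finite (initial_bases \<B> w)"
    using finite_bases by (simp add: initial_bases_def)
  have "wt \<B> w \<in> sum w ` \<B>"
    unfolding wt_def using finite_bases bases_nonempty by (intro Max_in) auto
  then obtain B where B: "B \<in> initial_bases \<B> w" by (auto simp: initial_bases_def)
  have "card (B' \<inter> E) = rank \<B> E" if "B' \<in> initial_bases \<B> w" for B'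
    using that rank_ground bases_subset by (metis (no_types, lifting) Int_absorb2 initial_bases_def mem_Collect_eq)
  then show ?thesis
    unfolding rank_def[of "initial_bases \<B> w"] using B fin by (intro Max_eqI) force+
qed

end

section \<open>The magnitude as a rational function\<close>

text \<open>
  Up to sign this is the characteristic polynomial of the minor \<open>(M|E)/A\<close> at \<open>-1\<close>. It vanishes if the
  minor has a loop, that is, if \<open>A\<close> is not a flat of \<open>M|E\<close>.
\<close>

definition interval_char :: "('a set \<Rightarrow> nat) \<Rightarrow> 'a set \<Rightarrow> 'a set \<Rightarrow> int" where
  "interval_char r A E = (\<Sum>S\<in>Pow (E - A). (- 1) ^ (card S + r (A \<union> S) + r A))"

text \<open>
  The contribution of \<open>w\<close> to the zeta function at \<open>x = -1\<close>: the initial matroid is the direct sum of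
  the minors between consecutive level sets \<open>{w \<ge> i + 1} \<subseteq> {w \<ge> i}\<close>. The first argument is any
  strict upper bound on the values of \<open>w\<close>.
\<close>

primrec weight_coeff :: "('a set \<Rightarrow> nat) \<Rightarrow> nat \<Rightarrow> 'a set \<Rightarrow> ('a \<Rightarrow> nat) \<Rightarrow> int" where
  "weight_coeff r 0 A w = 1"
| "weight_coeff r (Suc K) A w =
     (- 1) ^ r {e\<in>A. 0 < w e} * interval_char r {e\<in>A. 0 < w e} A *
     weight_coeff r K {e\<in>A. 0 < w e} (\<lambda>e. w e - 1)"

lemma interval_char_self: "interval_char r A A = 1"
  by (simp add: interval_char_def flip: mult_2)

lemma sum_Pow_split:
  assumes "finite A" "A1 \<subseteq> A"
  shows "(\<Sum>S\<in>Pow A. f S) = (\<Sum>S0\<in>Pow (A - A1). \<Sum>S1\<in>Pow A1. f (S0 \<union> S1))"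
proof -
  have "(\<Sum>S\<in>Pow A. f S) = (\<Sum>(S0, S1)\<in>Pow (A - A1) \<times> Pow A1. f (S0 \<union> S1))"
    by (rule sum.reindex_bij_witness[where i = "\<lambda>(S0, S1). S0 \<union> S1" and j = "\<lambda>S. (S - A1, S \<inter> A1)"])
       (use assms in \<open>auto simp: Un_Diff_Int\<close>)
  then show ?thesis by (simp add: sum.cartesian_product)
qed

text \<open>The product is the sign coming from \<open>wt\<close>, the sum that of the
  characteristic polynomial, up to a global sign. The level sets of \<open>w - 1\<close> on the
  support of \<open>w\<close> are those of \<open>w\<close> shifted by one, so the factor of level 0
  splits off.\<close>

lemma weight_coeff_eq:
  assumes "finite A" "\<forall>e\<in>A. w e < K"
  shows "(\<Prod>i<K. (- 1) ^ r {e\<in>A. i < w e}) * (\<Sum>S\<in>Pow A. (- 1) ^ (card S +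
      (\<Sum>i<K. r ({e\<in>A. i < w e} \<union> S \<inter> {e. w e = i}) + r {e\<in>A. i < w e}))) = weight_coeff r K A w"
  using assms
proof (induction K arbitrary: A w)
  case 0
  then have "A = {}" by auto
  then show ?case by simp
next
  case (Suc K)
  define A1 where "A1 = {e\<in>A. 0 < w e}"
  define w1 where "w1 e = w e - 1" for e
  have A1: "A1 \<subseteq> A" "finite A1" "\<forall>e\<in>A1. w1 e < K"
    using Suc.prems by (auto simp: A1_def w1_def)
  have level: "{e\<in>A. Suc i < w e} = {e\<in>A1. i < w1 e}" for i
    by (auto simp: A1_def w1_def)
  have factor: "(- 1) ^ (card (S0 \<union> S1) + (\<Sum>i<Suc K. r ({e\<in>A. i < w e} \<union> (S0 \<union> S1) \<inter> {e. w e = i})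
        + r {e\<in>A. i < w e})) =
      (- 1) ^ (card S0 + r (A1 \<union> S0) + r A1) *
      (- 1 :: int) ^ (card S1 + (\<Sum>i<K. r ({e\<in>A1. i < w1 e} \<union> S1 \<inter> {e. w1 e = i}) + r {e\<in>A1. i < w1 e}))"
    if "S0 \<in> Pow (A - A1)" "S1 \<in> Pow A1" for S0 S1
  proof -
    have "card (S0 \<union> S1) = card S0 + card S1"
      using that Suc.prems(1) A1(2) by (intro card_Un_disjoint) (auto intro: finite_subset)
    moreover have "(S0 \<union> S1) \<inter> {e. w e = 0} = S0" using that by (auto simp: A1_def)
    moreover have "(S0 \<union> S1) \<inter> {e. w e = Suc i} = S1 \<inter> {e. w1 e = i}" for i
      using that by (auto simp: A1_def w1_def)
    ultimately show ?thesis
      unfolding sum.lessThan_Suc_shift level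
      by (simp add: A1_def[symmetric] power_add ac_simps)
  qed
  have "(\<Sum>S\<in>Pow A. (- 1) ^ (card S +
      (\<Sum>i<Suc K. r ({e\<in>A. i < w e} \<union> S \<inter> {e. w e = i}) + r {e\<in>A. i < w e}))) =
      interval_char r A1 A * (\<Sum>S\<in>Pow A1. (- 1) ^ (card S +
      (\<Sum>i<K. r ({e\<in>A1. i < w1 e} \<union> S \<inter> {e. w1 e = i}) + r {e\<in>A1. i < w1 e})))"
    unfolding sum_Pow_split[OF Suc.prems(1) A1(1)] interval_char_def sum_product
    by (intro sum.cong refl factor)
  moreover have "(\<Prod>i<Suc K. (- 1) ^ r {e\<in>A. i < w e}) =
      (- 1 :: int) ^ r A1 * (\<Prod>i<K. (- 1) ^ r {e\<in>A1. i < w1 e})"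
    unfolding prod.lessThan_Suc_shift level by (simp add: A1_def)
  ultimately show ?case
    using Suc.IH[OF A1(2,3)] by (simp add: A1_def w1_def mult.assoc mult.left_commute)
qed

text \<open>Surplus levels are empty and contribute \<open>1\<close>. This frees the coefficient
  from the particular bound, which changes when the support of the weight is split off.\<close>

lemma weight_coeff_mono:
  assumes "r {} = 0" "\<forall>e\<in>A. w e < K" "K \<le> K'"
  shows "weight_coeff r K' A w = weight_coeff r K A w"
  using assms(2,3)
proof (induction K' arbitrary: K A w)
  case (Suc K')
  show ?case
  proof (cases K)
    case 0
    then have "A = {}" using Suc.prems by auto
    then show ?thesis using Suc.IH[of "{}" "\<lambda>e. w e - 1" 0] 0 assms(1)
      by (simp add: interval_char_self)
  next
    case (Suc K0)
    have "\<forall>e\<in>{e\<in>A. 0 < w e}. w e - 1 < K0" using Suc.prems Suc by auto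
    with Suc show ?thesis
      using Suc.IH[of "{e\<in>A. 0 < w e}" "\<lambda>e. w e - 1" K0] Suc.prems by simp
  qed
qed simp

lemma finite_weights_of_size:
  assumes "finite A"
  shows "finite (weights_of_size A n)"
proof (rule finite_subset)
  show "finite {w. \<forall>e. (e \<in> A \<longrightarrow> w e \<in> {..n}) \<and> (e \<notin> A \<longrightarrow> w e = 0)}"
    using assms by (intro finite_set_of_finite_funs) auto
  show "weights_of_size A n \<subseteq> {w. \<forall>e. (e \<in> A \<longrightarrow> w e \<in> {..n}) \<and> (e \<notin> A \<longrightarrow> w e = 0)}"
    using assms by (auto simp: weights_of_size_def intro: member_le_sum)
qed

lemma weights_of_size_less:
  assumes "finite A" "w \<in> weights_of_size A n"
  shows "w e < Suc n"
  using assms by (cases "e \<in> A") (auto simp: weights_of_size_def less_Suc_eq_le intro: member_le_sum)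

definition magnitude_fps :: "('a set \<Rightarrow> nat) \<Rightarrow> 'a set \<Rightarrow> complex fps" where
  "magnitude_fps r A =
     Abs_fps (\<lambda>n. of_int (\<Sum>w\<in>weights_of_size A n. weight_coeff r (Suc n) A w))"

lemma minus_one_power_diff: "b \<le> a \<Longrightarrow> (- 1 :: 'b::ring_1) ^ (a - b) = (- 1) ^ (a + b)"
  by (simp add: minus_one_power_iff)

text \<open>At \<open>x = -1\<close> only parities of exponents matter, so differences of ranks may
  be replaced by sums. The sign of \<open>rank \<B> E\<close> occurs once in the characteristic
  polynomial and once in the power of \<open>x\<close>, and cancels.\<close>

lemma (in matroid) magnitude_eq_magnitude_fps: "magnitude E \<B> = magnitude_fps (rank \<B>) E"
proof -
  have "char_poly_at E (initial_bases \<B> w) (- 1 :: complex) * (- 1) powi (- int (rank \<B> E) - int (wt \<B> w)) =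
      of_int (weight_coeff (rank \<B>) (Suc n) E w)" if w: "w \<in> weights_of_size E n" for n w
  proof -
    define K where "K = Suc n"
    have less: "w e < K" for e using weights_of_size_less[OF finite_ground w] by (simp add: K_def)
    have level: "{e. i < w e} = {e\<in>E. i < w e}" for i
      using w by (auto simp: weights_of_size_def dest: gr_implies_not0)
    have mono: "rank \<B> A \<le> rank \<B> (A \<union> C)" for A C
    proof -
      obtain B where B: "B \<in> \<B>" "card (B \<inter> A) = rank \<B> A" using rank_attained by blast
      have "card (B \<inter> A) \<le> card (B \<inter> (A \<union> C))" using B(1) finite_basis by (intro card_mono) auto
      then show ?thesis using B card_Int_le_rank[OF B(1), of "A \<union> C"] by linarith
    qed
    have rank_sign: "(- 1 :: int) ^ (rank \<B> E - rank (initial_bases \<B> w) S) =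
        (- 1) ^ rank \<B> E * (- 1) ^ (\<Sum>i<K. rank \<B> ({e\<in>E. i < w e} \<union> S \<inter> {e. w e = i}) + rank \<B> {e\<in>E. i < w e})"
      if "S \<subseteq> E" for S
    proof -
      have "rank (initial_bases \<B> w) S \<le> rank \<B> E"
      proof -
        have "wt \<B> w \<in> sum w ` \<B>"
          unfolding wt_def using finite_bases bases_nonempty by (intro Max_in) auto
        then have "initial_bases \<B> w \<noteq> {}" by (auto simp: initial_bases_def)
        moreover have "finite (initial_bases \<B> w)" using finite_bases by (simp add: initial_bases_def)
        moreover have "card (B \<inter> S) \<le> rank \<B> E" if "B \<in> initial_bases \<B> w" for B
        proof -
          have B: "B \<in> \<B>" using that by (simp add: initial_bases_def)
          show ?thesis using rank_ground[OF B] finite_basis[OF B] by (simp add: card_mono)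
        qed
        ultimately show ?thesis unfolding rank_def[of "initial_bases \<B> w"] by simp
      qed
      then have "(- 1 :: int) ^ (rank \<B> E - rank (initial_bases \<B> w) S) =
          (- 1) ^ rank \<B> E * (- 1) ^ rank (initial_bases \<B> w) S"
        by (simp add: minus_one_power_diff power_add)
      also have "(- 1 :: int) ^ rank (initial_bases \<B> w) S =
          (- 1) ^ (\<Sum>i<K. rank \<B> ({e\<in>E. i < w e} \<union> S \<inter> {e. w e = i}) + rank \<B> {e\<in>E. i < w e})"
        using mono unfolding rank_initial_bases[of w K, OF less] level power_sum
        by (simp add: minus_one_power_diff)
      finally show ?thesis .
    qed
    have wt_sign: "(- 1 :: complex) powi (- int (rank \<B> E) - int (wt \<B> w)) =
        of_int ((- 1) ^ rank \<B> E * (\<Prod>i<K. (- 1) ^ rank \<B> {e\<in>E. i < w e}))"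
    proof -
      have "- int (rank \<B> E) - int (wt \<B> w) = - int (rank \<B> E + wt \<B> w)" by simp
      then have "(- 1 :: complex) powi (- int (rank \<B> E) - int (wt \<B> w)) = (- 1) ^ (rank \<B> E + wt \<B> w)"
        by (simp only: power_int_minus power_int_of_nat) (simp flip: power_inverse)
      moreover have "wt \<B> w = (\<Sum>i<K. rank \<B> {e\<in>E. i < w e})" using wt_eq[of w K, OF less] level by simp
      ultimately show ?thesis by (simp add: power_add power_sum)
    qed
    have "char_poly_at E (initial_bases \<B> w) (- 1 :: complex) =
        of_int (\<Sum>S\<in>Pow E. (- 1) ^ card S * (- 1) ^ (rank \<B> E - rank (initial_bases \<B> w) S))"
      by (simp add: char_poly_at_def rank_initial_ground)
    also have "(\<Sum>S\<in>Pow E. (- 1) ^ card S * (- 1) ^ (rank \<B> E - rank (initial_bases \<B> w) S)) =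
        (- 1 :: int) ^ rank \<B> E * (\<Sum>S\<in>Pow E. (- 1) ^ (card S +
         (\<Sum>i<K. rank \<B> ({e\<in>E. i < w e} \<union> S \<inter> {e. w e = i}) + rank \<B> {e\<in>E. i < w e})))"
      unfolding sum_distrib_left by (intro sum.cong refl) (simp add: rank_sign power_add)
    finally show ?thesis
      unfolding wt_sign K_def[symmetric] of_int_mult[symmetric]
      using less by (simp add: mult_ac flip: weight_coeff_eq[OF finite_ground, of w K] power_add mult_2)
  qed
  then show ?thesis
    by (simp add: magnitude_def motivic_zeta_def magnitude_fps_def of_int_sum)
qed

section \<open>Recursion over the support of the weight\<close>

lemma sum_shift:
  fixes w :: "'a \<Rightarrow> nat"
  assumes "finite A"
  shows "sum w A = (\<Sum>e\<in>{e\<in>A. 0 < w e}. w e - 1) + card {e\<in>A. 0 < w e}"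
proof -
  have "sum w A = (\<Sum>e\<in>{e\<in>A. 0 < w e}. w e)"
    using assms by (intro sum.mono_neutral_right) auto
  also have "\<dots> = (\<Sum>e\<in>{e\<in>A. 0 < w e}. (w e - 1) + 1)" by (intro sum.cong) auto
  also have "\<dots> = (\<Sum>e\<in>{e\<in>A. 0 < w e}. w e - 1) + card {e\<in>A. 0 < w e}"
    unfolding sum.distrib card_eq_sum ..
  finally show ?thesis .
qed

text \<open>
  Sorting the weights \<open>w\<close> by their support \<open>A'\<close>, what remains is the weight \<open>w - 1\<close> on \<open>A'\<close>.
\<close>

lemma magnitude_fps_recursion:
  assumes "finite A" "r {} = 0"
  shows "magnitude_fps r A = (\<Sum>A'\<in>Pow A. fps_const (of_int ((- 1) ^ r A' * interval_char r A' A)) *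
     fps_X ^ card A' * magnitude_fps r A')"
proof (rule fps_ext)
  fix n
  have fin: "finite A'" if "A' \<in> Pow A" for A' using that assms(1) finite_subset by auto
  have "(\<Sum>w\<in>weights_of_size A n. weight_coeff r (Suc n) A w) =
      (\<Sum>(A', w')\<in>(SIGMA A':{A'\<in>Pow A. card A' \<le> n}. weights_of_size A' (n - card A')).
         (- 1) ^ r A' * interval_char r A' A * weight_coeff r (Suc (n - card A')) A' w')"
  proof (rule sum.reindex_bij_witness[where
        i = "\<lambda>(A', w') e. w' e + (if e \<in> A' then 1 else 0)" and
        j = "\<lambda>w. ({e\<in>A. 0 < w e}, \<lambda>e. w e - 1)"], goal_cases)
    case (1 w)
    then show ?case by (auto simp: weights_of_size_def fun_eq_iff)
  next
    case (2 w)
    let ?A = "{e\<in>A. 0 < w e}"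
    have "n = (\<Sum>e\<in>?A. w e - 1) + card ?A"
      using 2 sum_shift[OF assms(1), of w] by (simp add: weights_of_size_def)
    then show ?case using 2 by (auto simp: weights_of_size_def)
  next
    case (3 p)
    then obtain A' w' where p: "p = (A', w')" "A' \<subseteq> A" "w' \<in> weights_of_size A' (n - card A')" by auto
    then show ?case by (auto simp: weights_of_size_def fun_eq_iff)
  next
    case (4 p)
    then obtain A' w' where p: "p = (A', w')" "A' \<subseteq> A" "card A' \<le> n" "w' \<in> weights_of_size A' (n - card A')"
      by auto
    have "(\<Sum>e\<in>A. w' e + (if e \<in> A' then 1 else 0)) = (\<Sum>e\<in>A'. w' e + (if e \<in> A' then 1 else 0))"
      using p assms(1) by (intro sum.mono_neutral_right) (auto simp: weights_of_size_def)
    also have "\<dots> = sum w' A' + card A'" unfolding sum.distrib by simp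
    also have "\<dots> = n" using p by (simp add: weights_of_size_def)
    finally show ?case using p by (auto simp: weights_of_size_def)
  next
    case (5 w)
    let ?A = "{e\<in>A. 0 < w e}" and ?w = "\<lambda>e. w e - 1"
    have n: "w e < Suc n" for e using 5 weights_of_size_less[OF assms(1)] by blast
    \<comment> \<open>Lowering the bound needs \<open>Suc (n - card ?A) \<le> n\<close>, which fails
      for the empty support; that case is separate.\<close>
    have "weight_coeff r n ?A ?w = weight_coeff r (Suc (n - card ?A)) ?A ?w"
    proof (cases "?A = {}")
      case True
      have "weight_coeff r m {} v = 1" for m v
        using weight_coeff_mono[of r "{}" v 0 m] assms(2) by simp
      then show ?thesis unfolding True by (simp del: weight_coeff.simps)
    next
      case False
      then have "card ?A > 0" using assms(1) by (simp add: card_gt_0_iff)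
      have "?w \<in> weights_of_size ?A (n - card ?A)"
      proof -
        have "n = (\<Sum>e\<in>?A. w e - 1) + card ?A"
          using 5 sum_shift[OF assms(1), of w] by (simp add: weights_of_size_def)
        then show ?thesis using 5 by (auto simp: weights_of_size_def)
      qed
      then have "\<forall>e\<in>?A. ?w e < Suc (n - card ?A)"
        using weights_of_size_less[of ?A] assms(1) by fastforce
      moreover have "card ?A \<le> n"
      proof -
        have "card ?A = (\<Sum>e\<in>?A. 1)" by simp
        also have "\<dots> \<le> (\<Sum>e\<in>?A. w e)" by (intro sum_mono) auto
        also have "\<dots> \<le> (\<Sum>e\<in>A. w e)" using assms(1) by (intro sum_mono2) auto
        finally show ?thesis using 5 by (simp add: weights_of_size_def)
      qed
      ultimately show ?thesis
        using \<open>card ?A > 0\<close> assms(2) by (intro weight_coeff_mono) auto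
    qed
    then show ?case by simp
  qed
  also have "\<dots> = (\<Sum>A'\<in>{A'\<in>Pow A. card A' \<le> n}. \<Sum>w'\<in>weights_of_size A' (n - card A').
         (- 1) ^ r A' * interval_char r A' A * weight_coeff r (Suc (n - card A')) A' w')"
    using assms(1) finite_weights_of_size[OF fin] by (intro sum.Sigma[symmetric]) auto
  also have "\<dots> = (\<Sum>A'\<in>Pow A. if card A' \<le> n then (- 1) ^ r A' * interval_char r A' A *
         (\<Sum>w'\<in>weights_of_size A' (n - card A'). weight_coeff r (Suc (n - card A')) A' w') else 0)"
    using assms(1) by (intro sum.mono_neutral_cong_left) (auto simp: sum_distrib_left)
  finally have "magnitude_fps r A $ n = (\<Sum>A'\<in>Pow A. of_int (if card A' \<le> n then
      (- 1) ^ r A' * interval_char r A' A *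
      (\<Sum>w'\<in>weights_of_size A' (n - card A'). weight_coeff r (Suc (n - card A')) A' w') else 0))"
    unfolding magnitude_fps_def fps_nth_Abs_fps by (simp only: of_int_sum)
  also have "\<dots> = (\<Sum>A'\<in>Pow A. (fps_const (of_int ((- 1) ^ r A' * interval_char r A' A)) *
     fps_X ^ card A' * magnitude_fps r A') $ n)"
    by (intro sum.cong refl)
       (simp add: magnitude_fps_def mult.assoc fps_X_power_mult_nth del: weight_coeff.simps)
  finally show "magnitude_fps r A $ n = (\<Sum>A'\<in>Pow A. fps_const (of_int ((- 1) ^ r A' * interval_char r A' A)) *
     fps_X ^ card A' * magnitude_fps r A') $ n"
    by (simp only: fps_sum_nth)
qed

text \<open>Solving the power series recursion for its own term \<open>A' = A\<close> leaves this
  denominator, which for nonempty finite \<open>A\<close> has no zero in the open unit disc. The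
  value at infinite \<open>A\<close> is a default that lets the recursion run on
  \<open>card A\<close>.\<close>

function magnitude_fun :: "('a set \<Rightarrow> nat) \<Rightarrow> 'a set \<Rightarrow> complex \<Rightarrow> complex" where
  "magnitude_fun r A z = (if infinite A \<or> A = {} then 1 else
     (\<Sum>A'\<in>Pow A - {A}. of_int ((- 1) ^ r A' * interval_char r A' A) * z ^ card A' * magnitude_fun r A' z) /
     (1 - of_int ((- 1) ^ r A) * z ^ card A))"
  by auto
termination
  by (relation "Wellfounded.measure (\<lambda>(r, A, z). card A)") (auto intro: psubset_card_mono)

declare magnitude_fun.simps [simp del]

lemma magnitude_fun_denom:
  fixes z :: complex
  assumes "finite A" "A \<noteq> {}" "norm z < 1"
  shows "1 - of_int ((- 1) ^ n) * z ^ card A \<noteq> 0"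
proof
  assume "1 - of_int ((- 1) ^ n) * z ^ card A = 0"
  then have "norm (of_int ((- 1) ^ n) * z ^ card A) = 1" by simp
  moreover have "norm z ^ card A < 1"
    using assms power_strict_mono[of "norm z" 1 "card A"] by (simp add: card_gt_0_iff)
  ultimately show False by (simp add: norm_mult norm_power)
qed

lemma magnitude_fun_recursion:
  assumes "finite A" "A \<noteq> {}" "norm z < 1"
  shows "magnitude_fun r A z * (1 - of_int ((- 1) ^ r A) * z ^ card A) =
     (\<Sum>A'\<in>Pow A - {A}. of_int ((- 1) ^ r A' * interval_char r A' A) * z ^ card A' * magnitude_fun r A' z)"
  using magnitude_fun_denom[OF assms, of "r A"] assms(1,2)
  by (subst magnitude_fun.simps) (simp add: nonzero_eq_divide_eq)

lemma magnitude_fun_has_fps_expansion: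
  assumes "finite A" "r {} = 0"
  shows "magnitude_fun r A has_fps_expansion magnitude_fps r A"
  using assms(1)
proof (induction "card A" arbitrary: A rule: less_induct)
  case less
  let ?t = "fps_const (of_int ((- 1) ^ r A)) * fps_X ^ card A :: complex fps"
  have split: "magnitude_fps r A = (\<Sum>A'\<in>Pow A - {A}. fps_const (of_int ((- 1) ^ r A' * interval_char r A' A)) *
     fps_X ^ card A' * magnitude_fps r A') + ?t * magnitude_fps r A"
    by (subst magnitude_fps_recursion[of A r])
       (use less.prems assms(2) in \<open>simp_all add: sum.remove[of "Pow A" A] interval_char_self\<close>)
  show ?case
  proof (cases "A = {}")
    case True
    have "magnitude_fps r A = 1"
    proof (rule fps_ext)
      fix n
      have "weights_of_size {} n = (if n = 0 then {\<lambda>_. 0 :: nat} else {})"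
        by (auto simp: weights_of_size_def)
      then show "magnitude_fps r A $ n = 1 $ n"
        unfolding True magnitude_fps_def fps_nth_Abs_fps \<open>weights_of_size {} n = _\<close>
        using assms(2) by (simp add: interval_char_self)
    qed
    moreover have "magnitude_fun r A = (\<lambda>_. 1)"
      using True by (simp add: fun_eq_iff magnitude_fun.simps)
    ultimately show ?thesis by simp
  next
    case False
    have "card A > 0" using False less.prems by (simp add: card_gt_0_iff)
    then have nth: "(1 - ?t) $ 0 = 1" by (simp add: fps_mult_nth)
    then have ne: "1 - ?t \<noteq> 0" by (metis fps_zero_nth zero_neq_one)
    have "magnitude_fps r A = (\<Sum>A'\<in>Pow A - {A}. fps_const (of_int ((- 1) ^ r A' * interval_char r A' A)) *
     fps_X ^ card A' * magnitude_fps r A') / (1 - ?t)"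
    proof -
      have "magnitude_fps r A * (1 - ?t) = (\<Sum>A'\<in>Pow A - {A}. fps_const (of_int ((- 1) ^ r A' * interval_char r A' A)) *
     fps_X ^ card A' * magnitude_fps r A')"
        using split by (simp add: algebra_simps)
      then show ?thesis using ne by (metis nonzero_mult_div_cancel_right)
    qed
    moreover have "magnitude_fun r A = (\<lambda>z. (\<Sum>A'\<in>Pow A - {A}. of_int ((- 1) ^ r A' * interval_char r A' A) *
        z ^ card A' * magnitude_fun r A' z) / (1 - of_int ((- 1) ^ r A) * z ^ card A))"
      using False less.prems by (auto simp: fun_eq_iff intro: magnitude_fun.simps[THEN trans])
    moreover have "magnitude_fun r A' has_fps_expansion magnitude_fps r A'" if "A' \<in> Pow A - {A}" for A'
      using that less.prems by (intro less.hyps) (auto intro: psubset_card_mono finite_subset)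
    ultimately show ?thesis
      using nth by (auto intro!: has_fps_expansion_divide' has_fps_expansion_sum has_fps_expansion_mult
          has_fps_expansion_fps_X_power has_fps_expansion_const has_fps_expansion_diff simp del: of_int_mult of_int_power)
  qed
qed

text \<open>Denominators without zeros in the disc make this class closed under sums and products
  without any cancellation. Nothing is said outside the disc, but the expansion at 0 and the
  approach to \<open>-1\<close> along the real axis stay inside.\<close>

definition rational_on_disc :: "(complex \<Rightarrow> complex) \<Rightarrow> bool" where
  "rational_on_disc f \<longleftrightarrow> (\<exists>P Q. \<forall>z. norm z < 1 \<longrightarrow> poly Q z \<noteq> 0 \<and> f z = poly P z / poly Q z)"

lemma rational_on_disc_poly: "rational_on_disc (poly P)"
  unfolding rational_on_disc_def by (rule exI[of _ P], rule exI[of _ 1]) simp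

lemma rational_on_disc_add:
  assumes "rational_on_disc f" "rational_on_disc g"
  shows "rational_on_disc (\<lambda>z. f z + g z)"
proof -
  from assms obtain P Q P' Q' where
    "\<forall>z. norm z < 1 \<longrightarrow> poly Q z \<noteq> 0 \<and> f z = poly P z / poly Q z"
    "\<forall>z. norm z < 1 \<longrightarrow> poly Q' z \<noteq> 0 \<and> g z = poly P' z / poly Q' z"
    unfolding rational_on_disc_def by blast
  then show ?thesis unfolding rational_on_disc_def
    by (intro exI[of _ "P * Q' + P' * Q"] exI[of _ "Q * Q'"]) (simp add: add_frac_eq)
qed

lemma rational_on_disc_mult:
  assumes "rational_on_disc f" "rational_on_disc g"
  shows "rational_on_disc (\<lambda>z. f z * g z)"
proof -
  from assms obtain P Q P' Q' where
    "\<forall>z. norm z < 1 \<longrightarrow> poly Q z \<noteq> 0 \<and> f z = poly P z / poly Q z"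
    "\<forall>z. norm z < 1 \<longrightarrow> poly Q' z \<noteq> 0 \<and> g z = poly P' z / poly Q' z"
    unfolding rational_on_disc_def by blast
  then show ?thesis unfolding rational_on_disc_def
    by (intro exI[of _ "P * P'"] exI[of _ "Q * Q'"]) simp
qed

lemma rational_on_disc_sum:
  "(\<And>i. i \<in> I \<Longrightarrow> rational_on_disc (f i)) \<Longrightarrow> rational_on_disc (\<lambda>z. \<Sum>i\<in>I. f i z)"
proof (induction I rule: infinite_finite_induct)
  case (insert i I)
  then show ?case by (simp add: rational_on_disc_add)
next
  case empty
  have "poly 0 = (\<lambda>z :: complex. 0)" by auto
  then show ?case using rational_on_disc_poly[of 0] by simp
next
  case (infinite I)
  have "poly 0 = (\<lambda>z :: complex. 0)" by auto
  then show ?case using rational_on_disc_poly[of 0] infinite by simp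
qed

lemma rational_on_disc_divide:
  assumes "rational_on_disc f" "\<And>z. norm z < 1 \<Longrightarrow> poly R z \<noteq> 0"
  shows "rational_on_disc (\<lambda>z. f z / poly R z)"
proof -
  from assms(1) obtain P Q where "\<forall>z. norm z < 1 \<longrightarrow> poly Q z \<noteq> 0 \<and> f z = poly P z / poly Q z"
    unfolding rational_on_disc_def by blast
  then show ?thesis unfolding rational_on_disc_def
    using assms(2) by (intro exI[of _ P] exI[of _ "Q * R"]) simp
qed

lemma magnitude_fun_rational:
  assumes "finite A"
  shows "rational_on_disc (magnitude_fun r A)"
  using assms
proof (induction "card A" arbitrary: A rule: less_induct)
  case less
  show ?case
  proof (cases "A = {}")
    case True
    then have "magnitude_fun r A = poly 1" by (simp add: fun_eq_iff magnitude_fun.simps)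
    then show ?thesis using rational_on_disc_poly by simp
  next
    case False
    have IH: "rational_on_disc (magnitude_fun r A')" if "A' \<in> Pow A - {A}" for A'
      using that less.prems by (intro less.hyps) (auto intro: psubset_card_mono finite_subset)
    have "magnitude_fun r A = (\<lambda>z. (\<Sum>A'\<in>Pow A - {A}. poly (monom (of_int ((- 1) ^ r A' * interval_char r A' A)) (card A')) z *
        magnitude_fun r A' z) / poly (1 - monom (of_int ((- 1) ^ r A)) (card A)) z)"
      using False less.prems
      by (auto simp: fun_eq_iff poly_monom simp del: of_int_mult of_int_power intro: magnitude_fun.simps[THEN trans])
    moreover have "poly (1 - monom (of_int ((- 1) ^ r A)) (card A)) z \<noteq> 0" if "norm z < 1" for z :: complex
      using magnitude_fun_denom[OF less.prems False that, of "r A"] by (simp add: poly_monom)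
    ultimately show ?thesis
      by (simp only:) (intro rational_on_disc_divide rational_on_disc_sum rational_on_disc_mult
          rational_on_disc_poly IH)
  qed
qed

section \<open>Covectors and weightings on topes\<close>

definition restrict_sign :: "'a set \<Rightarrow> ('a \<Rightarrow> int) \<Rightarrow> 'a \<Rightarrow> int" where
  "restrict_sign A X = (\<lambda>e. if e \<in> A then X e else 0)"

lemma zero_set_restrict_sign: "A \<subseteq> E \<Longrightarrow> zero_set A (restrict_sign A X) = zero_set E X \<inter> A"
  by (auto simp: zero_set_def restrict_sign_def)

lemma zero_set_sign_comp: "zero_set E (sign_comp X Y) = zero_set E X \<inter> zero_set E Y"
  by (auto simp: zero_set_def sign_comp_def)

lemma zero_set_neg: "zero_set E (\<lambda>e. - X e) = zero_set E X"
  by (auto simp: zero_set_def)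

lemma restrict_sign_comp:
  "restrict_sign A (sign_comp X Y) = sign_comp (restrict_sign A X) (restrict_sign A Y)"
  by (auto simp: restrict_sign_def sign_comp_def)

lemma restrict_sign_neg: "restrict_sign A (\<lambda>e. - X e) = (\<lambda>e. - restrict_sign A X e)"
  by (auto simp: restrict_sign_def)

lemma finite_sign_vectors:
  assumes "finite E"
  shows "finite (sign_vectors E)"
proof (rule finite_subset)
  show "finite {X. \<forall>e. (e \<in> E \<longrightarrow> X e \<in> {- 1, 0, 1 :: int}) \<and> (e \<notin> E \<longrightarrow> X e = 0)}"
    using assms by (intro finite_set_of_finite_funs) auto
qed (auto simp: sign_vectors_def)

lemma sum_Pow_minus_one:
  assumes "finite A"
  shows "(\<Sum>S\<in>Pow A. (- 1) ^ card S) = (if A = {} then 1 else 0 :: int)"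
proof -
  have "(\<Sum>S\<in>Pow A. (- 1) ^ card S) = (\<Sum>S\<in>Pow A. (\<Prod>e\<in>S. - 1) * (\<Prod>e\<in>A - S. 1 :: int))"
    by simp
  also have "\<dots> = (\<Prod>e\<in>A. - 1 + 1)" by (rule prod_add[OF assms, symmetric])
  finally show ?thesis using assms by (simp add: power_0_left)
qed

section \<open>Elimination, closures and restrictions of covectors\<close>

context oriented_matroid
begin

lemma finite_covectors: "finite \<L>"
  using finite_sign_vectors[OF finite_ground] covectors_sign finite_subset by blast

lemma covector_values: "X \<in> \<L> \<Longrightarrow> X e \<in> {- 1, 0, 1}"
  using covectors_sign by (auto simp: sign_vectors_def)

lemma covector_outside: "X \<in> \<L> \<Longrightarrow> e \<notin> E \<Longrightarrow> X e = 0"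
  using covectors_sign by (auto simp: sign_vectors_def)

lemma zero_set_subset: "zero_set E X \<subseteq> E"
  by (auto simp: zero_set_def)

lemma eliminate:
  assumes "X \<in> \<L>" "Y \<in> \<L>" "X e \<noteq> 0" "Y e = - X e"
  obtains Z where "Z \<in> \<L>" "Z e = 0"
    "\<And>f. f \<in> E \<Longrightarrow> X f = 0 \<or> Y f \<noteq> - X f \<Longrightarrow> Z f = sign_comp X Y f"
proof -
  have "e \<in> separation X Y" using assms by (auto simp: separation_def)
  from strong_elimination[OF assms(1,2) this]
  obtain Z where "Z \<in> \<L>" "Z e = 0" "\<forall>f\<in>E - separation X Y. Z f = sign_comp X Y f" by blast
  then have "Z f = sign_comp X Y f" if "f \<in> E" "X f = 0 \<or> Y f \<noteq> - X f" for f
    using that by (auto simp: separation_def)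
  with \<open>Z \<in> \<L>\<close> \<open>Z e = 0\<close> show ?thesis by (rule that)
qed

text \<open>Composition intersects zero sets, so a zero set of minimum cardinality above
  \<open>S\<close> is contained in all others. It serves as the closure of \<open>S\<close>.\<close>

lemma ex_generic_covector:
  assumes "S \<subseteq> E"
  shows "\<exists>X\<in>\<L>. S \<subseteq> zero_set E X \<and> (\<forall>Y\<in>\<L>. S \<subseteq> zero_set E Y \<longrightarrow> zero_set E X \<subseteq> zero_set E Y)"
proof -
  let ?P = "\<lambda>X. X \<in> \<L> \<and> S \<subseteq> zero_set E X"
  have "?P (\<lambda>e. 0)" using zero_covector assms by (auto simp: zero_set_def)
  then obtain X where X: "?P X" "\<forall>Y. ?P Y \<longrightarrow> card (zero_set E X) \<le> card (zero_set E Y)"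
    using ex_has_least_nat[of ?P _ "\<lambda>X. card (zero_set E X)"] by blast
  have "zero_set E X \<subseteq> zero_set E Y" if "?P Y" for Y
  proof (rule ccontr)
    assume "\<not> zero_set E X \<subseteq> zero_set E Y"
    then have "zero_set E (sign_comp X Y) \<subset> zero_set E X" by (auto simp: zero_set_sign_comp)
    then have "card (zero_set E (sign_comp X Y)) < card (zero_set E X)"
      using finite_ground zero_set_subset finite_subset by (intro psubset_card_mono) blast+
    moreover have "?P (sign_comp X Y)" using X(1) that comp_covector by (auto simp: zero_set_sign_comp)
    ultimately show False using X(2) by (meson not_le)
  qed
  then show ?thesis using X(1) by blast
qed

lemma restrict_oriented_matroid:
  assumes "A \<subseteq> E"
  shows "oriented_matroid A (restrict_sign A ` \<L>)"
proof
  show "finite A" using assms finite_ground finite_subset by blast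
  show "restrict_sign A ` \<L> \<subseteq> sign_vectors A"
    using covectors_sign by (auto simp: sign_vectors_def restrict_sign_def) blast
  show "(\<lambda>e. 0) \<in> restrict_sign A ` \<L>"
    using zero_covector by (intro image_eqI[of _ _ "\<lambda>e. 0"]) (auto simp: restrict_sign_def)
  show "(\<lambda>e. - X e) \<in> restrict_sign A ` \<L>" if "X \<in> restrict_sign A ` \<L>" for X
    using that neg_covector by (auto simp: restrict_sign_neg[symmetric])
  show "sign_comp X Y \<in> restrict_sign A ` \<L>"
    if "X \<in> restrict_sign A ` \<L>" "Y \<in> restrict_sign A ` \<L>" for X Y
    using that comp_covector by (auto simp: restrict_sign_comp[symmetric])
  show "\<exists>Z\<in>restrict_sign A ` \<L>. Z e = 0 \<and> (\<forall>f\<in>A - separation X Y. Z f = sign_comp X Y f)"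
    if XY: "X \<in> restrict_sign A ` \<L>" "Y \<in> restrict_sign A ` \<L>" and e: "e \<in> separation X Y" for X Y e
  proof -
    obtain X' Y' where X': "X' \<in> \<L>" "X = restrict_sign A X'" and Y': "Y' \<in> \<L>" "Y = restrict_sign A Y'"
      using XY by blast
    have "e \<in> A" "X' e \<noteq> 0" "Y' e = - X' e"
      using e X' Y' by (auto simp: separation_def restrict_sign_def split: if_splits)
    with eliminate[OF X'(1) Y'(1)] obtain Z where Z: "Z \<in> \<L>" "Z e = 0"
      "\<And>f. f \<in> E \<Longrightarrow> X' f = 0 \<or> Y' f \<noteq> - X' f \<Longrightarrow> Z f = sign_comp X' Y' f" by metis
    have "restrict_sign A Z f = sign_comp X Y f" if "f \<in> A - separation X Y" for f
      using that assms Z(3)[of f] X'(2) Y'(2) by (auto simp: separation_def restrict_sign_def sign_comp_def)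
    then show ?thesis using Z(1,2) by (intro bexI[of _ "restrict_sign A Z"]) (auto simp: restrict_sign_def)
  qed
qed

end

text \<open>Bases are dropped in favour of a rank function because the induction passes to
  restrictions: these keep the same \<open>r\<close>, while their bases would have to be constructed
  anew.\<close>

locale ranked_oriented_matroid = oriented_matroid E \<L> for E :: "'a set" and \<L> +
  fixes r :: "'a set \<Rightarrow> nat"
  assumes r_empty: "r {} = 0"
    and r_insert_ge: "\<lbrakk>S \<subseteq> E; e \<in> E\<rbrakk> \<Longrightarrow> r S \<le> r (insert e S)"
    and r_insert_le: "\<lbrakk>S \<subseteq> E; e \<in> E\<rbrakk> \<Longrightarrow> r (insert e S) \<le> Suc (r S)"
    and r_submodular: "\<lbrakk>S \<subseteq> E; T \<subseteq> E\<rbrakk> \<Longrightarrow> r (S \<union> T) + r (S \<inter> T) \<le> r S + r T"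
    and zero_sets: "F \<subseteq> E \<Longrightarrow> F \<in> zero_set E ` \<L> \<longleftrightarrow> (\<forall>e\<in>E - F. r F < r (insert e F))"
begin

lemma r_mono:
  assumes "S \<subseteq> T" "T \<subseteq> E"
  shows "r S \<le> r T"
proof -
  have "finite (T - S)" using assms finite_ground finite_subset by blast
  then have "T - S \<subseteq> E \<Longrightarrow> r S \<le> r (S \<union> (T - S))"
  proof (induction "T - S" arbitrary: T rule: finite_induct)
    case empty
    then have "S \<union> (T - S) = S" by auto
    then show ?case by simp
  next
    case (insert e U)
    have "r S \<le> r (S \<union> (S \<union> U - S))"
      using insert.hyps insert.prems by (intro insert.hyps(3)) auto
    moreover have "S \<union> (S \<union> U - S) = S \<union> U" "S \<union> (T - S) = insert e (S \<union> U)"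
      using insert.hyps(4) by auto
    moreover have "S \<union> U \<subseteq> E" "e \<in> E" using insert.hyps(4) insert.prems assms by auto
    ultimately show ?case using r_insert_ge[of "S \<union> U" e] by simp
  qed
  moreover have "S \<union> (T - S) = T" using assms by auto
  ultimately show ?thesis using assms by auto
qed

text \<open>By submodularity the elements that do not raise the rank of \<open>S\<close> form a set
  \<open>C\<close> of the same rank. It is a flat, hence a zero set, so the least zero set above
  \<open>S\<close> is squeezed between \<open>S\<close> and \<open>C\<close>.\<close>

lemma r_generic:
  assumes "S \<subseteq> E" "X \<in> \<L>" "S \<subseteq> zero_set E X"
    "\<forall>Y\<in>\<L>. S \<subseteq> zero_set E Y \<longrightarrow> zero_set E X \<subseteq> zero_set E Y"
  shows "r (zero_set E X) = r S"
proof -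
  define C where "C = {e\<in>E. r (insert e S) = r S}"
  have SC: "S \<subseteq> C" using assms(1) by (auto simp: C_def insert_absorb)
  have CE: "C \<subseteq> E" by (auto simp: C_def)
  have "finite C" using CE finite_ground finite_subset by blast
  have "r (S \<union> U) = r S" if "finite U" "U \<subseteq> C" for U
    using that
  proof (induction U)
    case (insert e U)
    have "e \<in> E" "U \<subseteq> E" "r (insert e S) = r S" using insert.prems CE by (auto simp: C_def)
    then have "r ((S \<union> U) \<union> insert e S) + r ((S \<union> U) \<inter> insert e S) \<le> r S + r S"
      using r_submodular[of "S \<union> U" "insert e S"] insert assms(1) by auto
    moreover have "r S \<le> r ((S \<union> U) \<inter> insert e S)" "r S \<le> r (S \<union> insert e U)"
      using \<open>e \<in> E\<close> \<open>U \<subseteq> E\<close> assms(1) by (auto intro!: r_mono)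
    moreover have "(S \<union> U) \<union> insert e S = S \<union> insert e U" by auto
    ultimately show ?case by simp
  qed simp
  from this[OF \<open>finite C\<close>] have rC: "r C = r S" using SC by (simp add: Un_absorb1)
  have "C \<in> zero_set E ` \<L>"
    unfolding zero_sets[OF CE]
  proof
    fix e assume e: "e \<in> E - C"
    then have "r S < r (insert e S)" using r_insert_ge[OF assms(1), of e] by (auto simp: C_def)
    also have "\<dots> \<le> r (insert e C)" using e SC CE by (intro r_mono) auto
    finally show "r C < r (insert e C)" using rC by simp
  qed
  then have "zero_set E X \<subseteq> C" using assms(4) SC by auto
  then show ?thesis
    using r_mono[of S "zero_set E X"] r_mono[of "zero_set E X" C] assms(3) rC CE zero_set_subset by fastforce
qed

text \<open>
  The covectors agreeing with \<open>B\<close> on \<open>S\<close> and vanishing where \<open>B\<close> does are the cells of an open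
  convex cone; the sum is its Euler characteristic with compact support. Splitting by the sign at
  an element outside \<open>S\<close> cuts the cone into two open halves and their common wall.
\<close>

lemma covector_euler_sum:
  assumes "B \<in> \<L>" "S \<subseteq> E"
  shows "(\<Sum>X | X \<in> \<L> \<and> zero_set E B \<subseteq> zero_set E X \<and> (\<forall>e\<in>S. X e = B e). (- 1) ^ r (zero_set E X)) =
    (- 1 :: int) ^ r (zero_set E B)"
  using assms
proof (induction "card (E - (S \<union> zero_set E B))" arbitrary: B S rule: less_induct)
  case less
  let ?G = "zero_set E B"
  let ?f = "\<lambda>X. (- 1 :: int) ^ r (zero_set E X)"
  define V where "V B S = {X \<in> \<L>. zero_set E B \<subseteq> zero_set E X \<and> (\<forall>e\<in>S. X e = B e)}" for B S
  have finV: "finite (V B S)" for B S using finite_covectors by (simp add: V_def)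
  have IH: "sum ?f (V B' S') = (- 1) ^ r (zero_set E B')"
    if "E - (S' \<union> zero_set E B') \<subset> E - (S \<union> ?G)" "B' \<in> \<L>" "S' \<subseteq> E" for B' S'
    using less.hyps[OF _ that(2,3)] psubset_card_mono[OF _ that(1)] finite_ground by (simp add: V_def)
  show ?case
  proof (cases "E \<subseteq> S \<union> ?G")
    case True
    have "X = B" if "X \<in> V B S" for X
    proof
      fix e show "X e = B e"
      proof (cases "e \<in> E")
        case True
        then have "e \<in> S \<or> e \<in> ?G" using \<open>E \<subseteq> S \<union> ?G\<close> by auto
        then show ?thesis using that by (fastforce simp: V_def zero_set_def)
      next
        case False
        then show ?thesis using that less.prems(1) by (simp add: V_def covector_outside)
      qed
    qed
    moreover have "B \<in> V B S" using less.prems by (auto simp: V_def)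
    ultimately have "V B S = {B}" by auto
    then show ?thesis unfolding V_def by simp
  next
    case False
    then obtain e where e: "e \<in> E" "e \<notin> S" "e \<notin> ?G" by auto
    then have Be: "B e \<noteq> 0" by (auto simp: zero_set_def)
    have V1: "sum ?f (V B (insert e S)) = (- 1) ^ r ?G"
      using e less.prems by (intro IH) auto
    have "sum ?f (V B S) = (- 1) ^ r ?G"
    proof (cases "\<exists>X0\<in>V B S. X0 e \<noteq> B e")
      case False
      then have "V B S = V B (insert e S)" by (auto simp: V_def)
      then show ?thesis using V1 by simp
    next
      case True
      then obtain X0 where X0: "X0 \<in> V B S" "X0 e \<noteq> B e" by blast
      \<comment> \<open>A representative of the opposite half: composing with \<open>- B\<close>
        fills the surplus zeros of \<open>X0\<close>, so that the zero set is again that of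
        \<open>B\<close>, and the sign at \<open>e\<close> becomes \<open>- B e\<close> whether
        \<open>X0 e\<close> is zero or not.\<close>
      define B' where "B' = sign_comp X0 (\<lambda>e. - B e)"
      have B': "B' \<in> \<L>" "zero_set E B' = ?G" "B' e = - B e" "\<And>s. s \<in> S \<Longrightarrow> B' s = B s"
      proof -
        show "B' \<in> \<L>" using X0 less.prems comp_covector neg_covector by (auto simp: B'_def V_def)
        show "zero_set E B' = ?G" using X0 by (auto simp: B'_def V_def zero_set_sign_comp zero_set_neg)
        have "X0 \<in> \<L>" using X0 by (simp add: V_def)
        then show "B' e = - B e"
          using X0(2) Be covector_values[of X0 e] covector_values[OF less.prems(1), of e]
          by (auto simp: B'_def sign_comp_def)
        show "B' s = B s" if "s \<in> S" for s
          using that X0 by (auto simp: B'_def V_def sign_comp_def)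
      qed
      have V2: "sum ?f (V B' (insert e S)) = (- 1) ^ r ?G"
        using e less.prems B' IH[of "insert e S" B'] by auto
      obtain Z where Z: "Z \<in> \<L>" "Z e = 0"
        "\<And>f. f \<in> E \<Longrightarrow> B f = 0 \<or> B' f \<noteq> - B f \<Longrightarrow> Z f = sign_comp B B' f"
        using eliminate[OF less.prems(1) B'(1) Be B'(3)] by metis
      have ZS: "Z s = B s" if "s \<in> S" for s
        using that Z(3)[of s] B'(4)[OF that] less.prems(2) by (auto simp: sign_comp_def)
      have ZG: "insert e ?G \<subseteq> zero_set E Z"
      proof -
        have "Z g = 0" if "g \<in> ?G" for g
        proof -
          have "g \<in> zero_set E B'" using B'(2) that by simp
          then show ?thesis using that Z(3)[of g] by (auto simp: zero_set_def sign_comp_def)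
        qed
        then show ?thesis using Z(2) e by (auto simp: zero_set_def)
      qed
      have Ge: "insert e ?G \<subseteq> E" using e zero_set_subset by auto
      obtain W where W: "W \<in> \<L>" "insert e ?G \<subseteq> zero_set E W"
        "\<forall>Y\<in>\<L>. insert e ?G \<subseteq> zero_set E Y \<longrightarrow> zero_set E W \<subseteq> zero_set E Y"
        using ex_generic_covector[OF Ge] by blast
      \<comment> \<open>\<open>Z\<close> lies on the wall but may vanish too often. Composing with
        \<open>W\<close> makes the zero set as small as the wall allows; on \<open>S\<close> nothing
        changes, since \<open>Z\<close> vanishes there only where \<open>B\<close>, and hence
        \<open>W\<close>, does.\<close>
      define B0 where "B0 = sign_comp Z W"
      have B0: "B0 \<in> \<L>" "zero_set E B0 = zero_set E W"
        using W Z ZG comp_covector by (auto simp: B0_def zero_set_sign_comp)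
      have B0S: "B0 s = B s" if "s \<in> S" for s
      proof (cases "Z s = 0")
        case True
        then have "s \<in> ?G" using ZS[OF that] that less.prems by (auto simp: zero_set_def)
        then have "W s = 0" using W(2) by (auto simp: zero_set_def)
        then show ?thesis using True ZS[OF that] by (simp add: B0_def sign_comp_def)
      qed (use ZS[OF that] in \<open>simp add: B0_def sign_comp_def\<close>)
      have "r (zero_set E W) = r (insert e ?G)" using r_generic[OF Ge W] .
      moreover have "r (insert e ?G) = Suc (r ?G)"
      proof -
        have "?G \<in> zero_set E ` \<L>" using less.prems by blast
        then have "r ?G < r (insert e ?G)" using zero_sets[OF zero_set_subset] e by blast
        then show ?thesis using r_insert_le[of ?G e] zero_set_subset e by fastforce
      qed
      \<comment> \<open>The wall has rank one higher and so the opposite sign; the three pieces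
        contribute 1 + 1 - 1 times the sign of \<open>B\<close>.\<close>
      ultimately have V3: "sum ?f (V B0 S) = - ((- 1) ^ r ?G)"
        using IH[of S B0] B0 W(2) e less.prems by fastforce
      have "V B S = V B (insert e S) \<union> (V B' (insert e S) \<union> V B0 S)"
      proof (intro equalityI subsetI)
        fix X assume X: "X \<in> V B S"
        then have XL: "X \<in> \<L>" by (simp add: V_def)
        consider "X e = B e" | "X e = - B e" | "X e = 0"
          using covector_values[OF XL, of e] covector_values[OF less.prems(1), of e] Be by auto
        then show "X \<in> V B (insert e S) \<union> (V B' (insert e S) \<union> V B0 S)"
        proof cases
          case 3
          then have "insert e ?G \<subseteq> zero_set E X" using X e by (auto simp: V_def zero_set_def)
          then have "X \<in> V B0 S" using W(3) X B0 B0S by (auto simp: V_def)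
          then show ?thesis by blast
        qed (use X B' in \<open>auto simp: V_def\<close>)
      next
        fix X assume "X \<in> V B (insert e S) \<union> (V B' (insert e S) \<union> V B0 S)"
        then show "X \<in> V B S" using B' B0 B0S W(2) by (auto simp: V_def)
      qed
      moreover have "V B (insert e S) \<inter> (V B' (insert e S) \<union> V B0 S) = {}"
        "V B' (insert e S) \<inter> V B0 S = {}"
        using Be B'(3) B0(2) W(2) by (auto simp: V_def zero_set_def)
      ultimately show ?thesis using V1 V2 V3 finV by (simp add: sum.union_disjoint)
    qed
    then show ?thesis by (simp add: V_def)
  qed
qed

lemma covector_euler_sum_above:
  assumes "S \<subseteq> E"
  shows "(\<Sum>X | X \<in> \<L> \<and> S \<subseteq> zero_set E X. (- 1) ^ r (zero_set E X)) = (- 1 :: int) ^ r S"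
proof -
  obtain W where W: "W \<in> \<L>" "S \<subseteq> zero_set E W"
    "\<forall>Y\<in>\<L>. S \<subseteq> zero_set E Y \<longrightarrow> zero_set E W \<subseteq> zero_set E Y"
    using ex_generic_covector[OF assms] by blast
  then have "{X \<in> \<L>. S \<subseteq> zero_set E X} = {X \<in> \<L>. zero_set E W \<subseteq> zero_set E X}" by auto
  then show ?thesis
    using covector_euler_sum[OF W(1), of "{}"] r_generic[OF assms W] by simp
qed

text \<open>The count of Las Vergnas and Zaslavsky for the contraction by \<open>G\<close>. Each
  sign \<open>(-1) ^ r (G \<union> S)\<close> is replaced by the Euler sum over the covectors
  vanishing on \<open>G \<union> S\<close>; after exchanging the sums, the alternating sum over
  \<open>S\<close> keeps only covectors whose zero set is exactly \<open>G\<close>.\<close>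

lemma interval_char_eq_card:
  assumes "G \<subseteq> E"
  shows "interval_char r G E = int (card {X \<in> \<L>. zero_set E X = G})"
proof -
  let ?z = "zero_set E"
  have fin: "finite (E - G)" using finite_ground by simp
  have "interval_char r G E = (- 1) ^ r G * (\<Sum>S\<in>Pow (E - G). (- 1) ^ card S * (- 1) ^ r (G \<union> S))"
    by (simp add: interval_char_def sum_distrib_left power_add mult_ac)
  also have "(\<Sum>S\<in>Pow (E - G). (- 1) ^ card S * (- 1) ^ r (G \<union> S)) =
      (\<Sum>S\<in>Pow (E - G). \<Sum>X\<in>\<L>. if G \<union> S \<subseteq> ?z X then (- 1 :: int) ^ card S * (- 1) ^ r (?z X) else 0)"
  proof (intro sum.cong refl)
    fix S assume "S \<in> Pow (E - G)"
    then have "G \<union> S \<subseteq> E" using assms by auto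
    then show "(- 1) ^ card S * (- 1) ^ r (G \<union> S) =
        (\<Sum>X\<in>\<L>. if G \<union> S \<subseteq> ?z X then (- 1 :: int) ^ card S * (- 1) ^ r (?z X) else 0)"
      by (simp only: covector_euler_sum_above[symmetric] sum_distrib_left)
         (rule sum.mono_neutral_cong_left, use finite_covectors in auto)
  qed
  also have "\<dots> = (\<Sum>X\<in>\<L>. \<Sum>S\<in>Pow (E - G). if G \<union> S \<subseteq> ?z X then (- 1) ^ card S * (- 1) ^ r (?z X) else 0)"
    by (rule sum.swap)
  also have "\<dots> = (\<Sum>X\<in>\<L>. if ?z X = G then (- 1) ^ r G else 0)"
  proof (intro sum.cong refl)
    fix X
    show "(\<Sum>S\<in>Pow (E - G). if G \<union> S \<subseteq> ?z X then (- 1 :: int) ^ card S * (- 1) ^ r (?z X) else 0) =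
        (if ?z X = G then (- 1) ^ r G else 0)"
    proof (cases "G \<subseteq> ?z X")
      case True
      have "(\<Sum>S\<in>Pow (E - G). if G \<union> S \<subseteq> ?z X then (- 1 :: int) ^ card S * (- 1) ^ r (?z X) else 0) =
          (\<Sum>S\<in>Pow (?z X - G). (- 1) ^ card S * (- 1) ^ r (?z X))"
        using True fin zero_set_subset by (intro sum.mono_neutral_cong_right) auto
      also have "\<dots> = (if ?z X - G = {} then 1 else 0) * (- 1) ^ r (?z X)"
        using finite_ground zero_set_subset sum_Pow_minus_one[of "?z X - G"]
        by (simp add: sum_distrib_right[symmetric] finite_subset[of _ E])
      finally show ?thesis using True by (auto split: if_splits)
    qed auto
  qed
  also have "\<dots> = int (card {X \<in> \<L>. ?z X = G}) * (- 1) ^ r G"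
    using finite_covectors by (simp add: sum.If_cases Int_def)
  finally show ?thesis by (simp flip: power_add mult_2)
qed

text \<open>Each factor is \<open>q\<close> plus \<open>1 - q\<close> times the indicator of
  \<open>X e = B e\<close>. After expansion every inner sum is the Euler sum of an open cone around
  the tope \<open>B\<close>, which equals 1, and the remaining binomial weights add up to 1.\<close>

lemma tope_agreement_sum:
  fixes q :: real
  assumes "B \<in> topes E \<L>"
  shows "(\<Sum>X\<in>\<L>. (- 1) ^ r (zero_set E X) * (\<Prod>e\<in>E. if X e = B e then 1 else q)) = 1"
proof -
  have B: "B \<in> \<L>" "zero_set E B = {}" using assms by (auto simp: topes_def zero_set_def)
  have expand: "(\<Prod>e\<in>E. if X e = B e then 1 else q) =
      (\<Sum>S\<in>Pow E. if \<forall>e\<in>S. X e = B e then (1 - q) ^ card S * q ^ card (E - S) else 0)" for X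
  proof -
    have "(\<Prod>e\<in>E. if X e = B e then 1 else q) = (\<Prod>e\<in>E. (if X e = B e then 1 - q else 0) + q)"
      by (intro prod.cong) auto
    also have "\<dots> = (\<Sum>S\<in>Pow E. (\<Prod>e\<in>S. if X e = B e then 1 - q else 0) * (\<Prod>e\<in>E - S. q))"
      by (rule prod_add[OF finite_ground])
    also have "\<dots> = (\<Sum>S\<in>Pow E. if \<forall>e\<in>S. X e = B e then (1 - q) ^ card S * q ^ card (E - S) else 0)"
    proof (intro sum.cong refl)
      fix S assume "S \<in> Pow E"
      then have "finite S" using finite_ground finite_subset by auto
      then show "(\<Prod>e\<in>S. if X e = B e then 1 - q else 0) * (\<Prod>e\<in>E - S. q) =
          (if \<forall>e\<in>S. X e = B e then (1 - q) ^ card S * q ^ card (E - S) else 0)"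
        by (cases "\<forall>e\<in>S. X e = B e") (auto intro: prod_zero)
    qed
    finally show ?thesis .
  qed
  have "(\<Sum>X\<in>\<L>. (- 1) ^ r (zero_set E X) * (\<Prod>e\<in>E. if X e = B e then 1 else q)) =
      (\<Sum>S\<in>Pow E. \<Sum>X\<in>\<L>. if \<forall>e\<in>S. X e = B e then (- 1) ^ r (zero_set E X) * ((1 - q) ^ card S * q ^ card (E - S)) else 0)"
    unfolding expand sum_distrib_left by (subst sum.swap) (intro sum.cong refl, simp)
  also have "\<dots> = (\<Sum>S\<in>Pow E. (\<Prod>e\<in>S. 1 - q) * (\<Prod>e\<in>E - S. q))"
  proof (intro sum.cong refl)
    fix S assume "S \<in> Pow E"
    then have "(\<Sum>X | X \<in> \<L> \<and> (\<forall>e\<in>S. X e = B e). (- 1 :: int) ^ r (zero_set E X)) = 1"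
      using covector_euler_sum[OF B(1), of S] B(2) r_empty by simp
    then have "of_int (\<Sum>X | X \<in> \<L> \<and> (\<forall>e\<in>S. X e = B e). (- 1) ^ r (zero_set E X)) = (1 :: real)" by simp
    then have 1: "(\<Sum>X | X \<in> \<L> \<and> (\<forall>e\<in>S. X e = B e). (- 1 :: real) ^ r (zero_set E X)) = 1" by simp
    have "(\<Sum>X\<in>\<L>. if \<forall>e\<in>S. X e = B e then (- 1) ^ r (zero_set E X) * ((1 - q) ^ card S * q ^ card (E - S)) else 0) =
        (\<Sum>X | X \<in> \<L> \<and> (\<forall>e\<in>S. X e = B e). (- 1) ^ r (zero_set E X) * ((1 - q) ^ card S * q ^ card (E - S)))"
      using finite_covectors by (intro sum.mono_neutral_cong_right) auto
    then show "(\<Sum>X\<in>\<L>. if \<forall>e\<in>S. X e = B e then (- 1) ^ r (zero_set E X) * ((1 - q) ^ card S * q ^ card (E - S)) else 0) =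
        (\<Prod>e\<in>S. 1 - q) * (\<Prod>e\<in>E - S. q)"
      using 1 by (simp add: sum_distrib_right[symmetric])
  qed
  also have "\<dots> = (\<Prod>e\<in>E. (1 - q) + q)" by (rule prod_add[OF finite_ground, symmetric])
  finally show ?thesis by simp
qed

text \<open>Submodularity makes the trace of a flat on \<open>A\<close> a flat. Conversely, the
  least zero set above a flat \<open>F\<close> of the restriction has the rank of \<open>F\<close>,
  so it contains no further element of \<open>A\<close>.\<close>

lemma restrict_ranked:
  assumes "A \<subseteq> E"
  shows "ranked_oriented_matroid A (restrict_sign A ` \<L>) r"
proof -
  interpret R: oriented_matroid A "restrict_sign A ` \<L>" by (rule restrict_oriented_matroid[OF assms])
  show ?thesis
  proof
    show "r {} = 0" by (rule r_empty)
    show "r S \<le> r (insert e S)" "r (insert e S) \<le> Suc (r S)" if "S \<subseteq> A" "e \<in> A" for S e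
      using that assms r_insert_ge r_insert_le by blast+
    show "r (S \<union> T) + r (S \<inter> T) \<le> r S + r T" if "S \<subseteq> A" "T \<subseteq> A" for S T
      using that assms r_submodular by blast
    show "F \<in> zero_set A ` restrict_sign A ` \<L> \<longleftrightarrow> (\<forall>e\<in>A - F. r F < r (insert e F))" if F: "F \<subseteq> A" for F
    proof
      assume "F \<in> zero_set A ` restrict_sign A ` \<L>"
      then obtain X where X: "X \<in> \<L>" "F = zero_set E X \<inter> A" using assms by (auto simp: zero_set_restrict_sign)
      show "\<forall>e\<in>A - F. r F < r (insert e F)"
      proof
        fix e assume e: "e \<in> A - F"
        then have e': "e \<in> E - zero_set E X" using X assms by auto
        then have "r (zero_set E X) < r (insert e (zero_set E X))"
          using zero_sets[OF zero_set_subset] X(1) by blast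
        moreover have "r (zero_set E X \<union> insert e F) + r (zero_set E X \<inter> insert e F)
            \<le> r (zero_set E X) + r (insert e F)"
          using F e assms zero_set_subset by (intro r_submodular) auto
        moreover have "zero_set E X \<union> insert e F = insert e (zero_set E X)" "zero_set E X \<inter> insert e F = F"
          using X(2) e' by auto
        ultimately show "r F < r (insert e F)" by simp
      qed
    next
      assume flat: "\<forall>e\<in>A - F. r F < r (insert e F)"
      have FE: "F \<subseteq> E" using F assms by auto
      obtain W where W: "W \<in> \<L>" "F \<subseteq> zero_set E W"
        "\<forall>Y\<in>\<L>. F \<subseteq> zero_set E Y \<longrightarrow> zero_set E W \<subseteq> zero_set E Y"
        using ex_generic_covector[OF FE] by blast
      have "zero_set E W \<inter> A \<subseteq> F"
      proof
        fix e assume e: "e \<in> zero_set E W \<inter> A"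
        show "e \<in> F"
        proof (rule ccontr)
          assume "e \<notin> F"
          then have "r F < r (insert e F)" using flat e by blast
          also have "\<dots> \<le> r (zero_set E W)" using e W(2) zero_set_subset by (intro r_mono) auto
          finally show False using r_generic[OF FE W] by simp
        qed
      qed
      then have "F = zero_set A (restrict_sign A W)"
        using W(2) F assms by (auto simp: zero_set_restrict_sign)
      then show "F \<in> zero_set A ` restrict_sign A ` \<L>" using W(1) by blast
    qed
  qed
qed

text \<open>Composition with \<open>X\<close> is the inverse: it forces the signs outside the zero
  set and leaves those inside free.\<close>

lemma topes_above_bij:
  assumes "X \<in> \<L>"
  shows "bij_betw (restrict_sign (zero_set E X)) {C \<in> topes E \<L>. \<forall>e\<in>E. X e \<noteq> 0 \<longrightarrow> C e = X e}
    (topes (zero_set E X) (restrict_sign (zero_set E X) ` \<L>))"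
proof (rule bij_betwI')
  fix C C' assume C: "C \<in> {C \<in> topes E \<L>. \<forall>e\<in>E. X e \<noteq> 0 \<longrightarrow> C e = X e}"
    "C' \<in> {C \<in> topes E \<L>. \<forall>e\<in>E. X e \<noteq> 0 \<longrightarrow> C e = X e}"
  show "(restrict_sign (zero_set E X) C = restrict_sign (zero_set E X) C') = (C = C')"
  proof
    assume eq: "restrict_sign (zero_set E X) C = restrict_sign (zero_set E X) C'"
    show "C = C'"
    proof
      fix e
      show "C e = C' e"
        using fun_cong[OF eq, of e] C covector_outside[of C e] covector_outside[of C' e]
        by (cases "e \<in> E"; cases "X e = 0") (auto simp: restrict_sign_def zero_set_def topes_def)
    qed
  qed simp
next
  fix C assume "C \<in> {C \<in> topes E \<L>. \<forall>e\<in>E. X e \<noteq> 0 \<longrightarrow> C e = X e}"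
  then show "restrict_sign (zero_set E X) C \<in> topes (zero_set E X) (restrict_sign (zero_set E X) ` \<L>)"
    by (auto simp: topes_def restrict_sign_def zero_set_def)
next
  fix D assume "D \<in> topes (zero_set E X) (restrict_sign (zero_set E X) ` \<L>)"
  then obtain Y where Y: "Y \<in> \<L>" "D = restrict_sign (zero_set E X) Y" "\<forall>e\<in>zero_set E X. Y e \<noteq> 0"
    by (auto simp: topes_def restrict_sign_def)
  then have "sign_comp X Y \<in> {C \<in> topes E \<L>. \<forall>e\<in>E. X e \<noteq> 0 \<longrightarrow> C e = X e}"
    using assms comp_covector by (auto simp: topes_def sign_comp_def zero_set_def)
  moreover have "D = restrict_sign (zero_set E X) (sign_comp X Y)"
    using Y(2) by (auto simp: restrict_sign_def sign_comp_def zero_set_def)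
  ultimately show "\<exists>C\<in>{C \<in> topes E \<L>. \<forall>e\<in>E. X e \<noteq> 0 \<longrightarrow> C e = X e}. D = restrict_sign (zero_set E X) C"
    by blast
qed

end

section \<open>Weightings of the Varchenko matrix\<close>

definition tope_kernel :: "real \<Rightarrow> 'a set \<Rightarrow> ('a \<Rightarrow> int) \<Rightarrow> ('a \<Rightarrow> int) \<Rightarrow> real" where
  "tope_kernel q E B C = (\<Prod>e\<in>E. if B e = C e then 1 else q)"

text \<open>
  The weighting is built from those on the restrictions to the zero sets of the nonzero covectors:
  \<open>(1 - (-1)\<^bsup>r E\<^esup> q\<^bsup>card E\<^esup>) \<omega> C = (\<Sum>X. (-1)\<^bsup>r (z X)\<^esup> q\<^bsup>card (z X)\<^esup> \<omega>\<^bsub>X\<^esub> (C | z X))\<close>, where \<open>X\<close> runs over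
  the nonzero faces of \<open>C\<close> and \<open>z X\<close> is the zero set. The kernel factors along \<open>z X\<close>, which reduces
  the claim to the identity \<open>tope_agreement_sum\<close>, and the total mass satisfies the recursion of the
  magnitude.
\<close>

lemma ex_weighting:
  assumes "ranked_oriented_matroid E \<L> r" "\<bar>q\<bar> < 1"
  shows "\<exists>\<omega>. (\<forall>B\<in>topes E \<L>. (\<Sum>C\<in>topes E \<L>. tope_kernel q E B C * \<omega> C) = 1) \<and>
    magnitude_fun r E (of_real q) = of_real (\<Sum>C\<in>topes E \<L>. \<omega> C)"
  using assms(1)
proof (induction "card E" arbitrary: E \<L> rule: less_induct)
  case less
  interpret ranked_oriented_matroid E \<L> r by (rule less.prems)
  let ?z = "zero_set E"
  show ?case
  proof (cases "E = {}")
    case True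
    have "X = (\<lambda>e. 0)" if "X \<in> \<L>" for X using covector_outside[OF that] True by auto
    then have "\<L> = {\<lambda>e. 0}" using zero_covector by blast
    then have "topes E \<L> = {\<lambda>e. 0}" using True by (auto simp: topes_def)
    then show ?thesis
      using True by (intro exI[of _ "\<lambda>_. 1"]) (simp add: tope_kernel_def magnitude_fun.simps)
  next
    case False
    let ?L = "\<L> - {\<lambda>e. 0}"
    have zL: "?z X \<subset> E" if "X \<in> ?L" for X
    proof -
      have "?z X \<noteq> E"
      proof
        assume "?z X = E"
        then have "X = (\<lambda>e. 0)" using covector_outside[of X] that by (fastforce simp: zero_set_def)
        then show False using that by simp
      qed
      then show ?thesis using zero_set_subset by blast
    qed
    let ?T = "\<lambda>X. topes (?z X) (restrict_sign (?z X) ` \<L>)"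
    have "\<exists>\<omega>. (\<forall>B\<in>?T X. (\<Sum>C\<in>?T X. tope_kernel q (?z X) B C * \<omega> C) = 1) \<and>
      magnitude_fun r (?z X) (of_real q) = of_real (\<Sum>C\<in>?T X. \<omega> C)"
      if "X \<in> ?L" for X
      using finite_ground psubset_card_mono[OF _ zL[OF that]] restrict_ranked[OF zero_set_subset, of X]
      by (intro less.hyps) auto
    then have "\<exists>\<omega>. \<forall>X\<in>?L. (\<forall>B\<in>?T X. (\<Sum>C\<in>?T X. tope_kernel q (?z X) B C * \<omega> X C) = 1) \<and>
      magnitude_fun r (?z X) (of_real q) = of_real (\<Sum>C\<in>?T X. \<omega> X C)"
      by (intro bchoice ballI)
    then obtain \<omega> where \<omega>: "\<And>X B. X \<in> ?L \<Longrightarrow> B \<in> ?T X \<Longrightarrow>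
        (\<Sum>C\<in>?T X. tope_kernel q (?z X) B C * \<omega> X C) = 1"
      "\<And>X. X \<in> ?L \<Longrightarrow> magnitude_fun r (?z X) (of_real q) = of_real (\<Sum>C\<in>?T X. \<omega> X C)"
      by blast
    \<comment> \<open>\<open>t\<close> is the coefficient of the zero covector, whose zero set is
      all of \<open>E\<close>. Its term would involve the unknown weighting itself and is moved to
      the other side.\<close>
    define t where "t = (- 1) ^ r E * q ^ card E"
    have t: "1 - t \<noteq> 0"
    proof
      assume "1 - t = 0"
      then have "\<bar>t\<bar> = 1" by simp
      then have "\<bar>q\<bar> ^ card E = 1" by (simp add: t_def abs_mult power_abs)
      moreover have "\<bar>q\<bar> ^ card E < 1"
        using assms(2) False finite_ground power_strict_mono[of "\<bar>q\<bar>" 1 "card E"] by (simp add: card_gt_0_iff)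
      ultimately show False by simp
    qed
    define T where "T X = {C \<in> topes E \<L>. \<forall>e\<in>E. X e \<noteq> 0 \<longrightarrow> C e = X e}" for X
    have finT: "finite (topes E \<L>)" using finite_covectors by (simp add: topes_def)
    define \<Omega> where "\<Omega> C = (\<Sum>X\<in>?L. if C \<in> T X then (- 1) ^ r (?z X) * q ^ card (?z X) * \<omega> X (restrict_sign (?z X) C) else 0) / (1 - t)" for C
    have sum\<Omega>: "(\<Sum>C\<in>topes E \<L>. g C * \<Omega> C) * (1 - t) = (\<Sum>X\<in>?L. (- 1) ^ r (?z X) * q ^ card (?z X) *
        (\<Sum>C\<in>T X. g C * \<omega> X (restrict_sign (?z X) C)))" for g
    proof -
      have "(\<Sum>C\<in>topes E \<L>. g C * \<Omega> C) * (1 - t) = (\<Sum>C\<in>topes E \<L>. \<Sum>X\<in>?L. g C *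
          (if C \<in> T X then (- 1) ^ r (?z X) * q ^ card (?z X) * \<omega> X (restrict_sign (?z X) C) else 0))"
        using t by (simp add: sum_distrib_right \<Omega>_def flip: sum_distrib_left)
      also have "\<dots> = (\<Sum>X\<in>?L. \<Sum>C\<in>topes E \<L>. g C *
          (if C \<in> T X then (- 1) ^ r (?z X) * q ^ card (?z X) * \<omega> X (restrict_sign (?z X) C) else 0))"
        by (rule sum.swap)
      also have "\<dots> = (\<Sum>X\<in>?L. \<Sum>C\<in>T X. (- 1) ^ r (?z X) * q ^ card (?z X) * (g C * \<omega> X (restrict_sign (?z X) C)))"
        using finT by (intro sum.cong refl sum.mono_neutral_cong_right) (auto simp: T_def)
      finally show ?thesis by (simp add: sum_distrib_left)
    qed
    have "(\<Sum>C\<in>topes E \<L>. tope_kernel q E B C * \<Omega> C) = 1" if B: "B \<in> topes E \<L>" for B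
    proof -
      have B0: "B \<in> \<L>" "\<forall>e\<in>E. B e \<noteq> 0" using B by (auto simp: topes_def)
      \<comment> \<open>Outside the zero set \<open>C\<close> agrees with \<open>X\<close>, so those
        factors compare \<open>X\<close> with \<open>B\<close>; inside, the weighting of the
        restriction sums to 1. The power of \<open>q\<close> supplies the factors where
        \<open>X e = 0\<close>, since \<open>B\<close> has no zeros.\<close>
      have "q ^ card (?z X) * (\<Sum>C\<in>T X. tope_kernel q E B C * \<omega> X (restrict_sign (?z X) C)) =
          (\<Prod>e\<in>E. if X e = B e then 1 else q)" if X: "X \<in> ?L" for X
      proof -
        let ?R = "restrict_sign (?z X)"
        have kernel: "tope_kernel q E B C = (\<Prod>e\<in>E - ?z X. if X e = B e then 1 else q) *
            tope_kernel q (?z X) (?R B) (?R C)" if "C \<in> T X" for C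
        proof -
          have "tope_kernel q E B C = (\<Prod>e\<in>E - ?z X. if B e = C e then 1 else q) *
              (\<Prod>e\<in>?z X. if B e = C e then 1 else q)"
            unfolding tope_kernel_def using finite_ground zero_set_subset by (rule prod.subset_diff[rotated])
          also have "(\<Prod>e\<in>E - ?z X. if B e = C e then 1 else q) = (\<Prod>e\<in>E - ?z X. if X e = B e then 1 else q)"
            using that by (intro prod.cong) (auto simp: T_def zero_set_def)
          also have "(\<Prod>e\<in>?z X. if B e = C e then 1 else q) = tope_kernel q (?z X) (?R B) (?R C)"
            unfolding tope_kernel_def by (intro prod.cong) (auto simp: restrict_sign_def)
          finally show ?thesis .
        qed
        have bij: "bij_betw ?R (T X) (topes (?z X) (?R ` \<L>))"
          using topes_above_bij[of X] X by (simp add: T_def)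
        have RB: "?R B \<in> topes (?z X) (?R ` \<L>)"
          using B0 by (auto simp: topes_def restrict_sign_def zero_set_def)
        have "(\<Sum>C\<in>T X. tope_kernel q E B C * \<omega> X (?R C)) =
            (\<Prod>e\<in>E - ?z X. if X e = B e then 1 else q) *
            (\<Sum>C\<in>T X. tope_kernel q (?z X) (?R B) (?R C) * \<omega> X (?R C))"
          unfolding sum_distrib_left by (intro sum.cong refl) (simp add: kernel)
        also have "(\<Sum>C\<in>T X. tope_kernel q (?z X) (?R B) (?R C) * \<omega> X (?R C)) = 1"
          using sum.reindex_bij_betw[OF bij, of "\<lambda>D. tope_kernel q (?z X) (?R B) D * \<omega> X D"]
            \<omega>(1)[OF X RB] by simp
        finally have "(\<Sum>C\<in>T X. tope_kernel q E B C * \<omega> X (?R C)) =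
            (\<Prod>e\<in>E - ?z X. if X e = B e then 1 else q)" by simp
        moreover have "(\<Prod>e\<in>?z X. if X e = B e then 1 else q) = (\<Prod>e\<in>?z X. q)"
          using B0(2) by (intro prod.cong) (auto simp: zero_set_def)
        ultimately show ?thesis
          using prod.subset_diff[OF zero_set_subset finite_ground, of "\<lambda>e. if X e = B e then 1 else q" X] by simp
      qed
      then have "(\<Sum>C\<in>topes E \<L>. tope_kernel q E B C * \<Omega> C) * (1 - t) =
          (\<Sum>X\<in>?L. (- 1) ^ r (?z X) * (\<Prod>e\<in>E. if X e = B e then 1 else q))"
        unfolding sum\<Omega> mult.assoc by (intro sum.cong refl) simp
      also have "\<dots> = 1 - t"
      proof -
        have "(\<Prod>e\<in>E. if 0 = B e then 1 else q) = (\<Prod>e\<in>E. q)" using B0(2) by (intro prod.cong) auto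
        moreover have "?z (\<lambda>e. 0) = E" by (auto simp: zero_set_def)
        ultimately show ?thesis
          using tope_agreement_sum[OF B, of q]
          by (simp add: sum.remove[OF finite_covectors zero_covector] t_def)
      qed
      finally show ?thesis using t by simp
    qed
    moreover have "magnitude_fun r E (of_real q) = of_real (\<Sum>C\<in>topes E \<L>. \<Omega> C)"
    proof -
      have reindex: "(\<Sum>C\<in>T X. \<omega> X (restrict_sign (?z X) C)) = sum (\<omega> X) (?T X)" if "X \<in> ?L" for X
        using sum.reindex_bij_betw[OF topes_above_bij[of X], of "\<omega> X"] that by (simp add: T_def)
      have "(\<Sum>C\<in>topes E \<L>. \<Omega> C) * (1 - t) = (\<Sum>X\<in>?L. (- 1) ^ r (?z X) * q ^ card (?z X) *
          (\<Sum>C\<in>T X. \<omega> X (restrict_sign (?z X) C)))"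
        using sum\<Omega>[of "\<lambda>_. 1"] by simp
      also have "\<dots> = (\<Sum>X\<in>?L. (- 1) ^ r (?z X) * q ^ card (?z X) * (\<Sum>D\<in>?T X. \<omega> X D))"
        by (intro sum.cong refl) (simp only: reindex)
      finally have "(\<Sum>C\<in>topes E \<L>. \<Omega> C) * (1 - t) =
          (\<Sum>X\<in>?L. (- 1) ^ r (?z X) * q ^ card (?z X) * (\<Sum>D\<in>?T X. \<omega> X D))" .
      then have "of_real ((\<Sum>C\<in>topes E \<L>. \<Omega> C) * (1 - t)) =
          (\<Sum>X\<in>?L. (- 1) ^ r (?z X) * of_real q ^ card (?z X) * magnitude_fun r (?z X) (of_real q))"
        using \<omega>(2) by simp
      \<comment> \<open>Grouping by zero set turns multiplicities into
        \<open>interval_char r A E\<close>, which is the recursion of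
        \<open>magnitude_fun\<close>.\<close>
      also have "\<dots> = (\<Sum>A\<in>Pow E - {E}. \<Sum>X\<in>{X \<in> ?L. ?z X = A}. (- 1) ^ r (?z X) * of_real q ^ card (?z X) * magnitude_fun r (?z X) (of_real q))"
        using finite_covectors finite_ground zL by (intro sum.group[symmetric]) auto
      also have "\<dots> = (\<Sum>A\<in>Pow E - {E}. of_int ((- 1) ^ r A * interval_char r A E) * of_real q ^ card A * magnitude_fun r A (of_real q))"
      proof (intro sum.cong refl)
        fix A assume A: "A \<in> Pow E - {E}"
        then have "{X \<in> ?L. ?z X = A} = {X \<in> \<L>. ?z X = A}" by (auto simp: zero_set_def)
        then show "(\<Sum>X\<in>{X \<in> ?L. ?z X = A}. (- 1) ^ r (?z X) * of_real q ^ card (?z X) * magnitude_fun r (?z X) (of_real q)) =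
            of_int ((- 1) ^ r A * interval_char r A E) * of_real q ^ card A * magnitude_fun r A (of_real q)"
          using A by (simp add: interval_char_eq_card)
      qed
      also have "\<dots> = magnitude_fun r E (of_real q) * (1 - of_int ((- 1) ^ r E) * of_real q ^ card E)"
        using magnitude_fun_recursion[OF finite_ground False, of "of_real q"] assms(2) by simp
      also have "1 - of_int ((- 1) ^ r E) * of_real q ^ card E = complex_of_real (1 - t)"
        by (simp add: t_def)
      finally show ?thesis using t by (simp del: of_real_diff)
    qed
    ultimately show ?thesis by blast
  qed
qed

section \<open>Varchenko--Gelfand degree and chains of flats\<close>

definition sign_monom :: "'a set \<Rightarrow> ('a \<Rightarrow> int) \<Rightarrow> real" where
  "sign_monom S X = (\<Prod>e\<in>S. real_of_int (X e))"

fun chain_diff :: "('a \<Rightarrow> int) list \<Rightarrow> (('a \<Rightarrow> int) \<Rightarrow> real) \<Rightarrow> ('a \<Rightarrow> int) \<Rightarrow> real" where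
  "chain_diff [] f Y = f Y"
| "chain_diff (D # Ds) f Y = chain_diff Ds (\<lambda>X. f (sign_comp X D) - f (sign_comp X (\<lambda>e. - D e))) Y"

text \<open>
  The covectors \<open>Ds\<close> have zero sets \<open>F\<^sub>0 \<subset> F\<^sub>1 \<subset> \<dots>\<close>, and that of \<open>Y\<close> is larger still. The topes
  \<open>Y \<circ> \<plusminus>D\<^sub>p \<circ> \<dots> \<circ> \<plusminus>D\<^sub>1\<close> form a cube, over which \<open>chain_diff\<close> is the alternating sum.
\<close>

fun covector_chain :: "'a set \<Rightarrow> ('a \<Rightarrow> int) set \<Rightarrow> 'a set \<Rightarrow> ('a \<Rightarrow> int) list \<Rightarrow> ('a \<Rightarrow> int) \<Rightarrow> bool" where
  "covector_chain E \<L> G [] Y \<longleftrightarrow> Y \<in> \<L> \<and> zero_set E Y = G"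
| "covector_chain E \<L> G (D # Ds) Y \<longleftrightarrow>
     D \<in> \<L> \<and> zero_set E D = G \<and> (\<exists>F. G \<subset> F \<and> covector_chain E \<L> F Ds Y)"

text \<open>
  Consecutive flats may differ in rank by more than one here; \<open>odd_chain_rank_chain\<close> below shows that
  this does not change the maximal length.
\<close>

fun odd_chain :: "'a set \<Rightarrow> ('a \<Rightarrow> int) set \<Rightarrow> 'a set \<Rightarrow> nat \<Rightarrow> bool" where
  "odd_chain E \<L> G 0 \<longleftrightarrow> True"
| "odd_chain E \<L> G (Suc p) \<longleftrightarrow>
     (\<exists>F\<in>zero_set E ` \<L>. G \<subset> F \<and> odd (card (F - G)) \<and> odd_chain E \<L> F p)"

text \<open>Covectors with zero set \<open>G\<close> are the topes of the contraction by
  \<open>G\<close>, which is thus treated without leaving \<open>E\<close>. With the strict bound,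
  \<open>p = 0\<close> means that \<open>f\<close> vanishes on them, the start of the
  induction.\<close>

definition low_degree :: "'a set \<Rightarrow> ('a \<Rightarrow> int) set \<Rightarrow> 'a set \<Rightarrow> nat \<Rightarrow> (('a \<Rightarrow> int) \<Rightarrow> real) \<Rightarrow> bool" where
  "low_degree E \<L> G p f \<longleftrightarrow> (\<exists>c. \<forall>X\<in>\<L>. zero_set E X = G \<longrightarrow>
     f X = (\<Sum>S | S \<subseteq> E - G \<and> card S < p. c S * sign_monom S X))"

lemma chain_diff_sum:
  "chain_diff Ds (\<lambda>X. \<Sum>i\<in>I. c i * g i X) Y = (\<Sum>i\<in>I. c i * chain_diff Ds (g i) Y)"
proof (induction Ds arbitrary: g)
  case (Cons D Ds)
  show ?case
    by (simp add: Cons.IH[symmetric] sum_subtractf[symmetric] right_diff_distrib[symmetric])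
qed simp

lemma chain_diff_cmult: "chain_diff Ds (\<lambda>X. c * g X) Y = c * chain_diff Ds g Y"
  using chain_diff_sum[of Ds "\<lambda>_. c" "\<lambda>_. g" "{()}"] by simp

lemma chain_diff_diff: "chain_diff Ds (\<lambda>X. f X - g X) Y = chain_diff Ds f Y - chain_diff Ds g Y"
proof (induction Ds arbitrary: f g)
  case (Cons D Ds)
  show ?case by (simp add: Cons.IH[symmetric] algebra_simps)
qed simp

lemma covector_chain_zero_set: "covector_chain E \<L> G Ds Y \<Longrightarrow> G \<in> zero_set E ` \<L>"
  by (cases Ds) auto

lemma low_degree_cong:
  assumes "low_degree E \<L> G p g" "\<And>X. X \<in> \<L> \<Longrightarrow> zero_set E X = G \<Longrightarrow> f X = g X"
  shows "low_degree E \<L> G p f"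
proof -
  from assms(1) obtain c where
    "\<forall>X\<in>\<L>. zero_set E X = G \<longrightarrow> g X = (\<Sum>S | S \<subseteq> E - G \<and> card S < p. c S * sign_monom S X)"
    unfolding low_degree_def by blast
  then show ?thesis unfolding low_degree_def by (intro exI[of _ c]) (simp add: assms(2))
qed

context oriented_matroid
begin

lemma sign_comp_zero_set:
  assumes "X \<in> \<L>" "D \<in> \<L>" "zero_set E D \<subseteq> zero_set E X"
  shows "sign_comp X D \<in> \<L>" "zero_set E (sign_comp X D) = zero_set E D"
    "sign_comp X (\<lambda>e. - D e) \<in> \<L>" "zero_set E (sign_comp X (\<lambda>e. - D e)) = zero_set E D"
  using assms comp_covector neg_covector by (auto simp: zero_set_sign_comp zero_set_neg)

lemma chain_diff_cong:
  assumes "covector_chain E \<L> G Ds Y" "\<And>X. X \<in> \<L> \<Longrightarrow> zero_set E X = G \<Longrightarrow> f X = g X"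
  shows "chain_diff Ds f Y = chain_diff Ds g Y"
  using assms
proof (induction Ds arbitrary: G f g)
  case (Cons D Ds)
  from Cons.prems(1) obtain F where F: "D \<in> \<L>" "zero_set E D = G" "G \<subset> F" "covector_chain E \<L> F Ds Y"
    by auto
  show ?case
    unfolding chain_diff.simps
  proof (rule Cons.IH[OF F(4)])
    fix X assume X: "X \<in> \<L>" "zero_set E X = F"
    then have "zero_set E D \<subseteq> zero_set E X" using F by auto
    from sign_comp_zero_set[OF X(1) F(1) this]
    show "f (sign_comp X D) - f (sign_comp X (\<lambda>e. - D e)) = g (sign_comp X D) - g (sign_comp X (\<lambda>e. - D e))"
      using Cons.prems(2) F(2) by simp
  qed
qed simp

text \<open>Factors outside the zero set of \<open>X\<close> see only \<open>X\<close>, those inside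
  see \<open>D\<close> or \<open>- D\<close>. A monomial therefore survives only if it has an odd
  number of elements in the zero set; this is the origin of the oddness condition on chains.\<close>

lemma sign_monom_diff:
  assumes "S \<subseteq> E"
  shows "sign_monom S (sign_comp X D) - sign_monom S (sign_comp X (\<lambda>e. - D e)) =
    (1 - (- 1) ^ card (S \<inter> zero_set E X)) * sign_monom (S \<inter> zero_set E X) D * sign_monom (S - zero_set E X) X"
proof -
  let ?F = "zero_set E X"
  have fin: "finite S" using assms finite_ground finite_subset by blast
  have split: "sign_monom S Z = sign_monom (S - ?F) Z * sign_monom (S \<inter> ?F) Z" for Z
    using prod.subset_diff[of "S \<inter> ?F" S "\<lambda>e. real_of_int (Z e)"] fin
    by (simp add: sign_monom_def Diff_Int2 Diff_Int)
  have "sign_monom (S - ?F) (sign_comp X Z) = sign_monom (S - ?F) X" for Z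
    unfolding sign_monom_def using assms by (intro prod.cong) (auto simp: zero_set_def sign_comp_def)
  moreover have "sign_monom (S \<inter> ?F) (sign_comp X Z) = sign_monom (S \<inter> ?F) Z" for Z
    unfolding sign_monom_def by (intro prod.cong) (auto simp: zero_set_def sign_comp_def)
  moreover have "sign_monom (S \<inter> ?F) (\<lambda>e. - D e) = (- 1) ^ card (S \<inter> ?F) * sign_monom (S \<inter> ?F) D"
    by (simp add: sign_monom_def prod_uminus)
  ultimately show ?thesis by (simp add: split[of "sign_comp _ _"] algebra_simps)
qed

lemma chain_diff_sign_monom_Cons:
  assumes "covector_chain E \<L> F Ds Y" "S \<subseteq> E"
  shows "chain_diff (D # Ds) (sign_monom S) Y =
    (1 - (- 1) ^ card (S \<inter> F)) * sign_monom (S \<inter> F) D * chain_diff Ds (sign_monom (S - F)) Y"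
proof -
  have "chain_diff (D # Ds) (sign_monom S) Y =
      chain_diff Ds (\<lambda>X. ((1 - (- 1) ^ card (S \<inter> F)) * sign_monom (S \<inter> F) D) * sign_monom (S - F) X) Y"
    unfolding chain_diff.simps using sign_monom_diff[OF assms(2)]
    by (intro chain_diff_cong[OF assms(1)]) metis
  then show ?thesis by (simp only: chain_diff_cmult)
qed

text \<open>Each difference either kills the monomial or strips at least one element from
  it.\<close>

lemma chain_diff_sign_monom_low:
  assumes "covector_chain E \<L> G Ds Y" "S \<subseteq> E" "card S < length Ds"
  shows "chain_diff Ds (sign_monom S) Y = 0"
  using assms
proof (induction Ds arbitrary: G S)
  case (Cons D Ds)
  from Cons.prems(1) obtain F where F: "covector_chain E \<L> F Ds Y" by auto
  show ?case
  proof (cases "S \<inter> F = {}")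
    case True
    then show ?thesis unfolding chain_diff_sign_monom_Cons[OF F Cons.prems(2)] by simp
  next
    case False
    have "finite S" using Cons.prems(2) finite_ground finite_subset by blast
    then have "card (S - F) < card S" using False by (intro psubset_card_mono) auto
    then have "chain_diff Ds (sign_monom (S - F)) Y = 0"
      using Cons.prems by (intro Cons.IH[OF F]) auto
    then show ?thesis unfolding chain_diff_sign_monom_Cons[OF F Cons.prems(2)] by simp
  qed
qed simp

lemma chain_diff_low_degree:
  assumes "low_degree E \<L> G p f" "covector_chain E \<L> G Ds Y" "p \<le> length Ds"
  shows "chain_diff Ds f Y = 0"
proof -
  from assms(1) obtain c where c: "\<And>X. X \<in> \<L> \<Longrightarrow> zero_set E X = G \<Longrightarrow>
      f X = (\<Sum>S | S \<subseteq> E - G \<and> card S < p. c S * sign_monom S X)"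
    unfolding low_degree_def by blast
  have "chain_diff Ds f Y = (\<Sum>S | S \<subseteq> E - G \<and> card S < p. c S * chain_diff Ds (sign_monom S) Y)"
    unfolding chain_diff_sum[symmetric] by (rule chain_diff_cong[OF assms(2) c])
  also have "\<dots> = 0"
  proof (intro sum.neutral ballI)
    fix S assume "S \<in> {S. S \<subseteq> E - G \<and> card S < p}"
    then have "chain_diff Ds (sign_monom S) Y = 0"
      using assms(3) by (intro chain_diff_sign_monom_low[OF assms(2)]) auto
    then show "c S * chain_diff Ds (sign_monom S) Y = 0" by simp
  qed
  finally show ?thesis .
qed

text \<open>From the full monomial on \<open>E - G\<close> the step to \<open>F\<close> strips
  exactly \<open>F - G\<close> and leaves the full monomial on \<open>E - F\<close>, so the same
  argument applies to the rest of the chain.\<close>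

lemma chain_diff_parity_nonzero:
  assumes "covector_chain E \<L> G Ds Y" "chain_diff Ds (sign_monom (E - G)) Y \<noteq> 0"
  shows "odd_chain E \<L> G (length Ds)"
  using assms
proof (induction Ds arbitrary: G)
  case (Cons D Ds)
  from Cons.prems(1) obtain F where F: "G \<subset> F" "covector_chain E \<L> F Ds Y" by auto
  have "F \<in> zero_set E ` \<L>" by (rule covector_chain_zero_set[OF F(2)])
  then have "F \<subseteq> E" using zero_set_subset by auto
  then have "(E - G) \<inter> F = F - G" "E - G - F = E - F" using F(1) by auto
  with Cons.prems(2) chain_diff_sign_monom_Cons[OF F(2), of "E - G" D]
  have "(1 - (- 1) ^ card (F - G) :: real) \<noteq> 0" "chain_diff Ds (sign_monom (E - F)) Y \<noteq> 0" by auto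
  then have "odd (card (F - G))" "odd_chain E \<L> F (length Ds)" using Cons.IH[OF F(2)] by auto
  then show ?case using F(1) \<open>F \<in> zero_set E ` \<L>\<close> by auto
qed simp

lemma odd_chain_ex_chain_diff:
  assumes "odd_chain E \<L> G p" "G \<in> zero_set E ` \<L>"
  shows "\<exists>Ds Y. covector_chain E \<L> G Ds Y \<and> length Ds = p \<and> chain_diff Ds (sign_monom (E - G)) Y \<noteq> 0"
  using assms
proof (induction p arbitrary: G)
  case 0
  then obtain Y where "Y \<in> \<L>" "zero_set E Y = G" by auto
  then show ?case
    using finite_ground by (intro exI[of _ "[]"] exI[of _ Y]) (auto simp: sign_monom_def zero_set_def)
next
  case (Suc p)
  then obtain F where F: "F \<in> zero_set E ` \<L>" "G \<subset> F" "odd (card (F - G))" "odd_chain E \<L> F p" by auto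
  from Suc.IH[OF F(4,1)] obtain Ds Y where Y: "covector_chain E \<L> F Ds Y" "length Ds = p"
    "chain_diff Ds (sign_monom (E - F)) Y \<noteq> 0" by blast
  obtain D where D: "D \<in> \<L>" "zero_set E D = G" using Suc.prems(2) by auto
  have "F \<subseteq> E" using F(1) zero_set_subset by auto
  then have eq: "(E - G) \<inter> F = F - G" "E - G - F = E - F" using F(2) by auto
  have "finite (F - G)" using \<open>F \<subseteq> E\<close> by (intro finite_subset[OF _ finite_ground]) auto
  then have "sign_monom (F - G) D \<noteq> 0"
    using D(2) \<open>F \<subseteq> E\<close> by (auto simp: sign_monom_def zero_set_def)
  then have "chain_diff (D # Ds) (sign_monom (E - G)) Y \<noteq> 0"
    using chain_diff_sign_monom_Cons[OF Y(1), of "E - G" D] F(3) Y(3) by (simp add: eq)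
  then show ?case
    using Y D F by (intro exI[of _ "D # Ds"] exI[of _ Y]) auto
qed

lemma low_degree_add:
  assumes "low_degree E \<L> G p f" "low_degree E \<L> G p g"
  shows "low_degree E \<L> G p (\<lambda>X. f X + g X)"
proof -
  from assms obtain c d where
    "\<forall>X\<in>\<L>. zero_set E X = G \<longrightarrow> f X = (\<Sum>S | S \<subseteq> E - G \<and> card S < p. c S * sign_monom S X)"
    "\<forall>X\<in>\<L>. zero_set E X = G \<longrightarrow> g X = (\<Sum>S | S \<subseteq> E - G \<and> card S < p. d S * sign_monom S X)"
    unfolding low_degree_def by blast
  then show ?thesis unfolding low_degree_def
    by (intro exI[of _ "\<lambda>S. c S + d S"]) (simp add: distrib_right sum.distrib)
qed

lemma low_degree_cmult:
  assumes "low_degree E \<L> G p f"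
  shows "low_degree E \<L> G p (\<lambda>X. a * f X)"
proof -
  from assms obtain c where
    "\<forall>X\<in>\<L>. zero_set E X = G \<longrightarrow> f X = (\<Sum>S | S \<subseteq> E - G \<and> card S < p. c S * sign_monom S X)"
    unfolding low_degree_def by blast
  then show ?thesis unfolding low_degree_def
    by (intro exI[of _ "\<lambda>S. a * c S"]) (simp add: sum_distrib_left mult.assoc)
qed

lemma low_degree_sign_monom:
  assumes "S \<subseteq> E - G" "card S < p"
  shows "low_degree E \<L> G p (sign_monom S)"
  unfolding low_degree_def
proof (intro exI[of _ "\<lambda>T. if T = S then 1 else 0"] ballI impI)
  fix X
  have "finite {T. T \<subseteq> E - G \<and> card T < p}" using finite_ground by simp
  then show "sign_monom S X = (\<Sum>T | T \<subseteq> E - G \<and> card T < p. (if T = S then 1 else 0) * sign_monom T X)"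
    using assms by (simp add: if_distrib[of "\<lambda>x. x * _"] sum.delta' cong: if_cong)
qed

lemma low_degree_sum:
  assumes "\<And>i. i \<in> I \<Longrightarrow> low_degree E \<L> G p (f i)"
  shows "low_degree E \<L> G p (\<lambda>X. \<Sum>i\<in>I. f i X)"
proof -
  have 0: "low_degree E \<L> G p (\<lambda>X. 0)" unfolding low_degree_def by (intro exI[of _ "\<lambda>_. 0"]) simp
  from assms show ?thesis
    by (induction I rule: infinite_finite_induct) (simp_all add: 0 low_degree_add)
qed

text \<open>Any preimage of \<open>X'\<close> vanishes on \<open>G\<close>, the closure of its
  trace. Composing it with a covector of zero set \<open>G\<close> removes the surplus zeros outside
  \<open>A\<close> and changes no sign on \<open>A\<close>.\<close>

lemma restrict_covector_lift:
  assumes "A \<subseteq> E" "G \<in> zero_set E ` \<L>" "\<forall>Y\<in>\<L>. G \<inter> A \<subseteq> zero_set E Y \<longrightarrow> G \<subseteq> zero_set E Y"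
    and "X' \<in> restrict_sign A ` \<L>" "zero_set A X' = G \<inter> A"
  shows "\<exists>X\<in>\<L>. zero_set E X = G \<and> restrict_sign A X = X'"
proof -
  obtain X0 where X0: "X0 \<in> \<L>" "X' = restrict_sign A X0" using assms(4) by blast
  then have z: "zero_set E X0 \<inter> A = G \<inter> A" using assms(5) zero_set_restrict_sign[OF assms(1)] by simp
  then have GX: "G \<subseteq> zero_set E X0" using assms(3) X0(1) by blast
  obtain W where W: "W \<in> \<L>" "zero_set E W = G" using assms(2) by auto
  have "restrict_sign A (sign_comp X0 W) e = X' e" for e
  proof (cases "e \<in> A \<and> X0 e = 0")
    case True
    then have "e \<in> G" using z assms(1) by (auto simp: zero_set_def)
    then show ?thesis using True W(2) X0(2) by (auto simp: zero_set_def restrict_sign_def sign_comp_def)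
  qed (use X0(2) in \<open>auto simp: restrict_sign_def sign_comp_def\<close>)
  then have "restrict_sign A (sign_comp X0 W) = X'" by blast
  moreover have "sign_comp X0 W \<in> \<L>" "zero_set E (sign_comp X0 W) = G"
    using sign_comp_zero_set[OF X0(1) W(1)] GX W(2) by auto
  ultimately show ?thesis by blast
qed

text \<open>Each flat of the restriction is replaced by its closure in \<open>E\<close>, which has
  the same trace on \<open>A\<close>. Being the closure of its own trace is the property of
  \<open>G\<close> that passes along the chain.\<close>

lemma restrict_chain_lift:
  assumes "A \<subseteq> E" "G \<in> zero_set E ` \<L>" "\<forall>Y\<in>\<L>. G \<inter> A \<subseteq> zero_set E Y \<longrightarrow> G \<subseteq> zero_set E Y"
    and "\<And>X. X \<in> \<L> \<Longrightarrow> zero_set E X = G \<Longrightarrow> f X = f' (restrict_sign A X)"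
    and "covector_chain A (restrict_sign A ` \<L>) (G \<inter> A) Ds' Y'"
  shows "\<exists>Ds Y. covector_chain E \<L> G Ds Y \<and> length Ds = length Ds' \<and> chain_diff Ds f Y = chain_diff Ds' f' Y'"
  using assms(2-)
proof (induction Ds' arbitrary: G f f')
  case Nil
  then obtain Y where "Y \<in> \<L>" "zero_set E Y = G" "restrict_sign A Y = Y'"
    using restrict_covector_lift[OF assms(1), of G Y'] by auto
  then show ?case using Nil(3) by (intro exI[of _ "[]"] exI[of _ Y]) simp
next
  case (Cons D' Ds')
  from Cons.prems(4) obtain F' where D': "D' \<in> restrict_sign A ` \<L>" "zero_set A D' = G \<inter> A"
    and F': "G \<inter> A \<subset> F'" "covector_chain A (restrict_sign A ` \<L>) F' Ds' Y'" by auto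
  obtain D where D: "D \<in> \<L>" "zero_set E D = G" "restrict_sign A D = D'"
    using restrict_covector_lift[OF assms(1) Cons.prems(1,2) D'] by blast
  obtain X1 where X1: "X1 \<in> \<L>" "F' = zero_set E X1 \<inter> A"
    using covector_chain_zero_set[OF F'(2)] zero_set_restrict_sign[OF assms(1)] by auto
  have "F' \<subseteq> E" using X1 zero_set_subset by auto
  then obtain W where W: "W \<in> \<L>" "F' \<subseteq> zero_set E W"
    "\<forall>Y\<in>\<L>. F' \<subseteq> zero_set E Y \<longrightarrow> zero_set E W \<subseteq> zero_set E Y"
    using ex_generic_covector by blast
  define F where "F = zero_set E W"
  have FA: "F \<inter> A = F'" using W X1 by (auto simp: F_def)
  have GF: "G \<subset> F"
  proof -
    have "G \<inter> A \<subseteq> zero_set E W" using F'(1) W(2) by auto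
    then have "G \<subseteq> F" using Cons.prems(2) W(1) by (auto simp: F_def)
    then show ?thesis using FA F'(1) by auto
  qed
  have "\<exists>Ds Y. covector_chain E \<L> F Ds Y \<and> length Ds = length Ds' \<and>
      chain_diff Ds (\<lambda>X. f (sign_comp X D) - f (sign_comp X (\<lambda>e. - D e))) Y =
      chain_diff Ds' (\<lambda>X. f' (sign_comp X D') - f' (sign_comp X (\<lambda>e. - D' e))) Y'"
  proof (rule Cons.IH)
    show "F \<in> zero_set E ` \<L>" using W(1) by (simp add: F_def)
    show "\<forall>Y\<in>\<L>. F \<inter> A \<subseteq> zero_set E Y \<longrightarrow> F \<subseteq> zero_set E Y" using W(3) FA by (simp add: F_def)
    show "covector_chain A (restrict_sign A ` \<L>) (F \<inter> A) Ds' Y'" using F'(2) FA by simp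
    fix X assume X: "X \<in> \<L>" "zero_set E X = F"
    then have "zero_set E D \<subseteq> zero_set E X" using GF D(2) by auto
    from sign_comp_zero_set[OF X(1) D(1) this]
    show "f (sign_comp X D) - f (sign_comp X (\<lambda>e. - D e)) =
        f' (sign_comp (restrict_sign A X) D') - f' (sign_comp (restrict_sign A X) (\<lambda>e. - D' e))"
      using Cons.prems(3) D(2,3) by (simp add: restrict_sign_comp restrict_sign_neg)
  qed
  then obtain Ds Y where "covector_chain E \<L> F Ds Y" "length Ds = length Ds'"
      "chain_diff Ds (\<lambda>X. f (sign_comp X D) - f (sign_comp X (\<lambda>e. - D e))) Y =
      chain_diff Ds' (\<lambda>X. f' (sign_comp X D') - f' (sign_comp X (\<lambda>e. - D' e))) Y'" by blast
  then show ?case using D GF by (intro exI[of _ "D # Ds"] exI[of _ Y]) auto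
qed

end

text \<open>
  Let \<open>F\<close> be a flat covering \<open>G\<close>. By induction the difference of \<open>f\<close> across \<open>F\<close> is a polynomial \<open>P\<close> of
  degree less than \<open>p - 1\<close> on the covectors with zero set \<open>F\<close> (contraction). Subtracting \<open>P\<close> times a
  Heaviside function of an element of \<open>F - G\<close> makes \<open>f\<close> independent of the signs on \<open>F - G\<close>, and
  the elements of \<open>F - G\<close> can be deleted.
\<close>

lemma low_degree_if_chain_diff_zero:
  assumes "oriented_matroid E \<L>" "G \<in> zero_set E ` \<L>"
    and "\<And>Ds Y. covector_chain E \<L> G Ds Y \<Longrightarrow> length Ds = p \<Longrightarrow> chain_diff Ds f Y = 0"
  shows "low_degree E \<L> G p f"
  using assms
proof (induction "card (E - G)" arbitrary: E \<L> G p f rule: less_induct)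
  case less
  interpret oriented_matroid E \<L> by (rule less.prems)
  let ?z = "zero_set E"
  show ?case
  proof (cases p)
    case 0
    have "f X = 0" if "X \<in> \<L>" "?z X = G" for X
      using less.prems(3)[of "[]" X] that 0 by simp
    then show ?thesis unfolding low_degree_def 0 by simp
  next
    case p: (Suc p')
    show ?thesis
    proof (cases "G = E")
      case True
      have "X = (\<lambda>e. 0)" if "X \<in> \<L>" "?z X = G" for X
        using that True covector_outside[OF that(1)] by (fastforce simp: zero_set_def)
      moreover have "{S. S \<subseteq> E - G \<and> card S < p} = {{}}" using True p by auto
      ultimately show ?thesis
        unfolding low_degree_def
        by (intro exI[of _ "\<lambda>_. f (\<lambda>e. 0)"]) (auto simp: sign_monom_def)
    next
      case False
      obtain D where D: "D \<in> \<L>" "?z D = G" using less.prems(2) by auto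
      have GE: "G \<subset> E" using False less.prems(2) zero_set_subset by auto
      let ?P = "\<lambda>F. F \<in> ?z ` \<L> \<and> G \<subset> F"
      have "?z (\<lambda>e. 0) = E" by (auto simp: zero_set_def)
      then have "?P E" using zero_covector GE by force
      \<comment> \<open>Minimum cardinality makes \<open>F\<close> a cover of \<open>G\<close>: a
        covector vanishing on \<open>G\<close> and at one element of \<open>F - G\<close> then
        vanishes on all of \<open>F\<close>.\<close>
      then obtain F where F: "?P F" "\<forall>F'. ?P F' \<longrightarrow> card F \<le> card F'"
        using ex_has_least_nat[of ?P E card] by blast
      have FE: "F \<subseteq> E" using F(1) zero_set_subset by auto
      have finF: "finite F" using FE finite_ground finite_subset by blast
      have cover: "F \<subseteq> ?z X" if "X \<in> \<L>" "G \<subseteq> ?z X" "g \<in> F - G" "X g = 0" for X g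
      proof -
        obtain W where W: "W \<in> \<L>" "F = ?z W" using F(1) by blast
        have "?z (sign_comp X W) = ?z X \<inter> F" using W(2) by (simp add: zero_set_sign_comp)
        moreover have "g \<in> ?z X \<inter> F" using that FE by (auto simp: zero_set_def)
        ultimately have "?P (?z X \<inter> F)" using comp_covector[OF that(1) W(1)] that(2,3) F(1) by blast
        then have "card F \<le> card (?z X \<inter> F)" using F(2) by blast
        then have "?z X \<inter> F = F" using finF by (intro card_seteq) auto
        then show ?thesis by blast
      qed
      \<comment> \<open>After contracting \<open>G\<close>, the elements of \<open>F - G\<close> are
        parallel, so the sign at \<open>e\<close> determines the others. Otherwise elimination at
        \<open>g\<close> would give a covector vanishing at \<open>g\<close> but not at
        \<open>e\<close>.\<close>
      have parallel: "X g = W g"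
        if X: "X \<in> \<L>" "?z X = G" and W: "W \<in> \<L>" "?z W = G" and e: "e \<in> F - G" "X e = W e" and g: "g \<in> F - G" for X W e g
      proof (rule ccontr)
        assume "X g \<noteq> W g"
        moreover have ne: "X g \<noteq> 0" "W g \<noteq> 0" "X e \<noteq> 0" using X(2) W(2) e g FE by (auto simp: zero_set_def)
        ultimately have "W g = - X g" using covector_values[OF X(1), of g] covector_values[OF W(1), of g] by auto
        with eliminate[OF X(1) W(1) ne(1)] obtain Z where Z: "Z \<in> \<L>" "Z g = 0"
          "\<And>f. f \<in> E \<Longrightarrow> X f = 0 \<or> W f \<noteq> - X f \<Longrightarrow> Z f = sign_comp X W f" by metis
        have "Z e \<noteq> 0" using Z(3)[of e] ne e FE by (auto simp: sign_comp_def)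
        moreover have "G \<subseteq> ?z Z"
        proof
          fix h assume h: "h \<in> G"
          then have "X h = 0" "W h = 0" "h \<in> E" using X(2) W(2) by (auto simp: zero_set_def)
          then show "h \<in> ?z Z" using Z(3)[of h] by (simp add: zero_set_def sign_comp_def)
        qed
        ultimately show False using cover[OF Z(1) _ g Z(2)] e by (auto simp: zero_set_def)
      qed
      obtain e where e: "e \<in> F - G" using F(1) by blast
      have eE: "e \<in> E" using e FE by auto
      have De: "D e = 1 \<or> D e = - 1" using D e eE covector_values[OF D(1), of e] by (auto simp: zero_set_def)
      have above: "sign_comp Y D \<in> \<L>" "?z (sign_comp Y D) = G"
          "sign_comp Y (\<lambda>e. - D e) \<in> \<L>" "?z (sign_comp Y (\<lambda>e. - D e)) = G"
        if "Y \<in> \<L>" "G \<subseteq> ?z Y" for Y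
        using sign_comp_zero_set[OF that(1) D(1)] that(2) D(2) by simp_all
      have "low_degree E \<L> F p' (\<lambda>X. f (sign_comp X D) - f (sign_comp X (\<lambda>e. - D e)))"
      proof (rule less.hyps)
        show "card (E - F) < card (E - G)"
          using e eE F(1) finite_ground by (intro psubset_card_mono) auto
        show "F \<in> ?z ` \<L>" using F(1) by blast
        fix Ds Y assume "covector_chain E \<L> F Ds Y" "length Ds = p'"
        then have "covector_chain E \<L> G (D # Ds) Y" "length (D # Ds) = p" using D F(1) p by auto
        from less.prems(3)[OF this]
        show "chain_diff Ds (\<lambda>X. f (sign_comp X D) - f (sign_comp X (\<lambda>e. - D e))) Y = 0" by simp
      qed (rule less.prems)
      then obtain c where c: "\<And>Y. Y \<in> \<L> \<Longrightarrow> ?z Y = F \<Longrightarrow> f (sign_comp Y D) - f (sign_comp Y (\<lambda>e. - D e)) =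
          (\<Sum>S | S \<subseteq> E - F \<and> card S < p'. c S * sign_monom S Y)"
        unfolding low_degree_def by blast
      define P where "P X = (\<Sum>S | S \<subseteq> E - F \<and> card S < p'. c S * sign_monom S X)" for X
      \<comment> \<open>On covectors with zero set \<open>G\<close> this is \<open>P\<close> times
        the indicator of \<open>X e = D e\<close>, that is \<open>(1 + D e * X e) / 2\<close>,
        multiplied out into monomials; the degree rises by at most one.\<close>
      define h where "h X = (\<Sum>S | S \<subseteq> E - F \<and> card S < p'. (c S / 2) * sign_monom S X +
          (c S / 2 * D e) * sign_monom (insert e S) X)" for X
      define f1 where "f1 X = f X - h X" for X
      have h_eq: "h X = (1 + D e * X e) / 2 * P X" for X
      proof -
        have "sign_monom (insert e S) X = X e * sign_monom S X" if "S \<subseteq> E - F" for S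
        proof -
          have "finite S" "e \<notin> S" using that e finite_ground finite_subset[of S E] by auto
          then show ?thesis by (simp add: sign_monom_def)
        qed
        then show ?thesis
          unfolding h_def P_def sum_distrib_left by (intro sum.cong refl) (simp add: field_simps)
      qed
      have h_low: "low_degree E \<L> G p h"
        unfolding h_def
      proof (intro low_degree_sum low_degree_add low_degree_cmult low_degree_sign_monom)
        fix S assume S: "S \<in> {S. S \<subseteq> E - F \<and> card S < p'}"
        then show "S \<subseteq> E - G" "insert e S \<subseteq> E - G" "card S < p" using F(1) e eE p by auto
        have "card (insert e S) \<le> Suc (card S)" by (rule card_insert_le_m1) auto
        then show "card (insert e S) < p" using S p by auto
      qed
      have P_comp: "P (sign_comp Y Z) = P Y" if "?z Y = F" for Y Z
      proof -
        have "sign_monom S (sign_comp Y Z) = sign_monom S Y" if "S \<subseteq> E - F" for S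
          unfolding sign_monom_def using that \<open>?z Y = F\<close>
          by (intro prod.cong) (auto simp: sign_comp_def zero_set_def)
        then show ?thesis by (simp add: P_def)
      qed
      have f1_swap: "f1 (sign_comp Y D) = f1 (sign_comp Y (\<lambda>e. - D e))" if Y: "Y \<in> \<L>" "?z Y = F" for Y
      proof -
        have "Y e = 0" using e Y(2) by (auto simp: zero_set_def)
        then have "h (sign_comp Y D) = P Y" "h (sign_comp Y (\<lambda>e. - D e)) = 0"
          using De P_comp[OF Y(2)] by (auto simp: h_eq sign_comp_def)
        then show ?thesis using c[OF Y] by (simp add: f1_def P_def)
      qed
      define A where "A = E - (F - G)"
      have AE: "A \<subseteq> E" and GA: "G \<inter> A = G" using GE by (auto simp: A_def)
      let ?R = "restrict_sign A"
      \<comment> \<open>The chosen preimage is arbitrary and may vanish on \<open>F - G\<close>;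
        composing with \<open>D\<close> repairs this.\<close>
      define f2 where "f2 X' = f1 (sign_comp (SOME X. X \<in> \<L> \<and> ?R X = X') D)" for X'
      have f2: "f1 X = f2 (?R X)" if X: "X \<in> \<L>" "?z X = G" for X
      proof -
        define W where "W = (SOME W. W \<in> \<L> \<and> ?R W = ?R X)"
        have W: "W \<in> \<L>" "?R W = ?R X" using someI[of "\<lambda>W. W \<in> \<L> \<and> ?R W = ?R X" X] X by (auto simp: W_def)
        have WA: "W g = X g" if "g \<in> A" for g
          using fun_cong[OF W(2), of g] that by (simp add: restrict_sign_def)
        have GW: "G \<subseteq> ?z W"
        proof
          fix g assume g: "g \<in> G"
          then have "g \<in> A" "X g = 0" "g \<in> E" using X(2) GE by (auto simp: A_def zero_set_def)
          then show "g \<in> ?z W" using WA[of g] by (simp add: zero_set_def)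
        qed
        define V where "V = sign_comp W D"
        have V: "V \<in> \<L>" "?z V = G" using above[OF W(1) GW] by (simp_all add: V_def)
        have VA: "V g = X g" if "g \<in> E - (F - G)" for g
        proof (cases "X g = 0")
          case True
          then have "g \<in> G" using that X(2) by (auto simp: zero_set_def)
          then show ?thesis using True V(2) by (auto simp: zero_set_def)
        next
          case False
          then show ?thesis using WA[of g] that by (simp add: A_def V_def sign_comp_def)
        qed
        \<comment> \<open>\<open>X\<close> and \<open>V\<close> agree off \<open>F - G\<close>, so
          by parallelism they are equal or opposite on all of \<open>F - G\<close>. If opposite,
          elimination at \<open>e\<close> gives a covector \<open>Z\<close> with zero set
          \<open>F\<close>, and \<open>X\<close> and \<open>V\<close> are its composites with
          \<open>D\<close> and \<open>- D\<close>, where \<open>f1\<close> takes equal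
          values.\<close>
        have "f1 X = f1 V"
        proof (cases "V e = X e")
          case True
          have "V g = X g" for g
          proof (cases "g \<in> E")
            case inE: True
            then show ?thesis using VA[of g] parallel[OF V X e True] by (cases "g \<in> F - G") auto
          next
            case False
            then show ?thesis using covector_outside[OF V(1)] covector_outside[OF X(1)] by simp
          qed
          then have "V = X" by blast
          then show ?thesis by simp
        next
          case False
          have ne: "X e \<noteq> 0" "V e \<noteq> 0" using X(2) V(2) e eE by (auto simp: zero_set_def)
          then have Ve: "V e = - X e"
            using False covector_values[OF X(1), of e] covector_values[OF V(1), of e] by auto
          obtain Z where Z: "Z \<in> \<L>" "Z e = 0"
            "\<And>f. f \<in> E \<Longrightarrow> X f = 0 \<or> V f \<noteq> - X f \<Longrightarrow> Z f = sign_comp X V f"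
            using eliminate[OF X(1) V(1) ne(1) Ve] by metis
          have Zout: "Z g = X g" if "g \<in> E - (F - G)" for g
            using Z(3)[of g] VA[OF that] that by (auto simp: sign_comp_def)
          have "G \<subseteq> ?z Z"
          proof
            fix g assume g: "g \<in> G"
            then have "g \<in> E" "X g = 0" using X(2) by (auto simp: zero_set_def)
            then show "g \<in> ?z Z" using Zout[of g] g by (simp add: zero_set_def)
          qed
          then have FZ: "F \<subseteq> ?z Z" using cover[OF Z(1) _ e Z(2)] by blast
          moreover have "?z Z \<subseteq> F"
          proof
            fix g assume "g \<in> ?z Z"
            then show "g \<in> F" using Zout[of g] X(2) F(1) by (auto simp: zero_set_def)
          qed
          ultimately have zZ: "?z Z = F" by blast
          have side: "U = (if U e = D e then sign_comp Z D else sign_comp Z (\<lambda>e. - D e))"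
            if U: "U \<in> \<L>" "?z U = G" "\<And>g. g \<in> E - (F - G) \<Longrightarrow> U g = X g" for U
          proof
            fix g
            let ?U = "if U e = D e then sign_comp Z D else sign_comp Z (\<lambda>e. - D e)"
            have zF: "Z g = 0" if "g \<in> F" for g using FZ that by (auto simp: zero_set_def)
            consider "g \<notin> E" | "g \<in> E - F" | "g \<in> G" | "g \<in> F - G" using F(1) by blast
            then show "U g = ?U g"
            proof cases
              case 1
              then show ?thesis using covector_outside[OF U(1)] covector_outside[OF Z(1)] covector_outside[OF D(1)]
                by (simp add: sign_comp_def)
            next
              case 2
              then have "X g \<noteq> 0" using X(2) F(1) by (auto simp: zero_set_def)
              then show ?thesis using U(3)[of g] Zout[of g] 2 by (simp add: sign_comp_def)
            next
              case 3
              then have "U g = 0" "D g = 0" using U(2) D(2) by (auto simp: zero_set_def)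
              then show ?thesis using zF[of g] 3 F(1) by (auto simp: sign_comp_def)
            next
              case 4
              show ?thesis
              proof (cases "U e = D e")
                case True
                then show ?thesis using parallel[OF U(1,2) D e True 4] zF[of g] 4 by (simp add: sign_comp_def)
              next
                case False
                have "U e \<noteq> 0" using U(2) e eE by (auto simp: zero_set_def)
                then have "U e = (\<lambda>e. - D e) e" using False De covector_values[OF U(1), of e] by auto
                from parallel[OF U(1,2) neg_covector[OF D(1)] _ e this 4] D(2)
                show ?thesis using zF[of g] 4 False by (simp add: sign_comp_def zero_set_neg)
              qed
            qed
          qed
          have "X e = D e \<longleftrightarrow> V e \<noteq> D e" using Ve ne De covector_values[OF X(1), of e] by auto
          with side[OF X] side[OF V VA] f1_swap[OF Z(1) zZ] show ?thesis by (auto split: if_splits)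
        qed
        then show ?thesis by (simp add: f2_def W_def V_def)
      qed
      have "low_degree A (?R ` \<L>) G p f2"
      proof (rule less.hyps)
        show "card (A - G) < card (E - G)"
          using e eE finite_ground by (intro psubset_card_mono) (auto simp: A_def)
        show "oriented_matroid A (?R ` \<L>)" by (rule restrict_oriented_matroid[OF AE])
        have "zero_set A (?R D) = G" using zero_set_restrict_sign[OF AE] D(2) GA by simp
        then show "G \<in> zero_set A ` ?R ` \<L>" using D(1) by blast
        fix Ds' Y' assume chain: "covector_chain A (?R ` \<L>) G Ds' Y'" "length Ds' = p"
        have "\<exists>Ds Y. covector_chain E \<L> G Ds Y \<and> length Ds = length Ds' \<and> chain_diff Ds f1 Y = chain_diff Ds' f2 Y'"
          by (rule restrict_chain_lift[OF AE less.prems(2)]) (use GA f2 chain in auto)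
        then obtain Ds Y where Ds: "covector_chain E \<L> G Ds Y" "length Ds = p"
          "chain_diff Ds f1 Y = chain_diff Ds' f2 Y'" using chain(2) by auto
        have "chain_diff Ds f1 Y = chain_diff Ds f Y - chain_diff Ds h Y"
          unfolding f1_def by (rule chain_diff_diff)
        then show "chain_diff Ds' f2 Y' = 0"
          using Ds less.prems(3)[OF Ds(1,2)] chain_diff_low_degree[OF h_low Ds(1)] by simp
      qed
      then obtain d where d: "\<And>X'. X' \<in> ?R ` \<L> \<Longrightarrow> zero_set A X' = G \<Longrightarrow>
          f2 X' = (\<Sum>S | S \<subseteq> A - G \<and> card S < p. d S * sign_monom S X')"
        unfolding low_degree_def by blast
      have "low_degree E \<L> G p (\<lambda>X. \<Sum>S | S \<subseteq> A - G \<and> card S < p. d S * sign_monom S X)"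
        using AE by (intro low_degree_sum low_degree_cmult low_degree_sign_monom) auto
      then have "low_degree E \<L> G p (\<lambda>X. (\<Sum>S | S \<subseteq> A - G \<and> card S < p. d S * sign_monom S X) + h X)"
        by (rule low_degree_add[OF _ h_low])
      moreover have "f X = (\<Sum>S | S \<subseteq> A - G \<and> card S < p. d S * sign_monom S X) + h X"
        if X: "X \<in> \<L>" "?z X = G" for X
      proof -
        have "zero_set A (?R X) = G" using zero_set_restrict_sign[OF AE] X(2) GA by simp
        then have "f1 X = (\<Sum>S | S \<subseteq> A - G \<and> card S < p. d S * sign_monom S (?R X))"
          using f2[OF X] d X(1) by simp
        also have "\<dots> = (\<Sum>S | S \<subseteq> A - G \<and> card S < p. d S * sign_monom S X)"
          by (intro sum.cong refl arg_cong2[of _ _ _ _ "(*)"])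
             (auto simp: sign_monom_def restrict_sign_def intro!: prod.cong)
        finally show ?thesis by (simp add: f1_def)
      qed
      ultimately show ?thesis by (rule low_degree_cong)
    qed
  qed
qed

text \<open>Products of affine factors expand into submonomials only, so the degree cannot grow.
  Used in both directions, this identifies the degree in Heaviside functions with the degree in
  signs.\<close>

lemma affine_change_of_monomials:
  fixes \<phi> \<psi> :: "'a \<Rightarrow> 'b \<Rightarrow> real"
  assumes "finite E" "\<And>B e. B \<in> T \<Longrightarrow> e \<in> E \<Longrightarrow> \<psi> e B = a * \<phi> e B + b"
    and "\<And>B. B \<in> T \<Longrightarrow> f B = (\<Sum>S | S \<subseteq> E \<and> card S \<le> k. c S * (\<Prod>e\<in>S. \<psi> e B))"
  shows "\<exists>d. \<forall>B\<in>T. f B = (\<Sum>S | S \<subseteq> E \<and> card S \<le> k. d S * (\<Prod>e\<in>S. \<phi> e B))"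
proof (intro exI ballI)
  let ?S = "{S. S \<subseteq> E \<and> card S \<le> k}"
  fix B assume B: "B \<in> T"
  have expand: "c S * (\<Prod>e\<in>S. \<psi> e B) =
      (\<Sum>U\<in>?S. if U \<subseteq> S then c S * a ^ card U * b ^ card (S - U) * (\<Prod>e\<in>U. \<phi> e B) else 0)"
    if S: "S \<in> ?S" for S
  proof -
    have fin: "finite S" using S assms(1) finite_subset by auto
    have "(\<Prod>e\<in>S. \<psi> e B) = (\<Prod>e\<in>S. a * \<phi> e B + b)"
      using S assms(2)[OF B] by (intro prod.cong) auto
    also have "\<dots> = (\<Sum>U\<in>Pow S. (\<Prod>e\<in>U. a * \<phi> e B) * (\<Prod>e\<in>S - U. b))" by (rule prod_add[OF fin])
    also have "c S * \<dots> = (\<Sum>U\<in>Pow S. c S * a ^ card U * b ^ card (S - U) * (\<Prod>e\<in>U. \<phi> e B))"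
      unfolding sum_distrib_left by (intro sum.cong refl) (simp add: prod.distrib)
    also have "\<dots> = (\<Sum>U\<in>?S. if U \<subseteq> S then c S * a ^ card U * b ^ card (S - U) * (\<Prod>e\<in>U. \<phi> e B) else 0)"
      using S assms(1) card_mono[OF fin] by (intro sum.mono_neutral_cong_left) (auto intro: order_trans)
    finally show ?thesis .
  qed
  have "f B = (\<Sum>S\<in>?S. \<Sum>U\<in>?S. if U \<subseteq> S then c S * a ^ card U * b ^ card (S - U) * (\<Prod>e\<in>U. \<phi> e B) else 0)"
    using assms(3)[OF B] expand by simp
  also have "\<dots> = (\<Sum>U\<in>?S. \<Sum>S\<in>?S. if U \<subseteq> S then c S * a ^ card U * b ^ card (S - U) * (\<Prod>e\<in>U. \<phi> e B) else 0)"
    by (rule sum.swap)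
  also have "\<dots> = (\<Sum>U\<in>?S. (\<Sum>S\<in>?S. if U \<subseteq> S then c S * a ^ card U * b ^ card (S - U) else 0) * (\<Prod>e\<in>U. \<phi> e B))"
    unfolding sum_distrib_right by (intro sum.cong refl) auto
  finally show "f B = (\<Sum>U\<in>?S. (\<Sum>S\<in>?S. if U \<subseteq> S then c S * a ^ card U * b ^ card (S - U) else 0) * (\<Prod>e\<in>U. \<phi> e B))" .
qed

context oriented_matroid
begin

lemma topes_iff_zero_set: "B \<in> topes E \<L> \<longleftrightarrow> B \<in> \<L> \<and> zero_set E B = {}"
  by (auto simp: topes_def zero_set_def)

lemma vg_filtration_iff_low_degree: "vg_filtration E \<L> k f \<longleftrightarrow> low_degree E \<L> {} (Suc k) f"
proof -
  have sign: "real_of_int (B e) = 2 * heaviside e B + - 1" if "B \<in> topes E \<L>" "e \<in> E" for B e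
    using that covector_values[of B e] by (auto simp: topes_def heaviside_def)
  have heavi: "heaviside e B = (1 / 2) * real_of_int (B e) + 1 / 2" if "B \<in> topes E \<L>" "e \<in> E" for B e
    unfolding sign[OF that] by (simp add: field_simps)
  have low: "low_degree E \<L> {} (Suc k) f \<longleftrightarrow> (\<exists>c. \<forall>B\<in>topes E \<L>.
      f B = (\<Sum>S | S \<subseteq> E \<and> card S \<le> k. c S * (\<Prod>e\<in>S. real_of_int (B e))))"
    by (auto simp: low_degree_def topes_iff_zero_set sign_monom_def less_Suc_eq_le)
  show ?thesis unfolding low vg_filtration_def
  proof
    assume "\<exists>c. \<forall>B\<in>topes E \<L>. f B = (\<Sum>S | S \<subseteq> E \<and> card S \<le> k. c S * (\<Prod>e\<in>S. heaviside e B))"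
    then obtain c where c: "\<And>B. B \<in> topes E \<L> \<Longrightarrow>
        f B = (\<Sum>S | S \<subseteq> E \<and> card S \<le> k. c S * (\<Prod>e\<in>S. heaviside e B))" by blast
    show "\<exists>c. \<forall>B\<in>topes E \<L>. f B = (\<Sum>S | S \<subseteq> E \<and> card S \<le> k. c S * (\<Prod>e\<in>S. real_of_int (B e)))"
      by (rule affine_change_of_monomials[OF finite_ground heavi c])
  next
    assume "\<exists>c. \<forall>B\<in>topes E \<L>. f B = (\<Sum>S | S \<subseteq> E \<and> card S \<le> k. c S * (\<Prod>e\<in>S. real_of_int (B e)))"
    then obtain c where c: "\<And>B. B \<in> topes E \<L> \<Longrightarrow>
        f B = (\<Sum>S | S \<subseteq> E \<and> card S \<le> k. c S * (\<Prod>e\<in>S. real_of_int (B e)))" by blast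
    show "\<exists>c. \<forall>B\<in>topes E \<L>. f B = (\<Sum>S | S \<subseteq> E \<and> card S \<le> k. c S * (\<Prod>e\<in>S. heaviside e B))"
      by (rule affine_change_of_monomials[OF finite_ground sign c])
  qed
qed

lemma tope_parity_eq_sign_monom: "tope_parity E = sign_monom (E - {})"
  by (auto simp: tope_parity_def sign_monom_def)

lemma low_degree_parity:
  assumes "{} \<in> zero_set E ` \<L>" "\<not> odd_chain E \<L> {} (Suc k)"
  shows "low_degree E \<L> {} (Suc k) (tope_parity E)"
  unfolding tope_parity_eq_sign_monom
  using assms(2) chain_diff_parity_nonzero[of "{}"]
  by (intro low_degree_if_chain_diff_zero[OF oriented_matroid_axioms assms(1)]) metis

lemma vg_degree_tope_parity:
  assumes "{} \<in> zero_set E ` \<L>" "odd_chain E \<L> {} k" "\<not> odd_chain E \<L> {} (Suc k)"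
  shows "vg_degree E \<L> (tope_parity E) = k"
  unfolding vg_degree_def
proof (rule Least_equality)
  show "vg_filtration E \<L> k (tope_parity E)"
    using low_degree_parity[OF assms(1,3)] by (simp add: vg_filtration_iff_low_degree)
  fix j assume "vg_filtration E \<L> j (tope_parity E)"
  then have j: "low_degree E \<L> {} (Suc j) (tope_parity E)" by (simp add: vg_filtration_iff_low_degree)
  obtain Ds Y where "covector_chain E \<L> {} Ds Y" "length Ds = k" "chain_diff Ds (tope_parity E) Y \<noteq> 0"
    using odd_chain_ex_chain_diff[OF assms(2,1)] by (auto simp: tope_parity_eq_sign_monom)
  then show "k \<le> j" using chain_diff_low_degree[OF j] by (metis not_less_eq_eq)
qed

lemma odd_chain_le_card:
  assumes "odd_chain E \<L> G p" "G \<subseteq> E"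
  shows "p \<le> card (E - G)"
  using assms
proof (induction p arbitrary: G)
  case (Suc p)
  then obtain F where F: "F \<in> zero_set E ` \<L>" "G \<subset> F" "odd_chain E \<L> F p" by auto
  then have "F \<subseteq> E" using zero_set_subset by auto
  then have "p \<le> card (E - F)" using Suc.IH F(3) by blast
  also have "\<dots> < card (E - G)" using F(2) \<open>F \<subseteq> E\<close> finite_ground by (intro psubset_card_mono) auto
  finally show ?case by simp
qed simp

end

section \<open>Odd chains with rank steps of one\<close>

context ranked_oriented_matroid
begin

text \<open>
  The flats covering \<open>G\<close> inside \<open>K\<close> partition \<open>K - G\<close>, so one of the parts is odd.
\<close>

lemma ex_odd_cover:
  assumes "G \<in> zero_set E ` \<L>" "K \<in> zero_set E ` \<L>" "G \<subseteq> K" "odd (card (K - G))"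
  shows "\<exists>H\<in>zero_set E ` \<L>. G \<subset> H \<and> H \<subseteq> K \<and> r H = Suc (r G) \<and> odd (card (H - G))"
proof -
  have KE: "K \<subseteq> E" using assms(2) zero_set_subset by auto
  have "\<exists>H. H \<in> zero_set E ` \<L> \<and> insert e G \<subseteq> H \<and> r H = Suc (r G) \<and>
      (\<forall>F\<in>zero_set E ` \<L>. insert e G \<subseteq> F \<longrightarrow> H \<subseteq> F)" if e: "e \<in> K - G" for e
  proof -
    have eG: "insert e G \<subseteq> E" "G \<subseteq> E" using e KE assms(3) by auto
    obtain W where W: "W \<in> \<L>" "insert e G \<subseteq> zero_set E W"
      "\<forall>Y\<in>\<L>. insert e G \<subseteq> zero_set E Y \<longrightarrow> zero_set E W \<subseteq> zero_set E Y"
      using ex_generic_covector[OF eG(1)] by blast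
    have "r G < r (insert e G)" using zero_sets[OF eG(2)] assms(1) e eG by blast
    then have "r (insert e G) = Suc (r G)" using r_insert_le[of G e] eG by force
    then show ?thesis using W r_generic[OF eG(1) W] by (intro exI[of _ "zero_set E W"]) auto
  qed
  then have "\<exists>H. \<forall>e\<in>K - G. H e \<in> zero_set E ` \<L> \<and> insert e G \<subseteq> H e \<and> r (H e) = Suc (r G) \<and>
      (\<forall>F\<in>zero_set E ` \<L>. insert e G \<subseteq> F \<longrightarrow> H e \<subseteq> F)"
    by (intro bchoice ballI)
  then obtain H where "\<forall>e\<in>K - G. H e \<in> zero_set E ` \<L> \<and> insert e G \<subseteq> H e \<and> r (H e) = Suc (r G) \<and>
      (\<forall>F\<in>zero_set E ` \<L>. insert e G \<subseteq> F \<longrightarrow> H e \<subseteq> F)" ..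
  then have H: "\<And>e. e \<in> K - G \<Longrightarrow> H e \<in> zero_set E ` \<L>" "\<And>e. e \<in> K - G \<Longrightarrow> insert e G \<subseteq> H e"
    "\<And>e. e \<in> K - G \<Longrightarrow> r (H e) = Suc (r G)"
    "\<And>e F. e \<in> K - G \<Longrightarrow> F \<in> zero_set E ` \<L> \<Longrightarrow> insert e G \<subseteq> F \<Longrightarrow> H e \<subseteq> F"
    by (simp_all only:)
  have HK: "H e \<subseteq> K" if "e \<in> K - G" for e using H(4)[OF that assms(2)] that assms(3) by blast
  \<comment> \<open>The covers are disjoint outside \<open>G\<close>: a proper inclusion between two
    of them would raise the rank, but all have rank \<open>Suc (r G)\<close>.\<close>
  have same: "H g = H e" if e: "e \<in> K - G" and g: "g \<in> H e - G" for e g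
  proof -
    have g': "g \<in> K - G" using g HK[OF e] by blast
    have sub: "H g \<subseteq> H e" using H(4)[OF g' H(1)[OF e]] g H(2)[OF e] by blast
    show ?thesis
    proof (rule ccontr)
      assume "H g \<noteq> H e"
      then obtain f where f: "f \<in> H e - H g" using sub by blast
      have "H e \<subseteq> E" using HK[OF e] KE by blast
      then have "r (H g) < r (insert f (H g))" using zero_sets[of "H g"] H(1)[OF g'] f sub by blast
      also have "\<dots> \<le> r (H e)" using f sub \<open>H e \<subseteq> E\<close> by (intro r_mono) auto
      finally show False using H(3)[OF e] H(3)[OF g'] by simp
    qed
  qed
  let ?P = "(\<lambda>e. H e - G) ` (K - G)"
  have "K - G = \<Union>?P" using H(2) HK by blast
  moreover have "card (\<Union>?P) = sum card ?P"
  proof (rule card_Union_disjoint)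
    show "pairwise disjnt ?P" unfolding pairwise_def disjnt_def using same by blast
    show "finite A" if "A \<in> ?P" for A
      using that HK KE finite_ground finite_subset by (metis (no_types, lifting) Diff_subset imageE)
  qed
  ultimately have "odd (sum card ?P)" using assms(4) by simp
  then obtain A where "A \<in> ?P" "odd (card A)" by (meson dvd_sum)
  then obtain e where e: "e \<in> K - G" "odd (card (H e - G))" by blast
  then show ?thesis using H(1-3)[OF e(1)] HK[OF e(1)] by (intro bexI[of _ "H e"]) auto
qed

text \<open>\<open>K\<close> runs through the given chain while \<open>G\<close> climbs below it one
  rank at a time, with \<open>card (K - G)\<close> kept even. The next flat \<open>K'\<close> makes
  \<open>card (K' - G)\<close> odd, so \<open>G\<close> has an odd cover \<open>H\<close> inside
  \<open>K'\<close>, and \<open>card (K' - H)\<close> is even again.\<close>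

lemma odd_chain_rank_chain:
  assumes "odd_chain E \<L> K p" "K \<in> zero_set E ` \<L>" "G \<in> zero_set E ` \<L>" "G \<subseteq> K" "even (card (K - G))"
  shows "\<exists>F. F 0 = G \<and> (\<forall>i\<le>p. F i \<in> zero_set E ` \<L> \<and> r (F i) = r G + i) \<and>
    (\<forall>i<p. F i \<subset> F (Suc i) \<and> odd (card (F (Suc i) - F i)))"
  using assms
proof (induction p arbitrary: K G)
  case 0
  then show ?case by (intro exI[of _ "\<lambda>_. G"]) auto
next
  case (Suc p)
  then obtain K' where K': "K' \<in> zero_set E ` \<L>" "K \<subset> K'" "odd (card (K' - K))" "odd_chain E \<L> K' p" by auto
  have "K' \<subseteq> E" using K'(1) zero_set_subset by auto
  then have finK: "finite K'" using finite_ground finite_subset by blast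
  have "card (K' - G) = card (K' - K) + card (K - G)"
  proof -
    have "K' - G = (K' - K) \<union> (K - G)" using Suc.prems(4) K'(2) by auto
    moreover have "card \<dots> = card (K' - K) + card (K - G)"
      using finK K'(2) by (intro card_Un_disjoint) (auto intro: finite_subset)
    ultimately show ?thesis by simp
  qed
  then have "odd (card (K' - G))" using K'(3) Suc.prems(5) by simp
  then obtain H where H: "H \<in> zero_set E ` \<L>" "G \<subset> H" "H \<subseteq> K'" "r H = Suc (r G)" "odd (card (H - G))"
    using ex_odd_cover[OF Suc.prems(3) K'(1)] Suc.prems(4) K'(2) by blast
  have "card (K' - G) = card (K' - H) + card (H - G)"
  proof -
    have "K' - G = (K' - H) \<union> (H - G)" using H by auto
    moreover have "card \<dots> = card (K' - H) + card (H - G)"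
      using finK H(3) by (intro card_Un_disjoint) (auto intro: finite_subset)
    ultimately show ?thesis by simp
  qed
  then have "even (card (K' - H))" using H(5) \<open>odd (card (K' - G))\<close> by simp
  from Suc.IH[OF K'(4,1) H(1,3) this] obtain F where F: "F 0 = H"
    "\<forall>i\<le>p. F i \<in> zero_set E ` \<L> \<and> r (F i) = r H + i"
    "\<forall>i<p. F i \<subset> F (Suc i) \<and> odd (card (F (Suc i) - F i))" by blast
  show ?case
  proof (intro exI[of _ "case_nat G F"] conjI allI impI)
    fix i assume "i \<le> Suc p"
    then show "case_nat G F i \<in> zero_set E ` \<L>" "r (case_nat G F i) = r G + i"
      using F(2) H(4) Suc.prems(3) by (auto split: nat.splits)
  next
    fix i assume "i < Suc p"
    then show "case_nat G F i \<subset> case_nat G F (Suc i)"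
      "odd (card (case_nat G F (Suc i) - case_nat G F i))"
      using F(1,3) H(2,5) by (auto split: nat.splits)
  qed simp
qed

end

lemma orientation_ranked:
  assumes "orientation E \<B> \<L>"
  shows "ranked_oriented_matroid E \<L> (rank \<B>)"
proof -
  interpret matroid E \<B> using assms by (simp add: orientation_def)
  interpret oriented_matroid E \<L> using assms by (simp add: orientation_def)
  have flats: "zero_set E ` \<L> = {F. flat E \<B> F}" using assms by (simp add: orientation_def)
  show ?thesis
    by unfold_locales
       (use rank_empty rank_insert_ge rank_insert_le rank_submodular in \<open>auto simp: flats flat_def\<close>)
qed

lemma odd_flat_chain_iff:
  assumes "orientation E \<B> \<L>" "loopless E \<B>"
  shows "(\<exists>F. odd_flat_chain E \<B> p F) \<longleftrightarrow> odd_chain E \<L> {} p"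
proof
  interpret ranked_oriented_matroid E \<L> "rank \<B>" by (rule orientation_ranked[OF assms(1)])
  have flats: "flat E \<B> F \<longleftrightarrow> F \<in> zero_set E ` \<L>" for F using assms(1) by (auto simp: orientation_def)
  {
    assume "\<exists>F. odd_flat_chain E \<B> p F"
    then obtain F where F: "F 0 = {}" "\<forall>i\<le>p. F i \<in> zero_set E ` \<L>"
      "\<forall>i<p. F i \<subset> F (Suc i) \<and> odd (card (F (Suc i) - F i))"
      unfolding odd_flat_chain_def flats by blast
    have "odd_chain E \<L> (F (p - i)) i" if "i \<le> p" for i
      using that
    proof (induction i)
      case (Suc i)
      then have "Suc (p - Suc i) = p - i" by simp
      moreover have "p - Suc i < p" using Suc.prems by simp
      ultimately have "F (p - Suc i) \<subset> F (p - i)" "odd (card (F (p - i) - F (p - Suc i)))"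
        using F(3) by (metis, metis)
      moreover have "F (p - i) \<in> zero_set E ` \<L>" using F(2) by simp
      moreover have "odd_chain E \<L> (F (p - i)) i" using Suc by simp
      ultimately show ?case by (simp only: odd_chain.simps) (rule bexI[of _ "F (p - i)"], simp_all)
    qed simp
    from this[of p] show "odd_chain E \<L> {} p" using F(1) by simp
  }
  {
    assume "odd_chain E \<L> {} p"
    moreover have "{} \<in> zero_set E ` \<L>"
      using assms(2) by (simp add: flats[symmetric] flat_def loopless_def r_empty)
    ultimately have "\<exists>F. F 0 = {} \<and> (\<forall>i\<le>p. F i \<in> zero_set E ` \<L> \<and> rank \<B> (F i) = rank \<B> {} + i) \<and>
        (\<forall>i<p. F i \<subset> F (Suc i) \<and> odd (card (F (Suc i) - F i)))"
      by (intro odd_chain_rank_chain[of "{}"]) auto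
    then show "\<exists>F. odd_flat_chain E \<B> p F"
      unfolding odd_flat_chain_def flats r_empty by simp
  }
qed

lemma odd_chain_length_spec:
  assumes "orientation E \<B> \<L>" "loopless E \<B>"
  shows "odd_chain E \<L> {} (odd_chain_length E \<B>)" "\<not> odd_chain E \<L> {} (Suc (odd_chain_length E \<B>))"
proof -
  interpret ranked_oriented_matroid E \<L> "rank \<B>" by (rule orientation_ranked[OF assms(1)])
  let ?S = "{p. odd_chain E \<L> {} p}"
  have eq: "odd_chain_length E \<B> = Max ?S"
    unfolding odd_chain_length_def odd_flat_chain_iff[OF assms] ..
  have fin: "finite ?S" by (rule finite_subset[of _ "{..card E}"]) (use odd_chain_le_card in fastforce)+
  have "0 \<in> ?S" by simp
  then have "Max ?S \<in> ?S" using fin Max_in by blast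
  then show "odd_chain E \<L> {} (odd_chain_length E \<B>)" unfolding eq by blast
  show "\<not> odd_chain E \<L> {} (Suc (odd_chain_length E \<B>))"
  proof
    assume "odd_chain E \<L> {} (Suc (odd_chain_length E \<B>))"
    then have "Suc (Max ?S) \<in> ?S" unfolding eq by blast
    then show False using Max_ge[OF fin] by fastforce
  qed
qed

section \<open>Behaviour at the pole\<close>

text \<open>With \<open>x = B e * C e\<close>, the factor at \<open>e\<close> is
  \<open>x * ((1 - s) / 2 * x + (1 + s) / 2)\<close>, which takes the values \<open>1\<close> and
  \<open>- s\<close>. The leading \<open>x\<close> is the conjugation by the parity function; the
  affine part has positive coefficients, and these multiply to the eigenvalues.\<close>

lemma (in oriented_matroid) tope_kernel_expansion:
  assumes "B \<in> topes E \<L>" "C \<in> topes E \<L>"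
  shows "tope_kernel (- s) E B C = sign_monom E B * sign_monom E C *
    (\<Sum>S\<in>Pow E. ((1 - s) / 2) ^ card S * ((1 + s) / 2) ^ card (E - S) * (sign_monom S B * sign_monom S C))"
proof -
  let ?b = "\<lambda>e. real_of_int (B e)" and ?c = "\<lambda>e. real_of_int (C e)"
  have "tope_kernel (- s) E B C = (\<Prod>e\<in>E. (?b e * ?c e) * ((1 - s) / 2 * (?b e * ?c e) + (1 + s) / 2))"
    unfolding tope_kernel_def
  proof (intro prod.cong refl)
    fix e assume e: "e \<in> E"
    then have "B e = 1 \<or> B e = - 1" "C e = 1 \<or> C e = - 1"
      using assms covector_values[of B e] covector_values[of C e] by (auto simp: topes_def)
    then show "(if B e = C e then 1 else - s) = (?b e * ?c e) * ((1 - s) / 2 * (?b e * ?c e) + (1 + s) / 2)"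
      by (auto simp: field_simps)
  qed
  also have "\<dots> = sign_monom E B * sign_monom E C * (\<Prod>e\<in>E. (1 - s) / 2 * (?b e * ?c e) + (1 + s) / 2)"
    by (simp add: prod.distrib sign_monom_def)
  also have "(\<Prod>e\<in>E. (1 - s) / 2 * (?b e * ?c e) + (1 + s) / 2) =
      (\<Sum>S\<in>Pow E. (\<Prod>e\<in>S. (1 - s) / 2 * (?b e * ?c e)) * (\<Prod>e\<in>E - S. (1 + s) / 2))"
    by (rule prod_add[OF finite_ground])
  also have "\<dots> = (\<Sum>S\<in>Pow E. ((1 - s) / 2) ^ card S * ((1 + s) / 2) ^ card (E - S) * (sign_monom S B * sign_monom S C))"
    by (intro sum.cong refl) (simp only: prod.distrib prod_constant sign_monom_def mult_ac)
  finally show ?thesis .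
qed

text \<open>\<open>W\<close> collects the moments of the conjugated weighting. Pairing that
  weighting with the parity function gives the total mass, so every expansion of the parity function
  yields a formula for the mass. The expansion provided by the weighting equation itself yields the
  positive quadratic form.\<close>

lemma (in oriented_matroid) weighting_fourier:
  assumes "\<forall>B\<in>topes E \<L>. (\<Sum>C\<in>topes E \<L>. tope_kernel (- s) E B C * \<omega> C) = 1"
  defines "a \<equiv> \<lambda>S. ((1 - s) / 2) ^ card S * ((1 + s) / 2) ^ card (E - S)"
    and "W \<equiv> \<lambda>S. \<Sum>C\<in>topes E \<L>. sign_monom S C * (sign_monom E C * \<omega> C)"
  shows "\<And>B. B \<in> topes E \<L> \<Longrightarrow> sign_monom E B = (\<Sum>S\<in>Pow E. a S * W S * sign_monom S B)"
    and "(\<Sum>C\<in>topes E \<L>. \<omega> C) = (\<Sum>S\<in>Pow E. a S * (W S)\<^sup>2)"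
    and "\<And>c. \<lbrakk>\<And>B. B \<in> topes E \<L> \<Longrightarrow> sign_monom E B = (\<Sum>S\<in>\<S>. c S * sign_monom S B)\<rbrakk> \<Longrightarrow>
      (\<Sum>C\<in>topes E \<L>. \<omega> C) = (\<Sum>S\<in>\<S>. c S * W S)"
proof -
  have sq: "sign_monom E C * sign_monom E C = 1" if "C \<in> topes E \<L>" for C
  proof -
    have "real_of_int (C e) * real_of_int (C e) = 1" if "e \<in> E" for e
      using that \<open>C \<in> topes E \<L>\<close> covector_values[of C e] by (auto simp: topes_def)
    then show ?thesis by (simp add: sign_monom_def flip: prod.distrib)
  qed
  have pair: "(\<Sum>C\<in>topes E \<L>. \<omega> C) = (\<Sum>S\<in>\<S>. c S * W S)"
    if c: "\<And>B. B \<in> topes E \<L> \<Longrightarrow> sign_monom E B = (\<Sum>S\<in>\<S>. c S * sign_monom S B)" for c \<S>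
  proof -
    have "(\<Sum>C\<in>topes E \<L>. \<omega> C) = (\<Sum>C\<in>topes E \<L>. sign_monom E C * (sign_monom E C * \<omega> C))"
      using sq by (intro sum.cong refl) (simp flip: mult.assoc)
    also have "\<dots> = (\<Sum>C\<in>topes E \<L>. (\<Sum>S\<in>\<S>. c S * sign_monom S C) * (sign_monom E C * \<omega> C))"
      using c by (intro sum.cong refl) simp
    also have "\<dots> = (\<Sum>S\<in>\<S>. \<Sum>C\<in>topes E \<L>. c S * sign_monom S C * (sign_monom E C * \<omega> C))"
      unfolding sum_distrib_right by (rule sum.swap)
    finally show ?thesis by (simp add: W_def sum_distrib_left mult.assoc)
  qed
  then show "\<And>c. \<lbrakk>\<And>B. B \<in> topes E \<L> \<Longrightarrow> sign_monom E B = (\<Sum>S\<in>\<S>. c S * sign_monom S B)\<rbrakk> \<Longrightarrow>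
      (\<Sum>C\<in>topes E \<L>. \<omega> C) = (\<Sum>S\<in>\<S>. c S * W S)" .
  show parity: "sign_monom E B = (\<Sum>S\<in>Pow E. a S * W S * sign_monom S B)" if B: "B \<in> topes E \<L>" for B
  proof -
    have "sign_monom E B = sign_monom E B * (\<Sum>C\<in>topes E \<L>. tope_kernel (- s) E B C * \<omega> C)"
      using assms(1) B by simp
    also have "\<dots> = (\<Sum>C\<in>topes E \<L>. (sign_monom E B * sign_monom E B) *
        (\<Sum>S\<in>Pow E. a S * (sign_monom S B * sign_monom S C)) * (sign_monom E C * \<omega> C))"
      unfolding sum_distrib_left[of "sign_monom E B"]
      by (intro sum.cong refl) (simp add: tope_kernel_expansion[OF B] a_def mult_ac)
    also have "\<dots> = (\<Sum>S\<in>Pow E. \<Sum>C\<in>topes E \<L>. a S * (sign_monom S B * sign_monom S C) * (sign_monom E C * \<omega> C))"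
      unfolding sq[OF B] mult_1 sum_distrib_right by (rule sum.swap)
    finally show ?thesis by (simp add: W_def sum_distrib_left sum_distrib_right mult_ac)
  qed
  show "(\<Sum>C\<in>topes E \<L>. \<omega> C) = (\<Sum>S\<in>Pow E. a S * (W S)\<^sup>2)"
    using pair[OF parity] by (simp add: power2_eq_square mult.assoc)
qed

text \<open>
  The upper bound uses an expansion of the parity function in monomials of degree at most \<open>k\<close>, the
  lower bound a functional killing all monomials of degree less than \<open>k\<close> but not the parity.
\<close>

lemma (in oriented_matroid) weighting_bounds:
  assumes "{} \<in> zero_set E ` \<L>" "odd_chain E \<L> {} k" "\<not> odd_chain E \<L> {} (Suc k)"
  shows "\<exists>c C. 0 < c \<and> (\<forall>s \<omega>. 0 < s \<and> s < 1 \<and>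
    (\<forall>B\<in>topes E \<L>. (\<Sum>C\<in>topes E \<L>. tope_kernel (- s) E B C * \<omega> C) = 1) \<longrightarrow>
    c \<le> (1 - s) ^ k * (\<Sum>C\<in>topes E \<L>. \<omega> C) \<and> (1 - s) ^ k * (\<Sum>C\<in>topes E \<L>. \<omega> C) \<le> C)"
proof -
  have parity: "tope_parity E = sign_monom E" by (simp add: tope_parity_eq_sign_monom)
  let ?K = "{S. S \<subseteq> E \<and> card S < Suc k}"
  obtain c where c: "\<And>B. B \<in> topes E \<L> \<Longrightarrow> sign_monom E B = (\<Sum>S\<in>?K. c S * sign_monom S B)"
    using low_degree_parity[OF assms(1,3)] by (auto simp: low_degree_def parity topes_iff_zero_set)
  obtain Ds Y where chain: "covector_chain E \<L> {} Ds Y" "length Ds = k" "chain_diff Ds (sign_monom E) Y \<noteq> 0"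
    using odd_chain_ex_chain_diff[OF assms(2,1)] by auto
  let ?\<Lambda> = "\<lambda>S. chain_diff Ds (sign_monom S) Y"
  let ?H = "{S. S \<subseteq> E \<and> k \<le> card S}"
  \<comment> \<open>\<open>M\<close> and \<open>N\<close> involve neither \<open>s\<close> nor the
    weighting, so the bounds are uniform.\<close>
  define M where "M = (\<Sum>S\<in>?H. (?\<Lambda> S)\<^sup>2)"
  define N where "N = (\<Sum>S\<in>?K. 2 ^ card E * (c S)\<^sup>2)"
  have finK: "finite ?K" and finH: "finite ?H" using finite_ground by simp_all
  have "k \<le> card E"
    using chain_diff_sign_monom_low[OF chain(1), of E] chain(2,3) by (meson not_le order_refl)
  then have "E \<in> ?H" by simp
  then have "(?\<Lambda> E)\<^sup>2 \<le> M" unfolding M_def by (intro member_le_sum finH) auto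
  then have M: "0 < M" using chain(3) by (meson less_le_trans zero_less_power2)
  have main: "(?\<Lambda> E)\<^sup>2 / M \<le> (1 - s) ^ k * (\<Sum>C\<in>topes E \<L>. \<omega> C)
      \<and> (1 - s) ^ k * (\<Sum>C\<in>topes E \<L>. \<omega> C) \<le> N"
    if s: "0 < s" "s < 1" and \<omega>: "\<forall>B\<in>topes E \<L>. (\<Sum>C\<in>topes E \<L>. tope_kernel (- s) E B C * \<omega> C) = 1" for s \<omega>
  proof -
    define m where "m = (\<Sum>C\<in>topes E \<L>. \<omega> C)"
    define a where "a S = ((1 - s) / 2) ^ card S * ((1 + s) / 2) ^ card (E - S)" for S
    define W where "W S = (\<Sum>C\<in>topes E \<L>. sign_monom S C * (sign_monom E C * \<omega> C))" for S
    note fourier = weighting_fourier[OF \<omega>, folded a_def[abs_def] W_def[abs_def] m_def]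
    have a_pos: "0 < a S" for S using s by (simp add: a_def)
    have m_eq: "m = (\<Sum>S\<in>Pow E. a S * (W S)\<^sup>2)" using fourier(2) by (simp add: a_def W_def)
    have part: "(\<Sum>S\<in>J. a S * (W S)\<^sup>2) \<le> m" if "J \<subseteq> Pow E" for J
      unfolding m_eq using that finite_ground less_imp_le[OF a_pos] by (intro sum_mono2) simp_all
    have "m * (1 - s) ^ k \<le> N"
    proof -
      have "m = (\<Sum>S\<in>?K. c S * W S)" using fourier(3)[OF c] by (simp add: W_def)
      \<comment> \<open>Weighted arithmetic-geometric mean inequality. The terms
        \<open>a S * (W S)\<^sup>2\<close> add up to at most \<open>m\<close>, so half of
        \<open>m\<close> is absorbed on the left and \<open>W\<close> disappears from the
        bound.\<close>
      also have "\<dots> \<le> (\<Sum>S\<in>?K. ((c S)\<^sup>2 / a S + a S * (W S)\<^sup>2) / 2)"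
      proof (intro sum_mono)
        fix S
        have "0 \<le> (c S - a S * W S)\<^sup>2 / a S" using a_pos[of S] by simp
        also have "\<dots> = (c S)\<^sup>2 / a S + a S * (W S)\<^sup>2 - 2 * (c S * W S)"
          using a_pos[of S] by (simp add: field_simps power2_eq_square)
        finally show "c S * W S \<le> ((c S)\<^sup>2 / a S + a S * (W S)\<^sup>2) / 2" by simp
      qed
      also have "\<dots> = ((\<Sum>S\<in>?K. (c S)\<^sup>2 / a S) + (\<Sum>S\<in>?K. a S * (W S)\<^sup>2)) / 2"
        by (simp add: sum.distrib flip: sum_divide_distrib)
      finally have "m \<le> (\<Sum>S\<in>?K. (c S)\<^sup>2 / a S)"
        using part[of ?K, OF subsetI] by auto
      then have "m * (1 - s) ^ k \<le> (\<Sum>S\<in>?K. (c S)\<^sup>2 / a S) * (1 - s) ^ k"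
        using s by (intro mult_right_mono) auto
      also have "\<dots> \<le> N"
        unfolding N_def sum_distrib_right
      proof (intro sum_mono)
        fix S assume S: "S \<in> ?K"
        have finS: "finite S" "card S + card (E - S) = card E"
          using S finite_ground finite_subset[of S E] card_mono[of E S] by (auto simp: card_Diff_subset)
        \<comment> \<open>The factor \<open>2 ^ card E\<close> in \<open>N\<close> pays for the
          halves in \<open>a S\<close>, as \<open>(1 + s) / 2\<close> is at least
          \<open>1 / 2\<close>.\<close>
        have "(1 - s) ^ k \<le> (1 - s) ^ card S" using S s by (intro power_decreasing) auto
        also have "\<dots> = 2 ^ card E * (((1 - s) / 2) ^ card S * (1 / 2) ^ card (E - S))"
          by (simp add: finS(2)[symmetric] power_add power_divide)
        also have "\<dots> \<le> 2 ^ card E * a S"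
          unfolding a_def using s by (intro mult_left_mono power_mono) auto
        finally have "(c S)\<^sup>2 / a S * (1 - s) ^ k \<le> (c S)\<^sup>2 / a S * (2 ^ card E * a S)"
          using a_pos[of S] by (intro mult_left_mono) auto
        also have "\<dots> = 2 ^ card E * (c S)\<^sup>2" using a_pos[of S] by (simp add: field_simps)
        finally show "(c S)\<^sup>2 / a S * (1 - s) ^ k \<le> 2 ^ card E * (c S)\<^sup>2" .
      qed
      finally show ?thesis .
    qed
    moreover have "(?\<Lambda> E)\<^sup>2 \<le> m * (1 - s) ^ k * M"
    proof -
      have "?\<Lambda> E = chain_diff Ds (\<lambda>X. \<Sum>S\<in>Pow E. a S * W S * sign_monom S X) Y"
        using fourier(1) by (intro chain_diff_cong[OF chain(1)]) (auto simp: topes_iff_zero_set a_def W_def)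
      also have "\<dots> = (\<Sum>S\<in>Pow E. a S * W S * ?\<Lambda> S)" by (rule chain_diff_sum)
      also have "\<dots> = (\<Sum>S\<in>?H. a S * W S * ?\<Lambda> S)"
      proof (intro sum.mono_neutral_right ballI)
        fix S assume "S \<in> Pow E - ?H"
        then have "?\<Lambda> S = 0"
          using chain(2) by (intro chain_diff_sign_monom_low[OF chain(1)]) auto
        then show "a S * W S * ?\<Lambda> S = 0" by simp
      qed (use finite_ground in auto)
      \<comment> \<open>Splitting \<open>a S\<close> evenly prepares Cauchy-Schwarz: one factor is
        part of the quadratic form \<open>m\<close>, the other is small because
        \<open>a S \<le> (1 - s) ^ k\<close> once \<open>k \<le> card S\<close>.\<close>
      also have "\<dots> = (\<Sum>S\<in>?H. (sqrt (a S) * W S) * (sqrt (a S) * ?\<Lambda> S))"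
        using a_pos by (intro sum.cong refl) (simp add: less_imp_le)
      finally have "(?\<Lambda> E)\<^sup>2 \<le> (\<Sum>S\<in>?H. (sqrt (a S) * W S)\<^sup>2) * (\<Sum>S\<in>?H. (sqrt (a S) * ?\<Lambda> S)\<^sup>2)"
        by (simp only: Cauchy_Schwarz_ineq_sum)
      also have "\<dots> \<le> m * (\<Sum>S\<in>?H. (1 - s) ^ k * (?\<Lambda> S)\<^sup>2)"
      proof (rule mult_mono[OF _ sum_mono])
        show "(\<Sum>S\<in>?H. (sqrt (a S) * W S)\<^sup>2) \<le> m"
        proof -
          have "(\<Sum>S\<in>?H. (sqrt (a S) * W S)\<^sup>2) = (\<Sum>S\<in>?H. a S * (W S)\<^sup>2)"
            by (intro sum.cong refl) (simp add: power_mult_distrib less_imp_le[OF a_pos])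
          also have "\<dots> \<le> m" by (rule part) auto
          finally show ?thesis .
        qed
        show "0 \<le> m" unfolding m_eq by (intro sum_nonneg) (simp add: less_imp_le[OF a_pos])
        fix S assume S: "S \<in> ?H"
        have "a S \<le> (1 - s) ^ card S * 1"
          unfolding a_def using s by (intro mult_mono power_mono power_le_one) auto
        also have "\<dots> \<le> (1 - s) ^ k" using S s by (simp add: power_decreasing)
        finally show "(sqrt (a S) * ?\<Lambda> S)\<^sup>2 \<le> (1 - s) ^ k * (?\<Lambda> S)\<^sup>2"
          using a_pos[of S] by (simp add: power_mult_distrib mult_right_mono)
      qed (auto intro: sum_nonneg)
      finally show ?thesis by (simp add: M_def sum_distrib_left mult_ac)
    qed
    ultimately show ?thesis using M by (simp add: m_def[symmetric] field_simps)
  qed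
  have "0 < (?\<Lambda> E)\<^sup>2 / M" using M chain(3) by simp
  then show ?thesis using main by blast
qed

text \<open>A nonzero rational function is an integral power of \<open>1 + z\<close> times a factor
  \<open>g\<close> regular and nonzero at \<open>-1\<close>, so its order is visible on one ray. The
  lower bound excludes a smaller pole order, the upper bound a larger one, and then
  \<open>g (- 1)\<close> is a limit of real numbers that are at least \<open>c\<close>.\<close>

lemma rational_pole_of_radial_bounds:
  fixes P Q :: "complex poly" and m :: "real \<Rightarrow> real"
  defines "f \<equiv> \<lambda>z. poly P z / poly Q z"
  assumes "Q \<noteq> 0" "0 < c"
    and radial: "\<And>s. 0 < s \<Longrightarrow> s < 1 \<Longrightarrow>
      f (- of_real s) = of_real (m s) \<and> c \<le> (1 - s) ^ k * m s \<and> (1 - s) ^ k * m s \<le> C"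
  shows "pole_order f (- 1) = k \<and>
    (\<exists>L::real. L > 0 \<and> ((\<lambda>q. (1 + q) ^ k * f q) \<longlongrightarrow> complex_of_real L) (at (- 1)))"
proof -
  have "P \<noteq> 0"
  proof
    assume "P = 0"
    then have "m (1 / 2) = 0" using radial[of "1 / 2"] by (simp add: f_def)
    then show False using radial[of "1 / 2"] assms(3) by simp
  qed
  from order_decomp[OF this, of "- 1"] obtain P1 where P1: "P = [:1, 1:] ^ order (- 1) P * P1" "\<not> [:1, 1:] dvd P1"
    by auto
  from order_decomp[OF assms(2), of "- 1"] obtain Q1 where Q1: "Q = [:1, 1:] ^ order (- 1) Q * Q1" "\<not> [:1, 1:] dvd Q1"
    by auto
  define a where "a = order (- 1) P"
  define b where "b = order (- 1) Q"
  define g where "g z = poly P1 z / poly Q1 z" for z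
  have ne: "poly P1 (- 1) \<noteq> 0" "poly Q1 (- 1) \<noteq> 0"
    using P1(2) Q1(2) poly_eq_0_iff_dvd[of _ "- 1"] by auto
  then have g1: "g (- 1) \<noteq> 0" by (simp add: g_def)
  have f_eq: "f z = (1 + z) ^ a * g z / (1 + z) ^ b" for z
  proof -
    have "poly P z = (1 + z) ^ a * poly P1 z" by (subst P1(1)) (simp add: a_def poly_power)
    moreover have "poly Q z = (1 + z) ^ b * poly Q1 z" by (subst Q1(1)) (simp add: b_def poly_power)
    ultimately show ?thesis by (simp add: f_def g_def)
  qed
  have g_cont: "isCont g (- 1)" unfolding g_def using ne by (intro continuous_intros) auto
  have left: "eventually (\<lambda>s. 0 < s \<and> s < (1 :: real)) (at_left 1)"
    by (rule eventually_at_leftI[of 0]) auto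
  have g_lim: "((\<lambda>s. g (- of_real s)) \<longlongrightarrow> g (- 1)) (at_left 1)"
    using isCont_tendsto_compose[OF g_cont, of "\<lambda>s. - of_real s" "at_left 1"]
    by (force intro!: tendsto_eq_intros)
  have ng_lim: "((\<lambda>s. norm (g (- of_real s))) \<longlongrightarrow> norm (g (- 1))) (at_left 1)"
    by (intro tendsto_norm g_lim)
  have radial_norm: "(1 - s) ^ k * m s * (1 - s) ^ b = (1 - s) ^ (k + a) * norm (g (- of_real s))"
    if s: "0 < s" "s < 1" for s
  proof -
    have pos: "0 < (1 - s) ^ k * m s" using radial[OF s] assms(3) by linarith
    then have "0 < m s" using s by (simp add: zero_less_mult_iff)
    have "norm (1 - complex_of_real s) = 1 - s"
      using s by (metis abs_of_pos diff_gt_0_iff_gt norm_of_real of_real_1 of_real_diff)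
    moreover have "m s = norm (f (- of_real s))" using radial[OF s] \<open>0 < m s\<close> by simp
    ultimately have "m s = (1 - s) ^ a * norm (g (- of_real s)) / (1 - s) ^ b"
      unfolding f_eq by (simp add: norm_mult norm_divide norm_power)
    then show ?thesis using s by (simp add: power_add)
  qed
  have small: "((\<lambda>s::real. (1 - s) ^ Suc j) \<longlongrightarrow> 0) (at_left 1)" for j
    by (auto intro!: tendsto_eq_intros)
  have "k + a = b"
  proof (rule ccontr)
    assume "k + a \<noteq> b"
    then consider j where "k + a = b + Suc j" | j where "b = k + a + Suc j"
      by (metis less_imp_Suc_add linorder_neqE_nat add_Suc_right)
    then show False
    proof cases
      case 1
      have "((\<lambda>s. (1 - s) ^ Suc j * norm (g (- of_real s))) \<longlongrightarrow> 0 * norm (g (- 1))) (at_left 1)"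
        by (intro tendsto_mult small ng_lim)
      moreover have "eventually (\<lambda>s. c \<le> (1 - s) ^ Suc j * norm (g (- of_real s))) (at_left 1)"
        using left
      proof eventually_elim
        case (elim s)
        then have "(1 - s) ^ k * m s = (1 - s) ^ Suc j * norm (g (- of_real s))"
          using radial_norm[of s] by (simp add: 1 power_add)
        then show ?case using radial[of s] elim by simp
      qed
      ultimately have "c \<le> 0 * norm (g (- 1))"
        by (intro tendsto_lowerbound[of _ _ "at_left 1"]) auto
      then show False using assms(3) by simp
    next
      case 2
      have "((\<lambda>s. C * (1 - s) ^ Suc j - norm (g (- of_real s))) \<longlongrightarrow> C * 0 - norm (g (- 1))) (at_left 1)"
        by (intro tendsto_diff tendsto_mult tendsto_const small ng_lim)
      moreover have "eventually (\<lambda>s. 0 \<le> C * (1 - s) ^ Suc j - norm (g (- of_real s))) (at_left 1)"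
        using left
      proof eventually_elim
        case (elim s)
        then have "(1 - s) ^ k * m s * (1 - s) ^ Suc j = norm (g (- of_real s))"
          using radial_norm[of s] by (simp add: 2 power_add mult_ac)
        moreover have "(1 - s) ^ k * m s * (1 - s) ^ Suc j \<le> C * (1 - s) ^ Suc j"
          using radial[of s] elim by (intro mult_right_mono) auto
        ultimately show ?case by simp
      qed
      ultimately have "0 \<le> C * 0 - norm (g (- 1))"
        by (intro tendsto_lowerbound[of _ _ "at_left 1"]) auto
      then show False using g1 by simp
    qed
  qed
  then have fg: "f z = g z / (1 + z) ^ k" if "z \<noteq> - 1" for z
  proof -
    have "1 + z \<noteq> 0" using that by (simp add: add_eq_0_iff)
    then show ?thesis unfolding f_eq \<open>k + a = b\<close>[symmetric] by (simp add: power_add)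
  qed
  have f_lim: "((\<lambda>q. (1 + q) ^ k * f q) \<longlongrightarrow> g (- 1)) (at (- 1))"
  proof (rule Lim_transform_eventually)
    show "(g \<longlongrightarrow> g (- 1)) (at (- 1))" using g_cont by (simp add: isCont_def)
    show "eventually (\<lambda>q. g q = (1 + q) ^ k * f q) (at (- 1))"
      by (rule eventually_at_ball'[of 1, THEN eventually_mono]) (auto simp: fg add_eq_0_iff)
  qed
  have g_radial: "eventually (\<lambda>s. g (- of_real s) = of_real ((1 - s) ^ k * m s)) (at_left 1)"
    using left
  proof eventually_elim
    case (elim s)
    then have "complex_of_real s \<noteq> 1" by (metis less_irrefl of_real_eq_1_iff)
    then have "g (- of_real s) = (1 - of_real s) ^ k * f (- of_real s)" by (subst fg) auto
    then show ?case using radial[of s] elim by simp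
  qed
  have "Im (g (- 1)) = 0"
  proof (rule tendsto_unique[OF _ tendsto_Im[OF g_lim]])
    have "eventually (\<lambda>s. 0 = Im (g (- complex_of_real s))) (at_left 1)"
      using g_radial by eventually_elim simp
    then show "((\<lambda>s. Im (g (- complex_of_real s))) \<longlongrightarrow> 0) (at_left 1)"
      by (rule Lim_transform_eventually[OF tendsto_const])
  qed simp
  moreover have "c \<le> Re (g (- 1))"
  proof (rule tendsto_lowerbound[OF tendsto_Re[OF g_lim]])
    show "eventually (\<lambda>s. c \<le> Re (g (- complex_of_real s))) (at_left 1)"
      using g_radial left
    proof eventually_elim
      case (elim s)
      then show ?case using radial[of s] by simp
    qed
  qed simp
  ultimately have L: "g (- 1) = complex_of_real (Re (g (- 1)))" "Re (g (- 1)) > 0"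
    using assms(3) by (auto simp: complex_eq_iff)
  \<comment> \<open>For \<open>k = 0\<close> the finite limit excludes a pole, and
    \<open>pole_order\<close> takes its default value.\<close>
  have "pole_order f (- 1) = k"
  proof (cases "k = 0")
    case True
    then have "(f \<longlongrightarrow> g (- 1)) (at (- 1))" using f_lim by simp
    then have "\<not> is_pole f (- 1)"
      unfolding is_pole_def using not_tendsto_and_filterlim_at_infinity[of "at (- 1)" f] by auto
    then show ?thesis using True by (simp add: pole_order_def)
  next
    case False
    define S where "S = {z. poly Q1 z \<noteq> 0}"
    have S: "open S" "- 1 \<in> S" "g holomorphic_on S"
      unfolding S_def g_def using ne
      by (auto intro!: open_Collect_neq continuous_intros holomorphic_intros)
    have "is_pole (\<lambda>w. g w / (w - (- 1)) ^ k) (- 1)"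
      using False by (intro is_pole_basic[OF S(3,1,2) g1]) simp
    moreover have "eventually (\<lambda>w. g w / (w - (- 1)) ^ k = f w) (at (- 1))"
      by (rule eventually_at_ball'[of 1, THEN eventually_mono]) (auto simp: fg add.commute)
    ultimately have "is_pole f (- 1)" by (rule is_pole_transform) simp
    moreover have "zorder f (- 1) = - int k"
      by (rule zorder_eqI[OF S g1])
         (simp add: fg add.commute power_int_minus divide_inverse)
    ultimately show ?thesis by (simp add: pole_order_def)
  qed
  then show ?thesis using f_lim L by metis
qed

theorem theoremC:
  fixes E :: "'a set" and \<B> :: "'a set set"
  assumes "simple_matroid E \<B>" and "orientable E \<B>"
  shows "\<exists>Mag. rational_function Mag \<and> Mag has_fps_expansion magnitude E \<B> \<and>
    pole_order Mag (- 1) = odd_chain_length E \<B> \<and>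
    (\<exists>L::real. L > 0 \<and>
       ((\<lambda>q. (1 + q) ^ odd_chain_length E \<B> * Mag q) \<longlongrightarrow> complex_of_real L) (at (- 1))) \<and>
    (\<forall>\<L>. orientation E \<B> \<L> \<longrightarrow> pole_order Mag (- 1) = vg_degree E \<L> (tope_parity E))"
proof -
  have loopless: "loopless E \<B>" using assms(1) by (simp add: simple_matroid_def)
  interpret matroid E \<B> using assms(1) by (simp add: simple_matroid_def)
  let ?k = "odd_chain_length E \<B>"
  have empty_flat: "{} \<in> zero_set E ` \<L>" if "orientation E \<B> \<L>" for \<L>
  proof -
    have "flat E \<B> {}" using loopless by (simp add: flat_def loopless_def rank_empty)
    then show ?thesis using that by (auto simp: orientation_def)
  qed
  obtain \<L> where or: "orientation E \<B> \<L>" using assms(2) by (auto simp: orientable_def)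
  interpret R: ranked_oriented_matroid E \<L> "rank \<B>" by (rule orientation_ranked[OF or])
  have bounds: "\<exists>c C. 0 < c \<and> (\<forall>s \<omega>. 0 < s \<and> s < 1 \<and>
      (\<forall>B\<in>topes E \<L>. (\<Sum>C\<in>topes E \<L>. tope_kernel (- s) E B C * \<omega> C) = 1) \<longrightarrow>
      c \<le> (1 - s) ^ ?k * (\<Sum>C\<in>topes E \<L>. \<omega> C) \<and> (1 - s) ^ ?k * (\<Sum>C\<in>topes E \<L>. \<omega> C) \<le> C)"
    by (rule R.weighting_bounds[OF empty_flat[OF or] odd_chain_length_spec[OF or loopless]])
  then obtain c C where c: "0 < c" and cC: "\<And>s \<omega>. 0 < s \<Longrightarrow> s < 1 \<Longrightarrow>
      \<forall>B\<in>topes E \<L>. (\<Sum>C\<in>topes E \<L>. tope_kernel (- s) E B C * \<omega> C) = 1 \<Longrightarrow>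
      c \<le> (1 - s) ^ ?k * (\<Sum>C\<in>topes E \<L>. \<omega> C) \<and> (1 - s) ^ ?k * (\<Sum>C\<in>topes E \<L>. \<omega> C) \<le> C" by blast
  obtain P Q where PQ: "\<And>z. norm z < 1 \<Longrightarrow> poly Q z \<noteq> 0 \<and> magnitude_fun (rank \<B>) E z = poly P z / poly Q z"
    using magnitude_fun_rational[OF finite_ground, of "rank \<B>"] by (auto simp: rational_on_disc_def)
  \<comment> \<open>The quotient is used on the whole plane, since \<open>magnitude_fun\<close> is
    known to be given by it only inside the disc.\<close>
  define Mag where "Mag = (\<lambda>z. poly P z / poly Q z)"
  have Q: "Q \<noteq> 0" using PQ[of 0] by auto
  then have rat: "rational_function Mag" unfolding rational_function_def Mag_def by blast
  have "eventually (\<lambda>z. magnitude_fun (rank \<B>) E z = Mag z) (nhds 0)"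
    using eventually_nhds_in_open[of "ball 0 1" "0 :: complex"]
    by (rule eventually_mono[OF _ PQ[THEN conjunct2, folded fun_cong[OF Mag_def]]]) auto
  then have fps: "Mag has_fps_expansion magnitude E \<B>"
    using magnitude_fun_has_fps_expansion[OF finite_ground, of "rank \<B>"] rank_empty
    by (simp add: magnitude_eq_magnitude_fps has_fps_expansion_def eventually_conj_iff)
       (auto elim: eventually_elim2)
  have "\<exists>m. Mag (- of_real s) = of_real m \<and> c \<le> (1 - s) ^ ?k * m \<and> (1 - s) ^ ?k * m \<le> C"
    if s: "0 < s" "s < 1" for s
  proof -
    have "\<bar>- s\<bar> < 1" using s by simp
    from ex_weighting[OF R.ranked_oriented_matroid_axioms this] obtain \<omega> where
      \<omega>: "\<forall>B\<in>topes E \<L>. (\<Sum>C\<in>topes E \<L>. tope_kernel (- s) E B C * \<omega> C) = 1"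
      "magnitude_fun (rank \<B>) E (of_real (- s)) = of_real (\<Sum>C\<in>topes E \<L>. \<omega> C)" by blast
    have "Mag (- of_real s) = of_real (\<Sum>C\<in>topes E \<L>. \<omega> C)"
      using PQ[of "of_real (- s)"] \<omega>(2) s by (simp add: Mag_def)
    then show ?thesis using cC[OF s \<omega>(1)] by blast
  qed
  then obtain m where m: "\<And>s. 0 < s \<Longrightarrow> s < 1 \<Longrightarrow>
      Mag (- of_real s) = of_real (m s) \<and> c \<le> (1 - s) ^ ?k * m s \<and> (1 - s) ^ ?k * m s \<le> C"
    by metis
  have "pole_order Mag (- 1) = ?k \<and>
    (\<exists>L::real. L > 0 \<and> ((\<lambda>q. (1 + q) ^ ?k * Mag q) \<longlongrightarrow> complex_of_real L) (at (- 1)))"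
    unfolding Mag_def by (rule rational_pole_of_radial_bounds[OF Q c m[unfolded Mag_def]])
  \<comment> \<open>The analytic part used one orientation; any other has the same degree because
    \<open>odd_chain_length\<close> does not see the orientation.\<close>
  moreover have "vg_degree E \<L>' (tope_parity E) = ?k" if "orientation E \<B> \<L>'" for \<L>'
  proof -
    interpret R': ranked_oriented_matroid E \<L>' "rank \<B>" by (rule orientation_ranked[OF that])
    show ?thesis by (rule R'.vg_degree_tope_parity[OF empty_flat[OF that] odd_chain_length_spec[OF that loopless]])
  qed
  ultimately show ?thesis using rat fps by metis
qed

end
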